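(* Let $\gamma\in W^{1,\infty}(\Omega)$ with $\inf_{x\in\Omega}\gamma(x)>0$, let $\alpha>0$, let $k\ge 1$ and $p\ge 0$ be integers, and let $\mathcal{T}_h$ be a mesh of $\Omega$. Then for every $f\in L^2(\Omega)$ and every $q\in H^1(\omega)$ there exists exactly one triple $(u_h,\sigma_h,z_h)\in V_k\times RT_p\times X_p$ such that \[ (\gamma\nabla u_h-\sigma_h,\nabla v_h)_\Omega+\alpha(u_h,v_h)_\omega=\alpha(q,v_h)_\omega\quad\text{for all } v_h\in V_k, \] \[ (\nabla u_h-\gamma^{-1}\sigma_h,-\tau_h)_\Omega-(\nabla\cdot\tau_h,z_h)_\Omega=0\quad\text{for all }\tau_h\in RT_p, \] \[ -(\nabla\cdot\sigma_h,y_h)_\Omega=(f,y_h)_\Omega\quad\text{for all } y_h\in X_p . \] (No compatibility between $\gamma$, $f$ and $q$ is assumed.)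
   Context: $\Omega\subset\mathbb{R}^d$ ($d\in\{2,3\}$) is a polygonal/polyhedral domain (bounded, open, connected), and $\omega\subset\Omega$ is a connected open subset of nonzero $d$-dimensional measure. $(v,w)_X=\int_X vw\,dX$ is the $L^2$ scalar product over $X$ (same notation for scalar and vector functions). $\mathcal{T}_h$ is a matching (conforming) tessellation of $\Omega$ into shape regular simplices $T$. $\mathbb{P}_p(T)$ is the space of polynomials of degree at most $p$ on $T$. The discrete spaces are $X_p=\{v\in L^2(\Omega): v|_T\in\mathbb{P}_p(T)\ \forall T\in\mathcal{T}_h\}$, $V_k=X_k\cap H^1(\Omega)$, and the Raviart-Thomas space $RT_p=\{q_h\in H_{div}(\Omega): q_h|_T\in\mathbb{P}_p(T)^d+\vec{x}\,\mathbb{P}_p(T)\ \forall T\in\mathcal{T}_h\}$, where $H_{div}(\Omega)$ is the space of $L^2$ vector fields with divergence in $L^2(\Omega)$. *)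

theory Defs
  imports "HOL-Analysis.Analysis"
begin

section \<open>Lebesgue spaces\<close>

text \<open>
  Elements of Lebesgue and Sobolev spaces are represented by functions on the whole space; only
  their values on the domain \<open>X\<close> matter, and two functions represent the same element iff
  they agree almost everywhere on \<open>X\<close>.
\<close>

definition L2_space :: "(real^'d) set \<Rightarrow> (real^'d \<Rightarrow> 'b::euclidean_space) set" where
  "L2_space X = {v. set_borel_measurable lebesgue X v \<and>
                    set_integrable lebesgue X (\<lambda>x. (norm (v x))\<^sup>2)}"

definition Linf_space :: "(real^'d) set \<Rightarrow> (real^'d \<Rightarrow> 'b::euclidean_space) set" where
  "Linf_space X = {v. set_borel_measurable lebesgue X v \<and>
                      (\<exists>C. AE x\<in>X in lebesgue. norm (v x) \<le> C)}"

definition L2_inner ::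
    "(real^'d) set \<Rightarrow> (real^'d \<Rightarrow> 'b::euclidean_space) \<Rightarrow> (real^'d \<Rightarrow> 'b) \<Rightarrow> real" where
  "L2_inner X v w = (LINT x:X|lebesgue. v x \<bullet> w x)"

definition locally_integrable ::
    "(real^'d) set \<Rightarrow> (real^'d \<Rightarrow> 'b::euclidean_space) \<Rightarrow> bool" where
  "locally_integrable X v \<longleftrightarrow> (\<forall>K. compact K \<and> K \<subseteq> X \<longrightarrow> set_integrable lebesgue K v)"


section \<open>Test functions and weak derivatives\<close>

definition partial_deriv :: "'d \<Rightarrow> (real^'d \<Rightarrow> real) \<Rightarrow> real^'d \<Rightarrow> real" where
  "partial_deriv i \<phi> x = frechet_derivative \<phi> (at x) (axis i 1)"

primrec Ck_fun :: "nat \<Rightarrow> (real^'d \<Rightarrow> real) \<Rightarrow> bool" where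
  "Ck_fun 0 \<phi> \<longleftrightarrow> continuous_on UNIV \<phi>"
| "Ck_fun (Suc n) \<phi> \<longleftrightarrow>
     (\<forall>x. \<phi> differentiable (at x)) \<and> (\<forall>i. Ck_fun n (partial_deriv i \<phi>))"

definition test_functions :: "(real^'d) set \<Rightarrow> (real^'d \<Rightarrow> real) set" where
  "test_functions X = {\<phi>. (\<forall>n. Ck_fun n \<phi>) \<and>
      compact (closure {x. \<phi> x \<noteq> 0}) \<and> closure {x. \<phi> x \<noteq> 0} \<subseteq> X}"

definition has_weak_grad ::
    "(real^'d) set \<Rightarrow> (real^'d \<Rightarrow> real) \<Rightarrow> (real^'d \<Rightarrow> real^'d) \<Rightarrow> bool" where
  "has_weak_grad X u g \<longleftrightarrow> locally_integrable X u \<and> locally_integrable X g \<and>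
     (\<forall>\<phi>\<in>test_functions X. \<forall>i.
        (LINT x:X|lebesgue. u x * partial_deriv i \<phi> x) = - (LINT x:X|lebesgue. g x $ i * \<phi> x))"

definition has_weak_div ::
    "(real^'d) set \<Rightarrow> (real^'d \<Rightarrow> real^'d) \<Rightarrow> (real^'d \<Rightarrow> real) \<Rightarrow> bool" where
  "has_weak_div X \<tau> g \<longleftrightarrow> locally_integrable X \<tau> \<and> locally_integrable X g \<and>
     (\<forall>\<phi>\<in>test_functions X.
        (LINT x:X|lebesgue. \<tau> x \<bullet> (\<chi> i. partial_deriv i \<phi> x)) = - (LINT x:X|lebesgue. g x * \<phi> x))"

text \<open>
  On an open set weak derivatives are unique up to null sets, so the choices below are harmless;
  they are meaningful only for functions that have a weak gradient (divergence).
\<close>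

definition weak_grad :: "(real^'d) set \<Rightarrow> (real^'d \<Rightarrow> real) \<Rightarrow> real^'d \<Rightarrow> real^'d" where
  "weak_grad X u = (SOME g. has_weak_grad X u g)"

definition weak_div :: "(real^'d) set \<Rightarrow> (real^'d \<Rightarrow> real^'d) \<Rightarrow> real^'d \<Rightarrow> real" where
  "weak_div X \<tau> = (SOME g. has_weak_div X \<tau> g)"


section \<open>Sobolev spaces\<close>

definition H1_space :: "(real^'d) set \<Rightarrow> (real^'d \<Rightarrow> real) set" where
  "H1_space X = {u \<in> L2_space X. \<exists>g \<in> L2_space X. has_weak_grad X u g}"

definition W1inf_space :: "(real^'d) set \<Rightarrow> (real^'d \<Rightarrow> real) set" where
  "W1inf_space X = {u \<in> Linf_space X. \<exists>g \<in> Linf_space X. has_weak_grad X u g}"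

definition Hdiv_space :: "(real^'d) set \<Rightarrow> (real^'d \<Rightarrow> real^'d) set" where
  "Hdiv_space X = {\<tau> \<in> L2_space X. \<exists>g \<in> L2_space X. has_weak_div X \<tau> g}"


section \<open>Domains and meshes\<close>

text \<open>
  The boundary consists of finitely many straight segments (in dimension two) or flat convex
  polygons (in dimension three).  No Lipschitz property is required.
\<close>

definition polyhedral_domain :: "(real^'d) set \<Rightarrow> bool" where
  "polyhedral_domain \<Omega> \<longleftrightarrow> open \<Omega> \<and> bounded \<Omega> \<and> connected \<Omega> \<and> \<Omega> \<noteq> {} \<and>
     (\<exists>\<F>. finite \<F> \<and> (\<forall>F\<in>\<F>. polytope F \<and> aff_dim F = int CARD('d) - 1) \<and>
          frontier \<Omega> = \<Union>\<F>)"

text \<open>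
  \<^const>\<open>triangulation\<close> supplies finiteness and the matching condition (any two
  simplices meet in a common, possibly empty, face).  The elements are closed simplices, and
  the condition on their interiors matters only for domains that differ from the interior of
  their closure.
\<close>

definition simplicial_mesh :: "(real^'d) set \<Rightarrow> (real^'d) set set \<Rightarrow> bool" where
  "simplicial_mesh \<Omega> \<T> \<longleftrightarrow> triangulation \<T> \<and> (\<forall>T\<in>\<T>. int CARD('d) simplex T) \<and>
     \<Union>\<T> = closure \<Omega> \<and> (\<forall>T\<in>\<T>. interior T \<subseteq> \<Omega>)"

definition inradius :: "(real^'d) set \<Rightarrow> real" where
  "inradius T = Sup {r. 0 \<le> r \<and> (\<exists>x. cball x r \<subseteq> T)}"

definition shape_regular :: "real \<Rightarrow> (real^'d) set set \<Rightarrow> bool" where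
  "shape_regular \<kappa> \<T> \<longleftrightarrow> (\<forall>T\<in>\<T>. diameter T \<le> \<kappa> * inradius T)"


section \<open>Discrete spaces\<close>

definition poly_space :: "nat \<Rightarrow> (real^'d \<Rightarrow> real) set" where
  "poly_space p = {P. \<exists>c :: ('d \<Rightarrow> nat) \<Rightarrow> real.
      P = (\<lambda>x. \<Sum>m | (\<Sum>i\<in>UNIV. m i) \<le> p. c m * (\<Prod>i\<in>UNIV. (x $ i) ^ m i))}"

definition RT_local :: "nat \<Rightarrow> (real^'d \<Rightarrow> real^'d) set" where
  "RT_local p = {R. \<exists>a b. (\<forall>i. (\<lambda>x. a x $ i) \<in> poly_space p) \<and> b \<in> poly_space p \<and>
      R = (\<lambda>x. a x + b x *\<^sub>R x)}"

definition X_space :: "(real^'d) set \<Rightarrow> (real^'d) set set \<Rightarrow> nat \<Rightarrow> (real^'d \<Rightarrow> real) set" where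
  "X_space \<Omega> \<T> p = {v \<in> L2_space \<Omega>. \<forall>T\<in>\<T>. \<exists>P\<in>poly_space p. AE x\<in>T in lebesgue. v x = P x}"

definition V_space :: "(real^'d) set \<Rightarrow> (real^'d) set set \<Rightarrow> nat \<Rightarrow> (real^'d \<Rightarrow> real) set" where
  "V_space \<Omega> \<T> k = X_space \<Omega> \<T> k \<inter> H1_space \<Omega>"

definition RT_space :: "(real^'d) set \<Rightarrow> (real^'d) set set \<Rightarrow> nat \<Rightarrow> (real^'d \<Rightarrow> real^'d) set" where
  "RT_space \<Omega> \<T> p = {\<tau> \<in> Hdiv_space \<Omega>. \<forall>T\<in>\<T>. \<exists>R\<in>RT_local p. AE x\<in>T in lebesgue. \<tau> x = R x}"


section \<open>The discrete problem\<close>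

definition discrete_solution ::
    "(real^'d) set \<Rightarrow> (real^'d) set \<Rightarrow> (real^'d) set set \<Rightarrow> nat \<Rightarrow> nat \<Rightarrow>
     (real^'d \<Rightarrow> real) \<Rightarrow> real \<Rightarrow> (real^'d \<Rightarrow> real) \<Rightarrow> (real^'d \<Rightarrow> real) \<Rightarrow>
     (real^'d \<Rightarrow> real) \<Rightarrow> (real^'d \<Rightarrow> real^'d) \<Rightarrow> (real^'d \<Rightarrow> real) \<Rightarrow> bool" where
  "discrete_solution \<Omega> \<omega> \<T> k p \<gamma> \<alpha> f q u \<sigma> z \<longleftrightarrow>
     u \<in> V_space \<Omega> \<T> k \<and> \<sigma> \<in> RT_space \<Omega> \<T> p \<and> z \<in> X_space \<Omega> \<T> p \<and>
     (\<forall>v\<in>V_space \<Omega> \<T> k.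
        L2_inner \<Omega> (\<lambda>x. \<gamma> x *\<^sub>R weak_grad \<Omega> u x - \<sigma> x) (weak_grad \<Omega> v) + \<alpha> * L2_inner \<omega> u v
          = \<alpha> * L2_inner \<omega> q v) \<and>
     (\<forall>\<tau>\<in>RT_space \<Omega> \<T> p.
        L2_inner \<Omega> (\<lambda>x. weak_grad \<Omega> u x - inverse (\<gamma> x) *\<^sub>R \<sigma> x) (\<lambda>x. - \<tau> x)
          - L2_inner \<Omega> (weak_div \<Omega> \<tau>) z = 0) \<and>
     (\<forall>y\<in>X_space \<Omega> \<T> p. - L2_inner \<Omega> (weak_div \<Omega> \<sigma>) y = L2_inner \<Omega> f y)"

end

(*
  Idea. Modulo null sets the discrete spaces are finite-dimensional and the problem is a symmetric
  linear system, so it suffices that the homogeneous problem has only the zero solution.  There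
  div sigma = 0, because div RT_p is contained in X_p, and testing with the solution itself gives
  sigma = gamma grad u and u = 0 on omega.

  u = 0 by unique continuation from simplex to simplex across facets.  If u vanishes on one side
  of a facet and equals a nonzero polynomial lambda^m w on the other (lambda the distance to the
  facet, w not identically zero on it), a radial bump centred slightly on the zero side has, on the
  cap where it meets the other side, a gradient nearly parallel to the normal; then the integral of
  gamma grad u . grad phi has a strict sign if m > 0, contradicting div sigma = 0, and for m = 0 the
  definition of the weak gradient is violated.  Only positivity and boundedness of gamma enter.

  z = 0 by explicit Raviart-Thomas fields: bubbles Q(x) (x - v), with Q = 0 on the facet opposite
  to the vertex v, force z to be constant on each simplex; the fields x - a and - k (x - b) on two
  simplices with a common facet force these constants to agree; the field x forces them to vanish.
  Integration by parts on simplices uses homotheties centred at a vertex instead of boundary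
  integrals.
*)

theory Submission
  imports Defs "HOL-Computational_Algebra.Polynomial"
begin

text \<open>Testing the homogeneous problem with its own solution completes a square: the integral
  of \<gamma>^-1 |\<gamma> grad u - \<sigma>|^2 plus \<alpha> times the squared norm of u over
  \<omega> vanishes, since both multiplier terms drop out with div \<sigma> = 0. No Lipschitz
  boundary is given, so traces, normal fluxes and a stable right inverse of the divergence are not
  at hand. Every flux argument is therefore an identity on single simplices against smooth test
  functions, and explicit fields take the place of the usual inf-sup argument. Across a facet,
  derivatives of u cannot be matched pointwise, because \<gamma> enters only almost everywhere. What
  helps is that u is a polynomial on each simplex and so vanishes to finite order at the facet:
  after division by a power of the distance, the leading part of grad u is normal with a fixed sign,
  whatever the positive values of \<gamma> are. Functions that vanish almost everywhere form a
  nontrivial kernel of the linear system. Solvability is therefore stated as a Fredholm alternative: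
  the load has to vanish on the kernel.\<close>

section \<open>Symmetric forms on finite-dimensional spaces\<close>

text \<open>\<open>comb a x y\<close> plays the role of \<open>x + a y\<close>; the spaces below consist of functions, which carry no
  vector space instance.\<close>

definition comb_closed :: "(real \<Rightarrow> 'w \<Rightarrow> 'w \<Rightarrow> 'w) \<Rightarrow> 'w set \<Rightarrow> bool" where
  "comb_closed comb W \<longleftrightarrow> (\<forall>a. \<forall>x\<in>W. \<forall>y\<in>W. comb a x y \<in> W)"

definition comb_linear :: "(real \<Rightarrow> 'w \<Rightarrow> 'w \<Rightarrow> 'w) \<Rightarrow> 'w set \<Rightarrow> ('w \<Rightarrow> real) \<Rightarrow> bool" where
  "comb_linear comb W f \<longleftrightarrow> (\<forall>a. \<forall>x\<in>W. \<forall>y\<in>W. f (comb a x y) = f x + a * f y)"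

lemma comb_linearD: "comb_linear comb W f \<Longrightarrow> x \<in> W \<Longrightarrow> y \<in> W \<Longrightarrow> f (comb a x y) = f x + a * f y"
  by (simp add: comb_linear_def)

lemma comb_closedD: "comb_closed comb W \<Longrightarrow> x \<in> W \<Longrightarrow> y \<in> W \<Longrightarrow> comb a x y \<in> W"
  by (simp add: comb_closed_def)

lemma comb_linear_subset: "comb_linear comb W f \<Longrightarrow> V \<subseteq> W \<Longrightarrow> comb_linear comb V f"
  by (auto simp: comb_linear_def)

lemma comb_closed_kernel:
  "comb_closed comb W \<Longrightarrow> comb_linear comb W f \<Longrightarrow> comb_closed comb {w\<in>W. f w = 0}"
  by (auto simp: comb_linear_def comb_closed_def)

text \<open>By hypothesis \<open>B w v\<close> depends only on the values of the functionals in
  \<Lambda> at w, so W modulo the part invisible to B is finite-dimensional and \<open>bs\<close>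
  acts as a spanning set of it. Elimination: each functional that is nonzero on W costs one test
  vector, and the rest takes place in its kernel.\<close>

lemma finite_test_set:
  assumes "finite \<Lambda>" "comb_closed comb W" "\<And>f. f \<in> \<Lambda> \<Longrightarrow> comb_linear comb W f"
    and "\<And>v. v \<in> V \<Longrightarrow> comb_linear comb W (\<lambda>w. B w v)"
    and "\<And>w v. w \<in> W \<Longrightarrow> v \<in> V \<Longrightarrow> (\<And>f. f \<in> \<Lambda> \<Longrightarrow> f w = 0) \<Longrightarrow> B w v = 0"
  shows "\<exists>bs. finite bs \<and> bs \<subseteq> W \<and> (\<forall>v\<in>V. (\<forall>b\<in>bs. B b v = 0) \<longrightarrow> (\<forall>w\<in>W. B w v = 0))"
  using assms
proof (induction \<Lambda> arbitrary: W rule: finite_induct)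
  case empty
  then show ?case by (intro exI[of _ "{}"]) auto
next
  case (insert f \<Lambda>)
  let ?W = "{w\<in>W. f w = 0}"
  have "\<exists>bs. finite bs \<and> bs \<subseteq> ?W \<and> (\<forall>v\<in>V. (\<forall>b\<in>bs. B b v = 0) \<longrightarrow> (\<forall>w\<in>?W. B w v = 0))"
  proof (rule insert.IH)
    show "comb_closed comb ?W" using insert.prems by (intro comb_closed_kernel) auto
    show "comb_linear comb ?W g" if "g \<in> \<Lambda>" for g
      using insert.prems(2)[of g] that by (auto intro: comb_linear_subset)
    show "comb_linear comb ?W (\<lambda>w. B w v)" if "v \<in> V" for v
      using insert.prems(3)[of v] that by (auto intro: comb_linear_subset)
    show "B w v = 0" if "w \<in> ?W" "v \<in> V" "\<And>g. g \<in> \<Lambda> \<Longrightarrow> g w = 0" for w v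
      using insert.prems(4)[of w v] that by auto
  qed
  then obtain bs where bs: "finite bs" "bs \<subseteq> ?W"
    and z: "\<And>v w. v \<in> V \<Longrightarrow> (\<And>b. b\<in>bs \<Longrightarrow> B b v = 0) \<Longrightarrow> w\<in>?W \<Longrightarrow> B w v = 0" by meson
  show ?case
  proof (cases "\<exists>b\<in>W. f b \<noteq> 0")
    case False
    then have "?W = W" by auto
    then show ?thesis using bs z by (intro exI[of _ bs]) auto
  next
    case True
    then obtain b where b: "b \<in> W" "f b \<noteq> 0" by auto
    have "B w v = 0" if v: "v \<in> V" and 0: "\<And>c. c \<in> insert b bs \<Longrightarrow> B c v = 0" and w: "w \<in> W" for v w
    proof -
      \<comment> \<open>Projection of w along b onto the kernel of f.\<close>
      let ?u = "comb (- (f w / f b)) w b"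
      have "f ?u = 0" using comb_linearD[of comb W f w b] insert.prems(2) b w by simp
      moreover have "?u \<in> W" using comb_closedD[OF insert.prems(1)] b w by simp
      ultimately have "B ?u v = 0" using z[of v ?u] v 0 by auto
      moreover have "B ?u v = B w v - (f w / f b) * B b v"
        using comb_linearD[OF insert.prems(3)[OF v], of w b] b w by simp
      ultimately show ?thesis using 0[of b] by simp
    qed
    then show ?thesis using bs b by (intro exI[of _ "insert b bs"]) auto
  qed
qed

text \<open>A functional that vanishes on the common kernel of finitely many functionals
  \<open>B b\<close> is a combination of them. The induction solves the problem on the kernel of one
  \<open>B b\<close> and then corrects the solution by a multiple of b.\<close>

lemma functional_representable:
  assumes "finite bs" "bs \<subseteq> W" "W \<noteq> {}" "comb_closed comb W" "comb_closed comb V"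
    and "\<And>v. v \<in> V \<Longrightarrow> comb_linear comb W (\<lambda>w. B w v)"
    and "\<And>w. w \<in> W \<Longrightarrow> comb_linear comb V (B w)"
    and "comb_linear comb V l"
    and "\<And>v. v \<in> V \<Longrightarrow> (\<And>b. b \<in> bs \<Longrightarrow> B b v = 0) \<Longrightarrow> l v = 0"
  shows "\<exists>w\<in>W. \<forall>v\<in>V. B w v = l v"
  using assms
proof (induction bs arbitrary: V rule: finite_induct)
  case empty
  then obtain w where w: "w \<in> W" by auto
  \<comment> \<open>This element plays the role of the zero vector; \<open>B\<close> annihilates it
    by linearity.\<close>
  have "comb (-1) w w \<in> W" using w empty by (simp add: comb_closed_def)
  moreover have "B (comb (-1) w w) v = 0" if "v \<in> V" for v
    using comb_linearD[OF empty(5)[OF that], of w w] w by simp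
  ultimately show ?case using empty by (intro bexI[of _ "comb (-1) w w"]) auto
next
  case (insert b bs)
  let ?V = "{v\<in>V. B b v = 0}"
  have bW: "b \<in> W" using insert by auto
  have "\<exists>w\<in>W. \<forall>v\<in>?V. B w v = l v"
  proof (rule insert.IH)
    show "comb_closed comb ?V" using insert.prems bW by (intro comb_closed_kernel) auto
    show "comb_linear comb ?V (B w)" if "w \<in> W" for w
      using insert.prems(6)[OF that] by (rule comb_linear_subset) auto
    show "comb_linear comb ?V l"
      using insert.prems(7) by (rule comb_linear_subset) auto
    show "l v = 0" if "v \<in> ?V" "\<And>c. c \<in> bs \<Longrightarrow> B c v = 0" for v
      using insert.prems(8)[of v] that by auto
    show "comb_linear comb W (\<lambda>w. B w v)" if "v \<in> ?V" for v
      using insert.prems(5)[of v] that by simp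
  qed (use insert.prems(1-3) in auto)
  then obtain w where w: "w \<in> W" "\<And>v. v \<in> ?V \<Longrightarrow> B w v = l v" by blast
  show ?case
  proof (cases "\<exists>v\<in>V. B b v \<noteq> 0")
    case False
    then show ?thesis using w by auto
  next
    case True
    then obtain c where c: "c \<in> V" "B b c \<noteq> 0" by auto
    \<comment> \<open>Chosen so that the corrected element also reproduces l at c, the direction
      missing from the kernel.\<close>
    define t where "t = (l c - B w c) / B b c"
    have tc: "t * B b c = l c - B w c" using c by (simp add: t_def)
    have "B (comb t w b) v = l v" if v: "v \<in> V" for v
    proof -
      \<comment> \<open>Makes v - s c an element of the kernel of \<open>B b\<close>, where w
        already represents l.\<close>
      define s where "s = B b v / B b c"
      have sc: "s * B b c = B b v" using c by (simp add: s_def)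
      let ?u = "comb (- s) v c"
      have uV: "?u \<in> V" using v c insert.prems by (simp add: comb_closed_def)
      have lin: "B w' ?u = B w' v - s * B w' c" if "w' \<in> W" for w'
        using comb_linearD[OF insert.prems(6)[OF that] v c(1), of "-s"] by simp
      have "B w ?u = l ?u" using w(2)[of ?u] uV lin[OF bW] sc by simp
      then have "B w v - s * B w c = l v - s * l c"
        using lin[OF w(1)] comb_linearD[OF insert.prems(7) v c(1), of "-s"] by simp
      then have "l v = B w v + s * (l c - B w c)" by (simp add: algebra_simps)
      also have "\<dots> = B w v + t * B b v" using tc sc by (metis mult.left_commute)
      also have "\<dots> = B (comb t w b) v"
        using comb_linearD[OF insert.prems(5)[OF v] w(1) bW] by simp
      finally show ?thesis by simp
    qed
    moreover have "comb t w b \<in> W" using w bW insert.prems by (simp add: comb_closed_def)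
    ultimately show ?thesis by blast
  qed
qed

text \<open>Symmetry identifies the left and right kernels, so the alternative needs l to vanish
  only on vectors v with \<open>B v w = 0\<close> for all w. The kernel may be nontrivial: in the
  application it consists of the representatives of zero.\<close>

lemma symmetric_form_solvable:
  assumes "W \<noteq> {}" "comb_closed comb W" "finite \<Lambda>" "\<And>f. f \<in> \<Lambda> \<Longrightarrow> comb_linear comb W f"
    and lin: "\<And>v. v \<in> W \<Longrightarrow> comb_linear comb W (\<lambda>w. B w v)"
    and sym: "\<And>v w. v \<in> W \<Longrightarrow> w \<in> W \<Longrightarrow> B v w = B w v"
    and sep: "\<And>w v. w \<in> W \<Longrightarrow> v \<in> W \<Longrightarrow> (\<And>f. f \<in> \<Lambda> \<Longrightarrow> f w = 0) \<Longrightarrow> B w v = 0"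
    and l: "comb_linear comb W l"
    and ker: "\<And>v. v \<in> W \<Longrightarrow> (\<And>w. w \<in> W \<Longrightarrow> B v w = 0) \<Longrightarrow> l v = 0"
  shows "\<exists>w\<in>W. \<forall>v\<in>W. B w v = l v"
proof -
  have "\<exists>bs. finite bs \<and> bs \<subseteq> W \<and> (\<forall>v\<in>W. (\<forall>b\<in>bs. B b v = 0) \<longrightarrow> (\<forall>w\<in>W. B w v = 0))"
    by (rule finite_test_set[OF assms(3,2,4) lin sep])
  then obtain bs where bs: "finite bs" "bs \<subseteq> W" "\<And>v w. v \<in> W \<Longrightarrow> (\<And>b. b\<in>bs \<Longrightarrow> B b v = 0) \<Longrightarrow> w \<in> W \<Longrightarrow> B w v = 0"
    by auto
  show ?thesis
  proof (rule functional_representable[OF bs(1,2)])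
    show "comb_linear comb W (B w)" if "w \<in> W" for w
    proof -
      have "B w (comb a x y) = B w x + a * B w y" if "x \<in> W" "y \<in> W" for a x y
        using comb_linearD[OF lin[OF \<open>w \<in> W\<close>], of x y] that sym \<open>w \<in> W\<close> comb_closedD[OF assms(2)] by metis
      then show ?thesis by (simp add: comb_linear_def)
    qed
    show "l v = 0" if "v \<in> W" "\<And>b. b \<in> bs \<Longrightarrow> B b v = 0" for v
      using ker[OF that(1)] bs(3)[OF that] sym that(1) by metis
  qed (use assms in auto)
qed

section \<open>Polynomials\<close>

definition monom_fun :: "('d \<Rightarrow> nat) \<Rightarrow> real^'d \<Rightarrow> real" where
  "monom_fun m x = (\<Prod>i\<in>UNIV. (x $ i) ^ m i)"

lemma finite_multi_indices: "finite {m :: 'd::finite \<Rightarrow> nat. (\<Sum>i\<in>UNIV. m i) \<le> p}"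
proof (rule finite_subset)
  show "{m :: 'd::finite \<Rightarrow> nat. (\<Sum>i\<in>UNIV. m i) \<le> p} \<subseteq> PiE UNIV (\<lambda>_. {..p})"
  proof
    fix m :: "'d \<Rightarrow> nat" assume m: "m \<in> {m. (\<Sum>i\<in>UNIV. m i) \<le> p}"
    have "m i \<le> p" for i using member_le_sum[of i UNIV m] m by simp
    then show "m \<in> PiE UNIV (\<lambda>_. {..p})" by auto
  qed
  show "finite (PiE (UNIV::'d set) (\<lambda>_. {..p}))" by (intro finite_PiE) auto
qed

lemma poly_space_alt:
  "P \<in> poly_space p \<longleftrightarrow> (\<exists>c. P = (\<lambda>x. \<Sum>m | (\<Sum>i\<in>UNIV. m i) \<le> p. c m * monom_fun m x))"
  by (simp add: poly_space_def monom_fun_def)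

lemma poly_space_comb:
  assumes "P \<in> poly_space p" "Q \<in> poly_space p"
  shows "(\<lambda>x. P x + a * Q x) \<in> poly_space p"
proof -
  obtain c d where "P = (\<lambda>x. \<Sum>m | (\<Sum>i\<in>UNIV. m i) \<le> p. c m * monom_fun m x)"
    "Q = (\<lambda>x. \<Sum>m | (\<Sum>i\<in>UNIV. m i) \<le> p. d m * monom_fun m x)"
    using assms unfolding poly_space_alt by blast
  then show ?thesis unfolding poly_space_alt
    by (intro exI[of _ "\<lambda>m. c m + a * d m"])
      (simp add: sum_distrib_left sum.distrib algebra_simps)
qed

lemma poly_space_zero: "(\<lambda>x. 0) \<in> poly_space p"
  unfolding poly_space_alt by (intro exI[of _ "\<lambda>m. 0"]) simp

lemma poly_space_add: "P \<in> poly_space p \<Longrightarrow> Q \<in> poly_space p \<Longrightarrow> (\<lambda>x. P x + Q x) \<in> poly_space p"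
  using poly_space_comb[of P p Q 1] by simp

lemma poly_space_cmult: "Q \<in> poly_space p \<Longrightarrow> (\<lambda>x. a * Q x) \<in> poly_space p"
  using poly_space_comb[OF poly_space_zero, of Q p a] by simp

lemma poly_space_sum:
  "(\<And>i. i \<in> I \<Longrightarrow> P i \<in> poly_space p) \<Longrightarrow> (\<lambda>x. \<Sum>i\<in>I. P i x) \<in> poly_space p"
  by (induction I rule: infinite_finite_induct) (auto intro: poly_space_add poly_space_zero)

lemma monom_in_poly_space:
  assumes "(\<Sum>i\<in>UNIV. m i) \<le> p" shows "monom_fun m \<in> poly_space p"
proof -
  have "(\<Sum>k | (\<Sum>i\<in>UNIV. k i) \<le> p. (if k = m then 1 else 0) * monom_fun k x) = monom_fun m x" for x
  proof -
    have "(\<Sum>k | (\<Sum>i\<in>UNIV. k i) \<le> p. (if k = m then 1 else 0) * monom_fun k x)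
        = (\<Sum>k | (\<Sum>i\<in>UNIV. k i) \<le> p. (if m = k then monom_fun k x else 0))"
      by (intro sum.cong) auto
    also have "\<dots> = monom_fun m x" by (subst sum.delta'[OF finite_multi_indices]) (use assms in auto)
    finally show ?thesis .
  qed
  then show ?thesis unfolding poly_space_alt by (intro exI[of _ "\<lambda>k. if k = m then 1 else 0"]) auto
qed

lemma poly_space_induct [consumes 1, case_names monom comb]:
  assumes "P \<in> poly_space p"
    and "\<And>m. (\<Sum>i\<in>UNIV. m i) \<le> p \<Longrightarrow> R (monom_fun m)"
    and "\<And>P Q a. P \<in> poly_space p \<Longrightarrow> Q \<in> poly_space p \<Longrightarrow> R P \<Longrightarrow> R Q \<Longrightarrow> R (\<lambda>x. P x + a * Q x)"
  shows "R P"
proof -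
  obtain c where c: "P = (\<lambda>x. \<Sum>m | (\<Sum>i\<in>UNIV. m i) \<le> p. c m * monom_fun m x)"
    using assms(1) unfolding poly_space_alt by blast
  \<comment> \<open>The zero polynomial arises as a monomial minus itself, the only route offered by
    the closure rule.\<close>
  have z: "R (\<lambda>x. 0)"
    using assms(3)[of "monom_fun (\<lambda>_. 0)" "monom_fun (\<lambda>_. 0)" "-1"] assms(2)[of "\<lambda>_. 0"]
      monom_in_poly_space[of "\<lambda>_. 0" p] by simp
  have "R (\<lambda>x. \<Sum>m\<in>M. c m * monom_fun m x)" if "finite M" "M \<subseteq> {m. (\<Sum>i\<in>UNIV. m i) \<le> p}" for M
    using that
  proof (induction M rule: finite_induct)
    case empty show ?case using z by simp
  next
    case (insert m M)
    have "R (\<lambda>x. (\<Sum>m\<in>M. c m * monom_fun m x) + c m * monom_fun m x)"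
    proof (rule assms(3))
      show "(\<lambda>x. \<Sum>m\<in>M. c m * monom_fun m x) \<in> poly_space p"
        by (rule poly_space_sum) (use insert in \<open>auto intro!: poly_space_cmult monom_in_poly_space\<close>)
    qed (use insert in \<open>auto intro: assms(2) monom_in_poly_space\<close>)
    then show ?case using insert by (simp add: add.commute)
  qed
  then show ?thesis unfolding c using finite_multi_indices by blast
qed

lemma poly_space_mono:
  assumes "p \<le> q" shows "poly_space p \<subseteq> poly_space q"
proof
  fix P :: "real^'d \<Rightarrow> real" assume "P \<in> poly_space p"
  then show "P \<in> poly_space q"
    by (induction rule: poly_space_induct) (use assms in \<open>auto intro: poly_space_comb monom_in_poly_space\<close>)
qed

lemma monom_fun_mult_coord: "x $ j * monom_fun m x = monom_fun (m(j := Suc (m j))) x"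
proof -
  have "(\<Prod>i\<in>UNIV - {j}. (x $ i) ^ (m(j := Suc (m j))) i) = (\<Prod>i\<in>UNIV - {j}. (x $ i) ^ m i)"
    by (intro prod.cong) auto
  then show ?thesis unfolding monom_fun_def
    by (subst (1 2) prod.remove[of UNIV j]) auto
qed

lemma sum_fun_upd_Suc: "(\<Sum>i\<in>UNIV. (m(j := Suc (m j))) i) = Suc (\<Sum>i\<in>(UNIV::'d::finite set). m i)"
proof -
  have "(\<Sum>i\<in>UNIV - {j}. (m(j := Suc (m j))) i) = (\<Sum>i\<in>UNIV - {j}. m i)"
    by (intro sum.cong) auto
  then show ?thesis by (subst (1 2) sum.remove[of UNIV j]) auto
qed

lemma poly_space_mult_coord:
  assumes "P \<in> poly_space p" shows "(\<lambda>x. x $ j * P x) \<in> poly_space (Suc p)"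
  using assms
proof (induction rule: poly_space_induct)
  case (monom m)
  then show ?case unfolding monom_fun_mult_coord
    by (intro monom_in_poly_space) (simp only: sum_fun_upd_Suc Suc_le_mono)
next
  case (comb P Q a)
  then show ?case using poly_space_comb[of "\<lambda>x. x $ j * P x" "Suc p" "\<lambda>x. x $ j * Q x" a]
    by (simp add: algebra_simps)
qed

lemma poly_space_const: "(\<lambda>x. c) \<in> poly_space p"
  using poly_space_cmult[OF monom_in_poly_space[of "\<lambda>_. 0" p], of c] by (simp add: monom_fun_def)

text \<open>Barycentric coordinates are affine; this is the degree count behind the bubble
  functions.\<close>

lemma poly_space_mult_affine:
  assumes "P \<in> poly_space p" shows "(\<lambda>x. (c + n \<bullet> x) * P x) \<in> poly_space (Suc p)"
proof -
  have "(\<lambda>x. c * P x + (\<Sum>j\<in>UNIV. n $ j * (x $ j * P x))) \<in> poly_space (Suc p)"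
    using poly_space_mono[of p "Suc p"] assms
    by (intro poly_space_add poly_space_sum poly_space_cmult poly_space_mult_coord) auto
  then show ?thesis by (simp add: inner_vec_def sum_distrib_right sum_distrib_left algebra_simps)
qed

lemma poly_space_imp_rpf:
  fixes P :: "real^'d \<Rightarrow> real"
  assumes "P \<in> poly_space p" shows "real_polynomial_function P"
  using assms
proof (induction rule: poly_space_induct)
  case (monom m)
  then show ?case unfolding monom_fun_def
    by (intro real_polynomial_function_prod real_polynomial_function_power real_polynomial_function.intros(1)
        bounded_linear_vec_nth) auto
next
  case (comb P Q a)
  then show ?case by (intro real_polynomial_function.intros(2-4))
qed

lemma poly_space_0:
  fixes P :: "real^'d \<Rightarrow> real"
  shows "P \<in> poly_space 0 \<Longrightarrow> \<exists>c. P = (\<lambda>x. c)"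
proof (induction rule: poly_space_induct)
  case (monom m)
  then show ?case by (intro exI[of _ 1]) (auto simp: monom_fun_def)
qed auto

lemma monom_fun_deriv:
  "\<exists>G :: real^'d \<Rightarrow> real^'d. (\<forall>x. (monom_fun m has_derivative (\<lambda>h. G x \<bullet> h)) (at x)) \<and>
     (\<forall>i. \<exists>c m'. (\<lambda>x. G x $ i) = (\<lambda>x. c * monom_fun m' x) \<and> (c = 0 \<or> Suc (\<Sum>i\<in>UNIV. m' i) = (\<Sum>i\<in>UNIV. m i)))"
proof -
  \<comment> \<open>The truncated exponent \<open>m i - 1\<close> is harmless: when
    \<open>m i = 0\<close> the coefficient vanishes. This is the alternative \<open>c = 0\<close> in
    the claim.\<close>
  define G :: "real^'d \<Rightarrow> real^'d" where "G x = (\<chi> i. of_nat (m i) * monom_fun (m(i := m i - 1)) x)" for x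
  have "(monom_fun m has_derivative (\<lambda>h. G x \<bullet> h)) (at x)" for x
  proof -
    have "((\<lambda>x. \<Prod>i\<in>UNIV. (x $ i) ^ m i) has_derivative
       (\<lambda>h. \<Sum>i\<in>UNIV. (of_nat (m i) * h $ i * (x $ i) ^ (m i - 1)) * (\<Prod>j\<in>UNIV - {i}. (x $ j) ^ m j))) (at x)"
      by (intro has_derivative_prod has_derivative_power bounded_linear.has_derivative[OF bounded_linear_vec_nth] has_derivative_ident)
    moreover have "monom_fun (m(i := k)) x = (x $ i) ^ k * (\<Prod>j\<in>UNIV - {i}. (x $ j) ^ m j)" for i k
      unfolding monom_fun_def by (subst prod.remove[of UNIV i]) (auto intro!: prod.cong)
    then have "(\<Sum>i\<in>UNIV. (of_nat (m i) * h $ i * (x $ i) ^ (m i - 1)) * (\<Prod>j\<in>UNIV - {i}. (x $ j) ^ m j)) = G x \<bullet> h" for h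
      unfolding inner_vec_def G_def by (intro sum.cong) (simp_all add: algebra_simps)
    ultimately show ?thesis by (simp add: monom_fun_def[abs_def])
  qed
  moreover have "\<exists>c m'. (\<lambda>x. G x $ i) = (\<lambda>x. c * monom_fun m' x) \<and> (c = 0 \<or> Suc (\<Sum>i\<in>UNIV. m' i) = (\<Sum>i\<in>UNIV. m i))" for i
  proof (intro exI conjI)
    show "(\<lambda>x. G x $ i) = (\<lambda>x. of_nat (m i) * monom_fun (m(i := m i - 1)) x)" by (simp add: G_def)
    show "real (m i) = 0 \<or> Suc (\<Sum>j\<in>UNIV. (m(i := m i - 1)) j) = (\<Sum>i\<in>UNIV. m i)"
    proof (cases "m i")
      case (Suc k)
      have "(\<Sum>j\<in>UNIV. ((m(i := k))(i := Suc ((m(i := k)) i))) j) = Suc (\<Sum>j\<in>UNIV. (m(i := k)) j)"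
        by (rule sum_fun_upd_Suc)
      then show ?thesis using Suc by (simp add: fun_upd_idem)
    qed simp
  qed
  ultimately show ?thesis by blast
qed

text \<open>For p = 0 the bound \<open>p - 1\<close> degenerates to 0 and would only say that the
  gradient is constant, hence the separate clause. The last clause, that G x . x keeps degree p, is
  what the divergence of a Raviart-Thomas field needs.\<close>

lemma poly_space_deriv:
  fixes P :: "real^'d \<Rightarrow> real"
  assumes "P \<in> poly_space p"
  shows "\<exists>G. (\<forall>x. (P has_derivative (\<lambda>h. G x \<bullet> h)) (at x)) \<and> (\<forall>i. (\<lambda>x. G x $ i) \<in> poly_space (p - 1))
    \<and> (p = 0 \<longrightarrow> G = (\<lambda>x. 0)) \<and> (\<lambda>x. G x \<bullet> x) \<in> poly_space p"
proof -
  have "\<exists>G. (\<forall>x. (P has_derivative (\<lambda>h. G x \<bullet> h)) (at x)) \<and> (\<forall>i. (\<lambda>x. G x $ i) \<in> poly_space (p - 1))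
    \<and> (p = 0 \<longrightarrow> G = (\<lambda>x. 0))"
    using assms
  proof (induction rule: poly_space_induct)
    case (monom m)
    obtain G :: "real^'d \<Rightarrow> real^'d" where G: "\<And>x. (monom_fun m has_derivative (\<lambda>h. G x \<bullet> h)) (at x)"
      and G': "\<And>i. \<exists>c m'. (\<lambda>x. G x $ i) = (\<lambda>x. c * monom_fun m' x) \<and> (c = 0 \<or> Suc (\<Sum>i\<in>UNIV. m' i) = (\<Sum>i\<in>UNIV. m i))"
      using monom_fun_deriv[of m] by auto
    have "(\<lambda>x. G x $ i) \<in> poly_space (p - 1)" for i
    proof -
      obtain c m' where "(\<lambda>x. G x $ i) = (\<lambda>x. c * monom_fun m' x)" "c = 0 \<or> Suc (\<Sum>i\<in>UNIV. m' i) = (\<Sum>i\<in>UNIV. m i)"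
        using G' by blast
      then show ?thesis using monom by (cases "c = 0") (auto intro!: poly_space_cmult monom_in_poly_space simp: poly_space_zero)
    qed
    moreover have "G = (\<lambda>x. 0)" if "p = 0"
    proof -
      have "G x $ i = 0" for x i
      proof -
        obtain c m' where "(\<lambda>x. G x $ i) = (\<lambda>x. c * monom_fun m' x)" "c = 0 \<or> Suc (\<Sum>i\<in>UNIV. m' i) = (\<Sum>i\<in>UNIV. m i)"
          using G' by blast
        then show ?thesis using monom that by (metis (no_types, lifting) le_zero_eq mult_eq_0_iff nat.distinct(1))
      qed
      then show ?thesis by (simp add: fun_eq_iff vec_eq_iff)
    qed
    ultimately show ?case using G by (intro exI[of _ G]) simp
  next
    case (comb P Q a)
    then obtain G H where G: "\<forall>x. (P has_derivative (\<lambda>h. G x \<bullet> h)) (at x)" "\<forall>i. (\<lambda>x. G x $ i) \<in> poly_space (p - 1)" "p = 0 \<longrightarrow> G = (\<lambda>x. 0)"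
      and H: "\<forall>x. (Q has_derivative (\<lambda>h. H x \<bullet> h)) (at x)" "\<forall>i. (\<lambda>x. H x $ i) \<in> poly_space (p - 1)" "p = 0 \<longrightarrow> H = (\<lambda>x. 0)"
      by (elim exE conjE) (rule that; assumption)
    show ?case
    proof (intro exI[of _ "\<lambda>x. G x + a *\<^sub>R H x"] conjI allI impI)
      show "((\<lambda>x. P x + a * Q x) has_derivative (\<lambda>h. (G x + a *\<^sub>R H x) \<bullet> h)) (at x)" for x
        using has_derivative_add[OF G(1)[rule_format, of x] has_derivative_mult_right[OF H(1)[rule_format, of x], of a]]
        by (simp add: inner_add_left)
      show "(\<lambda>x. (G x + a *\<^sub>R H x) $ i) \<in> poly_space (p - 1)" for i
        using poly_space_comb[OF G(2)[rule_format] H(2)[rule_format]] by simp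
      show "(\<lambda>x. G x + a *\<^sub>R H x) = (\<lambda>x. 0)" if "p = 0" using G H that by simp
    qed
  qed
  then obtain G where G: "\<forall>x. (P has_derivative (\<lambda>h. G x \<bullet> h)) (at x)" "\<forall>i. (\<lambda>x. G x $ i) \<in> poly_space (p - 1)"
     "p = 0 \<longrightarrow> G = (\<lambda>x. 0)" by (elim exE conjE) (rule that; assumption)
  have "(\<lambda>x. G x \<bullet> x) \<in> poly_space p"
  proof (cases p)
    case 0
    then show ?thesis using G poly_space_zero by simp
  next
    case (Suc p')
    then have "(\<lambda>x. \<Sum>i\<in>UNIV. x $ i * G x $ i) \<in> poly_space (Suc p')"
      using G(2) by (intro poly_space_sum poly_space_mult_coord) auto
    then show ?thesis using Suc by (simp add: inner_vec_def mult.commute)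
  qed
  then show ?thesis using G by (intro exI[of _ G]) simp
qed

lemma poly_space_derivE:
  fixes P :: "real^'d \<Rightarrow> real"
  assumes "P \<in> poly_space p"
  obtains G where "\<And>x. (P has_derivative (\<lambda>h. G x \<bullet> h)) (at x)" "\<And>i. (\<lambda>x. G x $ i) \<in> poly_space (p - 1)"
    "p = 0 \<Longrightarrow> G = (\<lambda>x. 0)" "(\<lambda>x. G x \<bullet> x) \<in> poly_space p"
  using poly_space_deriv[OF assms] by (elim exE conjE) (rule that, simp_all)

section \<open>Polynomial functions along lines and division by an affine function\<close>

lemma rpf_univariate:
  fixes f :: "real \<Rightarrow> real"
  assumes "real_polynomial_function f" shows "\<exists>q. f = poly q"
proof -
  obtain a n where "f = (\<lambda>x. \<Sum>i\<le>n. a i * x ^ i)" using assms unfolding real_polynomial_function_iff_sum by blast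
  then have "f = poly (\<Sum>i\<le>n. monom (a i) i)" by (auto simp: poly_sum poly_monom)
  then show ?thesis by blast
qed

lemma rpf_line:
  fixes P :: "'a::euclidean_space \<Rightarrow> real"
  assumes "real_polynomial_function P" shows "\<exists>q. \<forall>t. P (a + t *\<^sub>R v) = poly q t"
proof -
  have "polynomial_function (\<lambda>t::real. a + t *\<^sub>R v)"
    by (rule polynomial_function_add[OF polynomial_function_const
          polynomial_function_bounded_linear[OF bounded_linear_scaleR_left]])
  then have "real_polynomial_function (P \<circ> (\<lambda>t::real. a + t *\<^sub>R v))"
    using assms by (rule real_polynomial_function_compose)
  then obtain q where "P \<circ> (\<lambda>t. a + t *\<^sub>R v) = poly q" using rpf_univariate by blast
  then have "P (a + t *\<^sub>R v) = poly q t" for t by (simp add: fun_eq_iff)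
  then show ?thesis by blast
qed

text \<open>On the line from x0 through x the function becomes a univariate polynomial with
  infinitely many roots near parameter 0; parameter 1 is the point x.\<close>

lemma rpf_zero_on_open:
  fixes P :: "'a::euclidean_space \<Rightarrow> real"
  assumes P: "real_polynomial_function P" and "open U" "x0 \<in> U" and z: "\<And>x. x \<in> U \<Longrightarrow> P x = 0"
  shows "P x = 0"
proof -
  obtain q where q: "\<And>t. P (x0 + t *\<^sub>R (x - x0)) = poly q t" using rpf_line[OF P] by meson
  have "open ((\<lambda>t::real. x0 + t *\<^sub>R (x - x0)) -` U)"
    by (intro open_vimage assms continuous_intros)
  then obtain e where e: "e > 0" "ball 0 e \<subseteq> ((\<lambda>t::real. x0 + t *\<^sub>R (x - x0)) -` U)"
    using \<open>x0 \<in> U\<close> by (auto simp: open_contains_ball dest: bspec[of _ _ 0])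
  have "q = 0"
  proof (rule ccontr)
    assume "q \<noteq> 0"
    then have "finite {t. poly q t = 0}" by (rule poly_roots_finite)
    moreover have "ball 0 e \<subseteq> {t. poly q t = 0}" using e z q by fastforce
    ultimately have "finite (ball (0::real) e)" by (rule rev_finite_subset)
    then show False using e using uncountable_ball[of e "0::real"] countable_finite by blast
  qed
  then show ?thesis using q[of 1] by simp
qed

text \<open>Division with remainder by the affine function; the remainder is P composed with the
  orthogonal projection \<open>pr\<close> onto its zero hyperplane. Structural induction keeps the
  quotient polynomial.\<close>

lemma rpf_split:
  fixes P :: "'a::euclidean_space \<Rightarrow> real" and c :: real
  assumes "real_polynomial_function P" "norm \<nu> = 1"
  defines "pr \<equiv> \<lambda>y. y - (c + \<nu> \<bullet> y) *\<^sub>R \<nu>"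
  shows "\<exists>Q. real_polynomial_function Q \<and> (\<forall>y. P y = (c + \<nu> \<bullet> y) * Q y + P (pr y))"
  using assms(1)
proof (induction)
  case (linear f)
  interpret f: bounded_linear f by fact
  show ?case
    by (intro exI[of _ "\<lambda>y. f \<nu>"]) (auto simp: pr_def f.diff f.scaleR)
next
  case (const c)
  show ?case by (intro exI[of _ "\<lambda>y. 0"]) auto
next
  case (add f g)
  then obtain Q R where *: "real_polynomial_function Q" "\<And>y. f y = (c + \<nu> \<bullet> y) * Q y + f (pr y)"
    "real_polynomial_function R" "\<And>y. g y = (c + \<nu> \<bullet> y) * R y + g (pr y)" by blast
  have "f y + g y = (c + \<nu> \<bullet> y) * (Q y + R y) + (f (pr y) + g (pr y))" for y
    using *(2)[of y] *(4)[of y] by (simp only: distrib_left)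
  then show ?case using * by (intro exI[of _ "\<lambda>y. Q y + R y"]) blast
next
  case (mult f g)
  then obtain Q R where *: "real_polynomial_function Q" "\<And>y. f y = (c + \<nu> \<bullet> y) * Q y + f (pr y)"
    "real_polynomial_function R" "\<And>y. g y = (c + \<nu> \<bullet> y) * R y + g (pr y)" by blast
  have pp: "polynomial_function pr" unfolding pr_def
    by (rule polynomial_function_diff[OF polynomial_function_id polynomial_function_mult[OF
          polynomial_function_add[OF polynomial_function_const
             polynomial_function_bounded_linear[OF bounded_linear_inner_right]] polynomial_function_const]])
  then have "real_polynomial_function (\<lambda>y. f (pr y))"
    using real_polynomial_function_compose[OF pp mult(1)] by (simp add: o_def)
  moreover have "f y * g y = (c + \<nu> \<bullet> y) * (Q y * g y + f (pr y) * R y) + f (pr y) * g (pr y)" for y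
    using *(2)[of y] *(4)[of y] by algebra
  moreover have "real_polynomial_function (\<lambda>y. Q y * g y + f (pr y) * R y)"
    using calculation(1) *(1,3) mult(1,2) by (intro real_polynomial_function.intros(3,4))
  ultimately show ?case by blast
qed

text \<open>Take the largest power of the affine function that divides P. The exponents are bounded
  by the degree of P on a normal line, and by maximality the quotient does not vanish on the whole
  hyperplane.\<close>

lemma rpf_factor_affine:
  fixes P :: "'a::euclidean_space \<Rightarrow> real"
  assumes P: "real_polynomial_function P" and nz: "P x0 \<noteq> 0" and \<nu>: "norm \<nu> = 1"
  shows "\<exists>m w y. real_polynomial_function w \<and> (\<forall>x. P x = (c + \<nu> \<bullet> x) ^ m * w x) \<and> c + \<nu> \<bullet> y = 0 \<and> w y \<noteq> 0"
proof -
  define pr where "pr = (\<lambda>y. y - (c + \<nu> \<bullet> y) *\<^sub>R \<nu>)"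
  have nn: "\<nu> \<bullet> \<nu> = 1" using \<nu> by (simp add: norm_eq_1)
  have pr0: "c + \<nu> \<bullet> pr y = 0" for y by (simp add: pr_def inner_diff_right nn)
  define A where "A = {m. \<exists>w. real_polynomial_function w \<and> (\<forall>x. P x = (c + \<nu> \<bullet> x) ^ m * w x)}"
  \<comment> \<open>On the normal line through x0 the affine function is the parameter t itself. The
    line contains x0, so q is not zero.\<close>
  obtain q where q: "\<And>t. P (pr x0 + t *\<^sub>R \<nu>) = poly q t" using rpf_line[OF P] by meson
  have "q \<noteq> 0" using q[of "c + \<nu> \<bullet> x0"] nz by (auto simp: pr_def)
  have bd: "m \<le> degree q" if mA: "m \<in> A" for m
  proof -
    obtain w where w: "real_polynomial_function w" "\<And>x. P x = (c + \<nu> \<bullet> x) ^ m * w x" using mA A_def by auto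
    obtain r where r: "\<And>t. w (pr x0 + t *\<^sub>R \<nu>) = poly r t" using rpf_line[OF w(1)] by meson
    have "poly q t = poly (monom 1 m * r) t" for t
    proof -
      have "c + \<nu> \<bullet> (pr x0 + t *\<^sub>R \<nu>) = t" using pr0[of x0] nn by (simp add: inner_add_right)
      then show ?thesis using q[of t] w(2)[of "pr x0 + t *\<^sub>R \<nu>"] r[of t] by (simp add: poly_monom)
    qed
    then have qe: "q = monom 1 m * r" by (metis poly_eqI_degree poly_eq_poly_eq_iff ext)
    then have "r \<noteq> 0" using \<open>q \<noteq> 0\<close> by auto
    then show ?thesis unfolding qe by (subst degree_mult_eq) (auto simp: degree_monom_eq)
  qed
  have "0 \<in> A" using P by (auto simp: A_def)
  moreover have "finite A" using bd by (meson finite_nat_set_iff_bounded_le)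
  ultimately have MA: "Max A \<in> A" by (metis Max_in empty_iff)
  define m where "m = Max A"
  obtain w where w: "real_polynomial_function w" "\<And>x. P x = (c + \<nu> \<bullet> x) ^ m * w x" using MA unfolding m_def A_def by auto
  obtain Q where Q: "real_polynomial_function Q" "\<And>y. w y = (c + \<nu> \<bullet> y) * Q y + w (pr y)"
    using rpf_split[OF w(1) \<nu>, of c] unfolding pr_def by auto
  \<comment> \<open>If w vanished on the hyperplane, the remainder in \<open>rpf_split\<close> would
    be zero and one more factor could be split off.\<close>
  have "\<exists>y. w (pr y) \<noteq> 0"
  proof (rule ccontr)
    assume "\<not> ?thesis"
    then have "P x = (c + \<nu> \<bullet> x) ^ (Suc m) * Q x" for x using w(2)[of x] Q(2)[of x] by simp
    then have "Suc m \<in> A" using Q A_def by blast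
    then show False using \<open>finite A\<close> m_def by (metis Max_ge not_less_eq_eq order_refl)
  qed
  then show ?thesis using w pr0 by blast
qed

section \<open>Smooth functions\<close>

definition grad :: "(real^'d \<Rightarrow> real) \<Rightarrow> real^'d \<Rightarrow> real^'d" where
  "grad \<phi> x = (\<chi> i. partial_deriv i \<phi> x)"

lemma partial_deriv_eq: "(\<phi> has_derivative D) (at x) \<Longrightarrow> partial_deriv i \<phi> x = D (axis i 1)"
  unfolding partial_deriv_def by (metis frechet_derivative_at)

lemma partial_deriv_inner: "(\<phi> has_derivative (\<lambda>h. G \<bullet> h)) (at x) \<Longrightarrow> partial_deriv i \<phi> x = G $ i"
  by (drule partial_deriv_eq[where i = i]) (simp add: inner_axis)

lemma grad_eq: "(\<phi> has_derivative (\<lambda>h. G \<bullet> h)) (at x) \<Longrightarrow> grad \<phi> x = G"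
  by (simp add: grad_def vec_eq_iff partial_deriv_inner)

lemma has_derivative_grad:
  assumes "\<phi> differentiable (at x)"
  shows "(\<phi> has_derivative (\<lambda>h. grad \<phi> x \<bullet> h)) (at x)"
proof -
  obtain D where D: "(\<phi> has_derivative D) (at x)" using assms by (auto simp: differentiable_def)
  then interpret bounded_linear D by (rule has_derivative_bounded_linear)
  have "D h = grad \<phi> x \<bullet> h" for h
  proof -
    have "h = (\<Sum>i\<in>UNIV. h $ i *\<^sub>R axis i 1)" using basis_expansion[of h] by (simp add: scalar_mult_eq_scaleR)
    then have "D h = D (\<Sum>i\<in>UNIV. h $ i *\<^sub>R axis i 1)" by simp
    also have "\<dots> = (\<Sum>i\<in>UNIV. h $ i * D (axis i 1))" by (simp add: sum scaleR)
    finally show ?thesis by (simp add: grad_def inner_vec_def partial_deriv_eq[OF D] mult.commute)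
  qed
  then have "D = (\<lambda>h. grad \<phi> x \<bullet> h)" by (simp add: fun_eq_iff)
  then show ?thesis using D by simp
qed

lemma Ck_fun_mono: "Ck_fun (Suc n) f \<Longrightarrow> Ck_fun n f"
  by (induction n arbitrary: f)
    (auto intro!: continuous_at_imp_continuous_on differentiable_imp_continuous_within)

lemma Ck_fun_const: "Ck_fun n (\<lambda>x. c)"
proof (induction n arbitrary: c)
  case (Suc n)
  have "partial_deriv i (\<lambda>x. c) = (\<lambda>x. 0)" for i :: 'a
    using partial_deriv_eq[OF has_derivative_const[of c]] by auto
  then show ?case using Suc by simp
qed simp

lemma Ck_fun_add: "Ck_fun n f \<Longrightarrow> Ck_fun n g \<Longrightarrow> Ck_fun n (\<lambda>x. f x + g x)"
proof (induction n arbitrary: f g)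
  case (Suc n)
  have "partial_deriv i (\<lambda>x. f x + g x) = (\<lambda>x. partial_deriv i f x + partial_deriv i g x)" for i
  proof
    fix x
    have "((\<lambda>x. f x + g x) has_derivative (\<lambda>h. (grad f x + grad g x) \<bullet> h)) (at x)"
      using has_derivative_add[OF has_derivative_grad[of f x] has_derivative_grad[of g x]] Suc.prems
      by (auto simp: inner_add_left)
    then show "partial_deriv i (\<lambda>x. f x + g x) x = partial_deriv i f x + partial_deriv i g x"
      using partial_deriv_inner by (fastforce simp: grad_def)
  qed
  then show ?case using Suc by auto
qed (auto intro: continuous_on_add)

lemma Ck_fun_mult: "Ck_fun n f \<Longrightarrow> Ck_fun n g \<Longrightarrow> Ck_fun n (\<lambda>x. f x * g x)"
proof (induction n arbitrary: f g)
  case (Suc n)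
  have "partial_deriv i (\<lambda>x. f x * g x) = (\<lambda>x. f x * partial_deriv i g x + partial_deriv i f x * g x)" for i
  proof
    fix x
    have "((\<lambda>x. f x * g x) has_derivative (\<lambda>h. (f x *\<^sub>R grad g x + g x *\<^sub>R grad f x) \<bullet> h)) (at x)"
      using has_derivative_mult[OF has_derivative_grad[of f x] has_derivative_grad[of g x]] Suc.prems
      by (simp add: inner_add_left mult.commute)
    then show "partial_deriv i (\<lambda>x. f x * g x) x = f x * partial_deriv i g x + partial_deriv i f x * g x"
      using partial_deriv_inner by (fastforce simp: grad_def mult.commute)
  qed
  moreover have "Ck_fun n f" "Ck_fun n g" using Suc.prems Ck_fun_mono by blast+
  ultimately show ?case using Suc by (auto intro!: Ck_fun_add)
qed (auto intro: continuous_on_mult)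

lemma Ck_fun_prod: "(\<And>i. i \<in> I \<Longrightarrow> Ck_fun n (f i)) \<Longrightarrow> Ck_fun n (\<lambda>x. \<Prod>i\<in>I. f i x)"
  by (induction I rule: infinite_finite_induct) (auto intro: Ck_fun_mult Ck_fun_const)

lemma poly_space_Ck_fun: "P \<in> poly_space p \<Longrightarrow> Ck_fun n P"
proof (induction n arbitrary: P p)
  case 0
  obtain G where G: "\<And>x. (P has_derivative (\<lambda>h. G x \<bullet> h)) (at x)"
    by (rule poly_space_derivE[OF 0]) (rule that)
  have "continuous_on UNIV P" by (rule has_derivative_continuous_on[OF G])
  then show ?case by simp
next
  case (Suc n)
  obtain G where G: "\<And>x. (P has_derivative (\<lambda>h. G x \<bullet> h)) (at x)" "\<And>i. (\<lambda>x. G x $ i) \<in> poly_space (p - 1)"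
    by (rule poly_space_derivE[OF Suc.prems]) (rule that)
  have "partial_deriv i P = (\<lambda>x. G x $ i)" for i using partial_deriv_inner[OF G(1)] by auto
  then show ?case using G(1) Suc.IH[OF G(2)] by (auto simp: differentiable_def)
qed

text \<open>The factor \<open>inverse s ^ j\<close> makes the family closed under differentiation up to linear combinations.\<close>

definition bump1 :: "real \<Rightarrow> nat \<Rightarrow> real \<Rightarrow> real" where
  "bump1 k j s = (if s > 0 then exp (- (k * inverse s)) * inverse s ^ j else 0)"

lemma bump1_nonneg: "bump1 k j s \<ge> 0" by (simp add: bump1_def)

text \<open>The exponential dominates the power N = j + 2 of k / (s N). After the division by s^j
  two powers of s remain, just enough for a vanishing derivative at 0.\<close>

lemma bump1_quadratic_bound:
  assumes "k > 0" shows "\<exists>C\<ge>0. \<forall>s. bump1 k j s \<le> C * s\<^sup>2"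
proof -
  define N where "N = j + 2"
  define C where "C = (N / k) ^ N"
  have "bump1 k j s \<le> C * s\<^sup>2" for s
  proof (cases "s > 0")
    case True
    have "(k / s / N) ^ N \<le> (1 + k / s / N) ^ N" using True assms by (intro power_mono) auto
    also have "\<dots> \<le> exp (k / s)" using True assms by (intro exp_ge_one_plus_x_over_n_power_n) (auto simp: N_def intro: order_trans[of _ 0])
    finally have "inverse (exp (k / s)) \<le> inverse ((k / s / N) ^ N)"
      using True assms by (intro le_imp_inverse_le) (auto simp: N_def)
    also have "\<dots> = C * s ^ N" using True assms by (simp add: C_def power_divide field_simps)
    finally have "exp (- (k * inverse s)) \<le> C * s ^ N" by (simp add: exp_minus divide_inverse)
    then have "exp (- (k * inverse s)) * inverse s ^ j \<le> C * s ^ N * inverse s ^ j"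
      using True by (intro mult_right_mono) auto
    also have "\<dots> = C * s\<^sup>2" using True by (simp add: N_def power_add field_simps power2_eq_square)
    finally show ?thesis using True by (simp add: bump1_def)
  qed (auto simp: bump1_def C_def assms less_imp_le)
  moreover have "C \<ge> 0" using assms by (simp add: C_def)
  ultimately show ?thesis by blast
qed

text \<open>Away from 0 this is calculus on an open half line; at 0 the quadratic bound forces the
  difference quotient to 0, which is also the value of the right-hand side there.\<close>

lemma bump1_deriv:
  assumes "k > 0"
  shows "(bump1 k j has_real_derivative (k * bump1 k (j + 2) s - j * bump1 k (j + 1) s)) (at s)"
proof -
  consider "s < 0" | "s > 0" | "s = 0" by linarith
  then show ?thesis
  proof cases
    case 1
    have "(bump1 k j has_real_derivative 0) (at s)"
      by (rule has_field_derivative_transform_within_open[where f = "\<lambda>_. 0" and S = "{..<0}"])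
        (use 1 in \<open>auto simp: bump1_def\<close>)
    then show ?thesis using 1 by (simp add: bump1_def)
  next
    case 2
    have "((\<lambda>s. exp (- (k * inverse s)) * inverse s ^ j) has_real_derivative
        exp (- (k * inverse s)) * (k * (inverse s)\<^sup>2) * inverse s ^ j
        + exp (- (k * inverse s)) * (j * inverse s ^ (j - 1) * - (inverse s)\<^sup>2)) (at s)"
      using 2 by (auto intro!: derivative_eq_intros simp: power2_eq_square)
    also have "exp (- (k * inverse s)) * (k * (inverse s)\<^sup>2) * inverse s ^ j
        + exp (- (k * inverse s)) * (j * inverse s ^ (j - 1) * - (inverse s)\<^sup>2)
        = k * bump1 k (j + 2) s - j * bump1 k (j + 1) s"
      using 2 by (cases j) (auto simp: bump1_def algebra_simps power2_eq_square)
    finally show ?thesis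
      by (rule has_field_derivative_transform_within_open[where S = "{0<..}"])
        (use 2 in \<open>auto simp: bump1_def\<close>)
  next
    case 3
    obtain C where C: "C \<ge> 0" "\<And>s. bump1 k j s \<le> C * s\<^sup>2" using bump1_quadratic_bound[OF assms] by blast
    have "((\<lambda>h. bump1 k j h / h) \<longlongrightarrow> 0) (at 0)"
    proof (rule Lim_null_comparison)
      show "\<forall>\<^sub>F h in at 0. norm (bump1 k j h / h) \<le> C * \<bar>h\<bar>"
        using C(2) bump1_nonneg[of k j]
        by (intro always_eventually) (auto simp: divide_simps power2_eq_square mult.assoc)
      show "((\<lambda>h. C * \<bar>h\<bar>) \<longlongrightarrow> 0) (at (0::real))" by (auto intro!: tendsto_eq_intros)
    qed
    then show ?thesis using 3 by (simp add: DERIV_def bump1_def)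
  qed
qed

text \<open>Differentiation raises j by one and by two, so the induction on n has to run over all j
  at once.\<close>

lemma Ck_fun_bump1:
  assumes "k > 0" "\<And>n. Ck_fun n h"
  shows "Ck_fun n (\<lambda>x. bump1 k j (h x))"
proof (induction n arbitrary: j)
  case 0
  have "isCont (bump1 k j) s" for s using bump1_deriv[OF assms(1)] DERIV_isCont by blast
  then show ?case using assms(2)[of 0]
    unfolding Ck_fun.simps
    by (intro continuous_on_compose2[of UNIV "bump1 k j" UNIV h]) (simp_all add: continuous_at_imp_continuous_on)
next
  case (Suc n)
  have hd: "h differentiable (at x)" for x using assms(2)[of 1] by simp
  have d: "((\<lambda>x. bump1 k j (h x)) has_derivative
      (\<lambda>v. ((k * bump1 k (j + 2) (h x) - j * bump1 k (j + 1) (h x)) *\<^sub>R grad h x) \<bullet> v)) (at x)" for x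
    using has_derivative_compose[OF has_derivative_grad[OF hd] bump1_deriv[OF assms(1), unfolded has_field_derivative_def]]
    by simp
  have "partial_deriv i (\<lambda>x. bump1 k j (h x)) =
      (\<lambda>x. (k * bump1 k (j + 2) (h x) + (- real j) * bump1 k (j + 1) (h x)) * partial_deriv i h x)" for i
    using partial_deriv_inner[OF d] by (auto simp: grad_def)
  moreover have "Ck_fun n (\<lambda>x. (k * bump1 k (j + 2) (h x) + (- real j) * bump1 k (j + 1) (h x)) * partial_deriv i h x)" for i
    using assms(2)[of "Suc n"] by (intro Ck_fun_mult Ck_fun_add Ck_fun_const Suc.IH) auto
  ultimately show ?case using d by (auto simp: differentiable_def simp del: of_nat_Suc)
qed

section \<open>Test functions and their supports\<close>

lemma test_functionI:
  assumes "\<And>n. Ck_fun n \<phi>" "compact K" "K \<subseteq> X" "\<And>x. x \<notin> K \<Longrightarrow> \<phi> x = 0"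
  shows "\<phi> \<in> test_functions X"
proof -
  have "closure {x. \<phi> x \<noteq> 0} \<subseteq> K" using assms(2,4) by (intro closure_minimal compact_imp_closed) auto
  moreover from this have "compact (closure {x. \<phi> x \<noteq> 0})"
    using compact_Int_closed[OF assms(2) closed_closure, of "{x. \<phi> x \<noteq> 0}"] by (simp add: Int_absorb1)
  ultimately show ?thesis using assms by (auto simp: test_functions_def)
qed

lemma test_functionE:
  assumes "\<phi> \<in> test_functions X"
  obtains K where "compact K" "K \<subseteq> X" "\<And>x. x \<notin> K \<Longrightarrow> \<phi> x = 0" "\<And>x. x \<notin> K \<Longrightarrow> grad \<phi> x = 0"
    "\<And>x. (\<phi> has_derivative (\<lambda>h. grad \<phi> x \<bullet> h)) (at x)" "continuous_on UNIV \<phi>" "continuous_on UNIV (grad \<phi>)"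
proof -
  define K where "K = closure {x. \<phi> x \<noteq> 0}"
  have K: "compact K" "K \<subseteq> X" using assms by (auto simp: test_functions_def K_def)
  have z: "\<phi> x = 0" if "x \<notin> K" for x using that closure_subset[of "{x. \<phi> x \<noteq> 0}"] by (auto simp: K_def)
  have c: "continuous_on UNIV \<phi>" using assms Ck_fun.simps(1)[of \<phi>] by (auto simp: test_functions_def simp del: Ck_fun.simps)
  have c1: "Ck_fun (Suc 0) \<phi>" using assms by (auto simp: test_functions_def simp del: Ck_fun.simps)
  have d: "(\<phi> has_derivative (\<lambda>h. grad \<phi> x \<bullet> h)) (at x)" for x using c1 by (intro has_derivative_grad) auto
  have cg: "continuous_on UNIV (grad \<phi>)" using c1
    unfolding grad_def by (intro continuous_on_vec_lambda) (auto simp: eta_contract_eq)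
  have zg: "grad \<phi> x = 0" if "x \<notin> K" for x
  proof (rule grad_eq)
    have "((\<lambda>x. 0) has_derivative (\<lambda>h. 0 \<bullet> h)) (at x)" by (simp add: has_derivative_const)
    then show "(\<phi> has_derivative (\<lambda>h. 0 \<bullet> h)) (at x)"
      by (rule has_derivative_transform_within_open[where s = "- K"])
         (use that z compact_imp_closed[OF K(1)] in \<open>simp_all add: open_Compl\<close>)
  qed
  show ?thesis by (rule that[OF K z zg d c cg])
qed

lemma test_functions_mono: "X \<subseteq> Y \<Longrightarrow> test_functions X \<subseteq> test_functions Y"
  by (auto simp: test_functions_def)

section \<open>The fundamental lemma of the calculus of variations\<close>

text \<open>As k tends to 0 these functions converge to the indicator of the open box, so they take
  the place of mollified indicators.\<close>

definition box_bump :: "real \<Rightarrow> real^'d \<Rightarrow> real^'d \<Rightarrow> real^'d \<Rightarrow> real" where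
  "box_bump k a b x = (\<Prod>i\<in>UNIV. bump1 k 0 ((x $ i - a $ i) * (b $ i - x $ i)))"

lemma Ck_fun_box_bump:
  assumes "k > 0" shows "Ck_fun n (box_bump k a b :: real^'d \<Rightarrow> real)"
proof -
  have "(\<lambda>x. (- a $ i + axis i 1 \<bullet> x) * ((b $ i + (- axis i 1) \<bullet> x) * 1)) \<in> poly_space (Suc (Suc 0))" for i
    by (intro poly_space_mult_affine poly_space_const)
  then have "(\<lambda>x. (x $ i - a $ i) * (b $ i - x $ i)) \<in> poly_space 2" for i
    by (simp add: inner_axis' numeral_2_eq_2)
  then show ?thesis unfolding box_bump_def
    by (intro Ck_fun_prod Ck_fun_bump1 assms) (auto intro: poly_space_Ck_fun)
qed

lemma bump1_le_1: "k > 0 \<Longrightarrow> bump1 k 0 s \<le> 1" by (simp add: bump1_def)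

lemma box_bump_range: "k > 0 \<Longrightarrow> 0 \<le> box_bump k a b x \<and> box_bump k a b x \<le> 1"
  unfolding box_bump_def by (auto intro!: prod_nonneg bump1_nonneg prod_le_1 bump1_le_1)

text \<open>Outside a nonempty box some coordinate gives factors of opposite sign or a zero factor.
  For an empty box both factors could be negative and their product positive.\<close>

lemma box_bump_outside:
  assumes "box a b \<noteq> {}" "x \<notin> box a b" shows "box_bump k a b x = 0"
proof -
  have ab: "a $ i < b $ i" for i using assms(1) by (auto simp: mem_box_cart interval_ne_empty_cart)
  obtain i where "\<not> (a $ i < x $ i \<and> x $ i < b $ i)" using assms(2) by (auto simp: mem_box_cart)
  then have "(x $ i - a $ i) * (b $ i - x $ i) \<le> 0" using ab[of i]
    by (cases "a $ i < x $ i") (auto simp: mult_le_0_iff)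
  then show ?thesis unfolding box_bump_def
    by (intro prod_zero) (auto simp: bump1_def intro!: exI[of _ i])
qed

lemma box_bump_tendsto:
  assumes "box a b \<noteq> {}"
  shows "(\<lambda>n. box_bump (1 / real (Suc n)) a b x) \<longlonglongrightarrow> indicator (box a b) x"
proof (cases "x \<in> box a b")
  case False
  then show ?thesis using box_bump_outside[OF assms] by simp
next
  case True
  have "(\<lambda>n. bump1 (1 / real (Suc n)) 0 s) \<longlonglongrightarrow> 1" if "s > 0" for s
  proof -
    have "(\<lambda>n. exp (- ((1 / real (Suc n)) * inverse s))) \<longlonglongrightarrow> exp (- (0 * inverse s))"
      by (intro tendsto_intros LIMSEQ_Suc lim_inverse_n'[unfolded inverse_eq_divide])
    then show ?thesis using that by (simp add: bump1_def)
  qed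
  then have "(\<lambda>n. box_bump (1 / real (Suc n)) a b x) \<longlonglongrightarrow> (\<Prod>i\<in>(UNIV::'a set). 1)"
    unfolding box_bump_def using True by (intro tendsto_prod) (auto simp: mem_box_cart)
  then show ?thesis using True by simp
qed

lemma set_integrable_iff_of_support:
  assumes "\<And>x. x \<notin> X \<Longrightarrow> f x = 0"
  shows "set_integrable M X f \<longleftrightarrow> integrable M f"
    "set_lebesgue_integral M X f = integral\<^sup>L M f"
proof -
  have "(\<lambda>x. indicator X x *\<^sub>R f x) = f" using assms by (auto simp: indicator_def)
  then show "set_integrable M X f \<longleftrightarrow> integrable M f" "set_lebesgue_integral M X f = integral\<^sup>L M f"
    by (simp_all add: set_integrable_def set_lebesgue_integral_def)
qed

lemma locally_integrable_mult:
  fixes v :: "real^'d \<Rightarrow> 'b::euclidean_space"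
  assumes v: "locally_integrable X v" and K: "compact K" "K \<subseteq> X" and \<psi>: "continuous_on UNIV \<psi>"
    "\<And>x. x \<notin> K \<Longrightarrow> \<psi> x = (0::real)"
  shows "integrable lebesgue (\<lambda>x. \<psi> x *\<^sub>R v x)"
proof -
  have iv: "set_integrable lebesgue K v" using v K by (auto simp: locally_integrable_def)
  have "compact (\<psi> ` K)" using K \<psi> by (intro compact_continuous_image) (auto intro: continuous_on_subset)
  then obtain C where C: "\<And>x. x \<in> K \<Longrightarrow> \<bar>\<psi> x\<bar> \<le> C" using compact_imp_bounded bounded_iff by (metis imageI real_norm_def)
  have m: "\<psi> \<in> borel_measurable lebesgue" using \<psi>(1) by (simp add: borel_measurable_continuous_onI measurable_completion)
  have eq: "(\<lambda>x. \<psi> x *\<^sub>R v x) = (\<lambda>x. \<psi> x *\<^sub>R (indicator K x *\<^sub>R v x))"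
  proof
    show "\<psi> x *\<^sub>R v x = \<psi> x *\<^sub>R (indicator K x *\<^sub>R v x)" for x using \<psi>(2)[of x] by (cases "x \<in> K") auto
  qed
  show ?thesis unfolding eq
  proof (rule Bochner_Integration.integrable_bound)
    show "integrable lebesgue (\<lambda>x. C *\<^sub>R (indicator K x *\<^sub>R v x))"
      using iv unfolding set_integrable_def by (rule integrable_scaleR_right)
    show "(\<lambda>x. \<psi> x *\<^sub>R indicat_real K x *\<^sub>R v x) \<in> borel_measurable lebesgue"
      using m borel_measurable_integrable[OF iv[unfolded set_integrable_def]]
      by (rule borel_measurable_scaleR)
    show "AE x in lebesgue. norm (\<psi> x *\<^sub>R indicat_real K x *\<^sub>R v x) \<le> norm (C *\<^sub>R (indicator K x *\<^sub>R v x))"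
      using C by (intro AE_I2) (auto simp: indicator_def intro!: mult_right_mono order_trans[OF C])
  qed
qed

text \<open>Boxes are stable under intersection and generate the Borel sets, so the vanishing of
  integrals spreads to all of them by a Dynkin argument; \<open>tot\<close> serves the complement
  step. Lebesgue sets differ from Borel sets by null sets.\<close>

lemma AE_zero_of_box_integrals:
  fixes h :: "real^'d \<Rightarrow> real"
  assumes h: "integrable lebesgue h" and box: "\<And>a b. (LINT x:box a b|lebesgue. h x) = 0"
    and tot: "(LINT x|lebesgue. h x) = 0"
  shows "AE x in lebesgue. h x = 0"
proof -
  have si: "set_integrable lebesgue S h" if "S \<in> sets lebesgue" for S
    using h that unfolding set_integrable_def by (rule integrable_mult_indicator[rotated])
  have borel: "(LINT x:S|lebesgue. h x) = 0" if S: "S \<in> sets borel" for S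
  proof -
    have sS: "S \<in> sigma_sets UNIV (range (\<lambda>(a, b). box a b :: (real^'d) set))"
      using S unfolding borel_eq_box by simp
    have I: "Int_stable (range (\<lambda>(a, b). box a b :: (real^'d) set))"
    proof (rule Int_stableI)
      fix A B :: "(real^'d) set" assume "A \<in> range (\<lambda>(a, b). box a b)" "B \<in> range (\<lambda>(a, b). box a b)"
      then obtain a b c d where "A = box a b" "B = box c d" by auto
      then show "A \<inter> B \<in> range (\<lambda>(a, b). box a b)" by (auto simp: box_Int_box)
    qed
    have P: "range (\<lambda>(a, b). box a b :: (real^'d) set) \<subseteq> Pow UNIV" by simp
    show ?thesis using sS
    proof (induction rule: sigma_sets_induct_disjoint[OF I P, consumes 1, case_names basic empty compl union])
      case (basic A)
      then show ?case using box by auto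
    next
      case empty
      show ?case by (simp add: set_lebesgue_integral_def)
    next
      case (compl A)
      then have Ab: "A \<in> sets lebesgue"
        by (metis borel_eq_box sets_completionI_sets sets_lborel sets_measure_of subset_Pow_Union top_greatest Pow_UNIV)
      have "(LINT x:A \<union> (UNIV - A)|lebesgue. h x) = (LINT x:A|lebesgue. h x) + (LINT x:UNIV - A|lebesgue. h x)"
        using Ab by (intro set_integral_Un si) auto
      then show ?case using compl tot by (simp add: set_lebesgue_integral_def)
    next
      case (union A)
      then have Ab: "A i \<in> sets lebesgue" for i
        by (metis borel_eq_box sets_completionI_sets sets_lborel sets_measure_of subset_Pow_Union top_greatest Pow_UNIV range_subsetD)
      have "(LINT x:(\<Union>i. A i)|lebesgue. h x) = (\<Sum>i. (LINT x:(A i)|lebesgue. h x))"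
        using union Ab by (intro lebesgue_integral_countable_add si) (auto simp: disjoint_family_on_def)
      then show ?case using union by simp
    qed
  qed
  show ?thesis
  proof (rule density_unique_real[OF h])
    show "(LINT x:A|lebesgue. h x) = (LINT x:A|lebesgue. 0)" if A: "A \<in> sets lebesgue" for A
    proof -
      obtain B N where BN: "B \<in> sets borel" "negligible N" "B \<union> N = A"
        using sets_lebesgue_almost_borel[OF A] by metis
      have "(LINT x:A|lebesgue. h x) = (LINT x:B|lebesgue. h x)"
      proof (rule set_integral_cong_set)
        show "set_borel_measurable lebesgue B h" "set_borel_measurable lebesgue A h"
          using si[of B] si[OF A] BN(1) by (auto simp: set_borel_measurable_def set_integrable_def)
        have "AE x in lebesgue. x \<notin> N" using BN(2) by (simp add: negligible_iff_null_sets AE_not_in)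
        then show "AE x in lebesgue. (x \<in> B) = (x \<in> A)" using BN by (auto elim!: eventually_mono)
      qed
      then show ?thesis using borel[OF BN(1)] by simp
    qed
  qed simp
qed

text \<open>Dominated convergence along box bumps shows that g has integral zero over every box
  whose closed box lies in X. Countably many such closed boxes cover X.\<close>

lemma fundamental_lemma:
  fixes g :: "real^'d \<Rightarrow> real"
  assumes X: "open X" and g: "locally_integrable X g"
    and z: "\<And>\<phi>. \<phi> \<in> test_functions X \<Longrightarrow> (LINT x:X|lebesgue. g x * \<phi> x) = 0"
  shows "AE x\<in>X in lebesgue. g x = 0"
proof -
  have box0: "(LINT x:box a b|lebesgue. g x) = 0" if ab: "cbox a b \<subseteq> X" for a b
  proof (cases "box a b = {}")
    case True
    then show ?thesis by (simp add: set_lebesgue_integral_def)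
  next
    case False
    define \<phi> where "\<phi> n = box_bump (1 / real (Suc n)) a b" for n
    have \<phi>0: "\<phi> n x = 0" if "x \<notin> cbox a b" for n x
      using box_bump_outside[OF False, of x] that subsetD[OF box_subset_cbox, of x a b] by (auto simp: \<phi>_def)
    have t: "\<phi> n \<in> test_functions X" for n
      by (rule test_functionI[of _ "cbox a b"]) (use ab \<phi>0 in \<open>auto simp: \<phi>_def intro: Ck_fun_box_bump\<close>)
    have cont: "continuous_on UNIV (\<phi> n)" for n using Ck_fun_box_bump[of "1 / real (Suc n)" 0 a b] by (simp add: \<phi>_def)
    have gi: "integrable lebesgue (\<lambda>x. \<phi> n x *\<^sub>R g x)" for n
      by (rule locally_integrable_mult[OF g _ ab cont]) (use \<phi>0 in auto)
    have ig: "set_integrable lebesgue (cbox a b) g" using g ab by (auto simp: locally_integrable_def)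
    have ig': "set_integrable lebesgue (box a b) g"
      by (rule set_integrable_subset[OF ig]) (auto simp: box_subset_cbox)
    have "(\<lambda>n. LINT x|lebesgue. \<phi> n x *\<^sub>R g x) \<longlonglongrightarrow> (LINT x|lebesgue. indicator (box a b) x *\<^sub>R g x)"
    proof (rule integral_dominated_convergence[where w = "\<lambda>x. norm (indicator (cbox a b) x *\<^sub>R g x)"])
      show "(\<lambda>x. indicat_real (box a b) x *\<^sub>R g x) \<in> borel_measurable lebesgue"
        using ig' by (auto simp: set_integrable_def)
      show "(\<lambda>x. \<phi> n x *\<^sub>R g x) \<in> borel_measurable lebesgue" for n using gi by auto
      show "integrable lebesgue (\<lambda>x. norm (indicat_real (cbox a b) x *\<^sub>R g x))"
        using ig unfolding set_integrable_def by (rule integrable_norm)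
      show "AE x in lebesgue. (\<lambda>n. \<phi> n x *\<^sub>R g x) \<longlonglongrightarrow> indicat_real (box a b) x *\<^sub>R g x"
        unfolding \<phi>_def by (intro AE_I2 tendsto_scaleR box_bump_tendsto False tendsto_const)
      show "AE x in lebesgue. norm (\<phi> n x *\<^sub>R g x) \<le> norm (indicat_real (cbox a b) x *\<^sub>R g x)" for n
        using box_bump_range[of "1 / real (Suc n)" a b] \<phi>0[of _ n]
        by (intro AE_I2) (auto simp: indicator_def \<phi>_def abs_mult intro!: mult_left_le_one_le)
    qed
    moreover have "(LINT x|lebesgue. \<phi> n x *\<^sub>R g x) = 0" for n
    proof -
      have "(LINT x:X|lebesgue. g x * \<phi> n x) = (LINT x|lebesgue. \<phi> n x *\<^sub>R g x)"
        by (subst set_integrable_iff_of_support(2)) (use \<phi>0 ab in \<open>auto simp: mult.commute\<close>)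
      then show ?thesis using z[OF t] by simp
    qed
    ultimately have "(\<lambda>n. 0) \<longlonglongrightarrow> (LINT x|lebesgue. indicator (box a b) x *\<^sub>R g x)" by simp
    then show ?thesis unfolding set_lebesgue_integral_def by (simp add: LIMSEQ_const_iff)
  qed
  have cb: "AE x\<in>cbox a b in lebesgue. g x = 0" if ab: "cbox a b \<subseteq> X" for a b
  proof -
    \<comment> \<open>Cutting off to one box makes the function integrable on the whole
      space.\<close>
    define h where "h x = indicator (box a b) x *\<^sub>R g x" for x
    have ig: "set_integrable lebesgue (cbox a b) g" using g ab by (auto simp: locally_integrable_def)
    have "set_integrable lebesgue (box a b) g"
      by (rule set_integrable_subset[OF ig]) (auto simp: box_subset_cbox)
    then have h: "integrable lebesgue h" by (simp add: set_integrable_def h_def[abs_def])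
    have "AE x in lebesgue. h x = 0"
    proof (rule AE_zero_of_box_integrals[OF h])
      show "(LINT x|lebesgue. h x) = 0" using box0[OF ab] by (simp add: set_lebesgue_integral_def h_def)
      show "(LINT x:box c d|lebesgue. h x) = 0" for c d
      proof -
        obtain e f where ef: "box c d \<inter> box a b = box e f" by (auto simp: box_Int_box)
        have "(LINT x:box c d|lebesgue. h x) = (LINT x:box e f|lebesgue. g x)"
          unfolding set_lebesgue_integral_def h_def ef[symmetric]
          by (intro Bochner_Integration.integral_cong) (auto simp: indicator_def)
        moreover have "(LINT x:box e f|lebesgue. g x) = 0"
        proof (cases "box e f = {}")
          case True then show ?thesis by (simp add: set_lebesgue_integral_def)
        next
          case False
          \<comment> \<open>\<open>box0\<close> asks for the closed box to lie in X; it stays inside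
            \<open>cbox a b\<close>.\<close>
          have "closure (box e f) \<subseteq> cbox a b" using ef box_subset_cbox by (intro closure_minimal) auto
          then show ?thesis using False ab by (intro box0) (auto simp: closure_box)
        qed
        ultimately show ?thesis by simp
      qed
    qed
    moreover have "AE x in lebesgue. x \<notin> cbox a b - box a b"
      by (rule AE_not_in) (use negligible_frontier_interval negligible_iff_null_sets in blast)
    ultimately show ?thesis by eventually_elim (auto simp: h_def indicator_def split: if_splits)
  qed
  obtain \<D> where D: "countable \<D>" "\<D> \<subseteq> Pow X" "\<And>Y. Y \<in> \<D> \<Longrightarrow> \<exists>a b. Y = cbox a b" "\<Union>\<D> = X"
    using open_countable_Union_open_cbox[OF X] by metis
  have "AE x\<in>Y in lebesgue. g x = 0" if "Y \<in> \<D>" for Y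
    using D(3)[OF that] D(2) that cb by auto
  then have "AE x in lebesgue. \<forall>Y\<in>\<D>. x \<in> Y \<longrightarrow> g x = 0"
    by (intro AE_ball_countable[OF D(1), THEN iffD2] ballI)
  then show ?thesis by (rule eventually_mono) (use D(4) in auto)
qed

section \<open>Change of variables\<close>

lemma nn_integral_lborel_shift:
  fixes f :: "'a::euclidean_space \<Rightarrow> ennreal"
  assumes [measurable]: "f \<in> borel_measurable borel"
  shows "(\<integral>\<^sup>+x. f (x + c) \<partial>lborel) = (\<integral>\<^sup>+x. f x \<partial>lborel)"
  by (subst (2) lborel_distr_plus[of c, symmetric], subst nn_integral_distr) (auto simp: add.commute)

text \<open>The library's change of variables for linear maps needs a well-ordered index type, so
  uniqueness of translation invariant measures is used instead.\<close>

lemma nn_integral_linear_image_aux: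
  fixes L :: "'a::euclidean_space \<Rightarrow> 'a"
  assumes L: "linear L" "inj L" and f[measurable]: "f \<in> borel_measurable borel"
  shows "(\<integral>\<^sup>+y. f y \<partial>lborel) * (\<integral>\<^sup>+x. indicator (ball 0 1) (L x) \<partial>lborel)
       = (\<integral>\<^sup>+x. f (L x) \<partial>lborel) * emeasure lborel (ball (0::'a) 1)"
proof -
  obtain M where M: "linear M" "\<And>x. L (M x) = x"
    using linear_injective_isomorphism[OF L] by auto
  have [measurable]: "L \<in> borel_measurable borel"
    using L linear_continuous_on linear_conv_bounded_linear by (intro borel_measurable_continuous_onI) auto
  \<comment> \<open>A reference function of known positive mass; the double integral of f (y + L x)
    g (L x) is computed in both orders.\<close>
  define g :: "'a \<Rightarrow> ennreal" where "g = indicator (ball 0 1)"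
  have [measurable]: "g \<in> borel_measurable borel" unfolding g_def by (intro borel_measurable_indicator) simp
  have "(\<integral>\<^sup>+y. f y \<partial>lborel) * (\<integral>\<^sup>+x. g (L x) \<partial>lborel) = (\<integral>\<^sup>+x. (\<integral>\<^sup>+y. f (y + L x) * g (L x) \<partial>lborel) \<partial>lborel)"
  proof -
    have "(\<integral>\<^sup>+y. f (y + L x) * g (L x) \<partial>lborel) = (\<integral>\<^sup>+y. f y \<partial>lborel) * g (L x)" for x
      using nn_integral_lborel_shift[of f "L x"] by (subst nn_integral_multc) auto
    then show ?thesis by (simp add: nn_integral_cmult)
  qed
  also have "\<dots> = (\<integral>\<^sup>+y. (\<integral>\<^sup>+x. f (y + L x) * g (L x) \<partial>lborel) \<partial>lborel)"
    by (rule lborel_pair.Fubini'[symmetric]) measurable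
  also have "\<dots> = (\<integral>\<^sup>+y. (\<integral>\<^sup>+x. f (L x) * g (L x - y) \<partial>lborel) \<partial>lborel)"
  proof (rule nn_integral_cong)
    \<comment> \<open>Translating x by - M y, with L (M y) = y, moves the shift by y from f to
      g.\<close>
    fix y
    have "(\<integral>\<^sup>+x. f (y + L (x + (- M y))) * g (L (x + (- M y))) \<partial>lborel) = (\<integral>\<^sup>+x. f (y + L x) * g (L x) \<partial>lborel)"
      by (rule nn_integral_lborel_shift) measurable
    moreover have "L (x + (- M y)) = L x - y" for x using L M by (simp add: linear_add linear_neg linear_diff)
    ultimately show "(\<integral>\<^sup>+x. f (y + L x) * g (L x) \<partial>lborel) = (\<integral>\<^sup>+x. f (L x) * g (L x - y) \<partial>lborel)"
      by simp
  qed
  also have "\<dots> = (\<integral>\<^sup>+x. (\<integral>\<^sup>+y. f (L x) * g (L x - y) \<partial>lborel) \<partial>lborel)"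
    by (rule lborel_pair.Fubini') measurable
  also have "\<dots> = (\<integral>\<^sup>+x. f (L x) \<partial>lborel) * emeasure lborel (ball (0::'a) 1)"
  proof -
    have "(\<integral>\<^sup>+y. f (L x) * g (L x - y) \<partial>lborel) = f (L x) * emeasure lborel (ball (0::'a) 1)" for x
    proof -
      have "g (L x - y) = g (y + (- L x))" for y by (auto simp: g_def indicator_def norm_minus_commute)
      then have "(\<integral>\<^sup>+y. g (L x - y) \<partial>lborel) = (\<integral>\<^sup>+y. g y \<partial>lborel)"
        using nn_integral_lborel_shift[of g "- L x"] by simp
      moreover have "(\<lambda>y. g (L x - y)) \<in> borel_measurable borel" by measurable
      ultimately show ?thesis by (simp add: nn_integral_cmult) (simp add: g_def)
    qed
    then show ?thesis by (simp add: nn_integral_multc)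
  qed
  finally show ?thesis unfolding g_def .
qed

text \<open>The auxiliary lemma for indicators shows that the image of Lebesgue measure under L is n
  / m times Lebesgue measure, where m is the volume of the unit ball and n that of its preimage.
  Thus c is 1 / |det L|; only its positivity and its independence of f matter later.\<close>

lemma integral_affine_change:
  fixes L :: "'a::euclidean_space \<Rightarrow> 'a"
  assumes L: "linear L" "inj L"
  shows "\<exists>c>0. \<forall>f::'a\<Rightarrow>real. f \<in> borel_measurable borel \<longrightarrow> (LINT x|lborel. f (b + L x)) = c * (LINT x|lborel. f x)"
proof -
  obtain M where M: "linear M" "\<And>x. L (M x) = x" "\<And>x. M (L x) = x"
    using linear_injective_isomorphism[OF L] by auto
  have cL: "continuous_on UNIV L" using L linear_continuous_on linear_conv_bounded_linear by auto
  have Lm[measurable]: "L \<in> borel_measurable borel" using cL by (rule borel_measurable_continuous_onI)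
  define B where "B = ball (0::'a) 1"
  define m where "m = measure lborel B"
  have mB: "emeasure lborel B = ennreal m" using emeasure_bounded_finite[of B] by (auto simp: m_def B_def emeasure_eq_ennreal_measure less_top)
  have "emeasure lborel B \<noteq> 0"
    using open_not_negligible[of B] by (simp add: B_def negligible_iff_emeasure0)
  then have m0: "m > 0" using mB measure_nonneg[of lborel B] by (auto simp: m_def less_le)
  define A where "A = L -` B"
  have AM: "A = M ` B" using M by (auto simp: A_def image_iff) metis
  have oA: "open A" unfolding A_def B_def using cL by (intro open_vimage) auto
  have "bounded A" unfolding AM B_def using M(1) linear_conv_bounded_linear by (intro bounded_linear_image bounded_ball) auto
  define n where "n = measure lborel A"
  have nA: "emeasure lborel A = ennreal n"
    using emeasure_bounded_finite[OF \<open>bounded A\<close>] by (auto simp: n_def emeasure_eq_ennreal_measure less_top)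
  have "0 \<in> A" using L by (simp add: A_def B_def linear_0)
  then have "emeasure lborel A \<noteq> 0"
    using open_not_negligible[OF oA] oA by (auto simp: negligible_iff_emeasure0)
  then have n0: "n > 0" using nA measure_nonneg[of lborel A] by (auto simp: n_def less_le)
  have Ameas: "A \<in> sets borel" using oA by simp
  have i: "(\<integral>\<^sup>+x. indicator (ball 0 1) (L x) \<partial>lborel) = ennreal n"
  proof -
    have "(\<integral>\<^sup>+x. indicator (ball 0 1) (L x) \<partial>lborel) = (\<integral>\<^sup>+x. indicator A x \<partial>lborel)"
      by (intro nn_integral_cong) (auto simp: A_def B_def indicator_def)
    then show ?thesis using nA Ameas by simp
  qed
  have D: "distr lborel borel L = density lborel (\<lambda>_. ennreal (n / m))"
  proof (rule measure_eqI)
    fix S assume "S \<in> sets (distr lborel borel L)"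
    then have S[measurable]: "S \<in> sets borel" by simp
    have "emeasure (distr lborel borel L) S = (\<integral>\<^sup>+x. indicator S (L x) \<partial>lborel)"
      by (subst emeasure_distr) (auto simp: nn_integral_indicator[symmetric] indicator_def vimage_def simp del: nn_integral_indicator intro!: nn_integral_cong)
    then have "emeasure (distr lborel borel L) S * ennreal m = emeasure lborel S * ennreal n"
      using nn_integral_linear_image_aux[OF L, of "indicator S"] i mB by (simp add: B_def)
    then have "emeasure (distr lborel borel L) S * (ennreal m * ennreal (1 / m)) = emeasure lborel S * (ennreal n * ennreal (1 / m))"
      by (simp add: mult.assoc[symmetric])
    then show "emeasure (distr lborel borel L) S = emeasure (density lborel (\<lambda>_. ennreal (n / m))) S"
      using m0 n0 by (simp add: ennreal_mult[symmetric] emeasure_density nn_integral_multc mult.commute)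
  qed simp
  have "(LINT x|lborel. f (b + L x)) = (n / m) * (LINT x|lborel. f x)" if f[measurable]: "f \<in> borel_measurable borel" for f :: "'a \<Rightarrow> real"
  proof -
    have "(LINT x|lborel. f (b + L x)) = (LINT x|distr lborel borel L. f (b + x))"
      by (subst integral_distr) auto
    also have "\<dots> = (LINT x|lborel. (n / m) *\<^sub>R f (b + x))"
      unfolding D using m0 n0 by (subst integral_density) auto
    also have "\<dots> = (n / m) * (LINT x|lborel. f (b + x))" by simp
    also have "(LINT x|lborel. f (b + x)) = (LINT x|distr lborel borel ((+) b). f x)"
      by (subst integral_distr) auto
    also have "\<dots> = (LINT x|lborel. f x)" by (simp add: lborel_distr_plus)
    finally show ?thesis .
  qed
  then show ?thesis using m0 n0 by (intro exI[of _ "n / m"]) auto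
qed

lemma integral_homothety:
  fixes f :: "real^'d \<Rightarrow> real"
  assumes [measurable]: "f \<in> borel_measurable borel" and s: "s > 0"
  shows "(LINT x|lborel. f x) = s ^ CARD('d) * (LINT x|lborel. f (a + s *\<^sub>R (x - a)))"
proof -
  have "(LINT x|lborel. f x) = (LINT x|density (distr lborel borel (\<lambda>x. (a - s *\<^sub>R a) + s *\<^sub>R x)) (\<lambda>_. ennreal (s ^ CARD('d))). f x)"
    using lborel_affine[of s "a - s *\<^sub>R a"] s by simp
  also have "\<dots> = (LINT x|lborel. s ^ CARD('d) *\<^sub>R f ((a - s *\<^sub>R a) + s *\<^sub>R x))"
    using s by (subst integral_density) (auto simp: integral_distr)
  finally show ?thesis by (simp add: scaleR_diff_right algebra_simps)
qed

section \<open>Integration by parts\<close>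

lemma lipschitz_of_grad_bound:
  fixes \<psi> :: "real^'d \<Rightarrow> real"
  assumes "convex T" "\<And>x. x \<in> T \<Longrightarrow> (\<psi> has_derivative (\<lambda>h. G x \<bullet> h)) (at x)" "\<And>x. x \<in> T \<Longrightarrow> norm (G x) \<le> B"
    "x \<in> T" "y \<in> T"
  shows "\<bar>\<psi> x - \<psi> y\<bar> \<le> B * norm (x - y)"
proof -
  have "onorm (\<lambda>h. G x \<bullet> h) \<le> B" if "x \<in> T" for x
  proof (rule onorm_bound)
    show "0 \<le> B" using assms(3)[OF that] norm_ge_zero order_trans by blast
    show "norm (G x \<bullet> h) \<le> B * norm h" for h
      using Cauchy_Schwarz_ineq2[of "G x" h] mult_right_mono[OF assms(3)[OF that] norm_ge_zero[of h]] by simp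
  qed
  then show ?thesis
    using differentiable_bound[of T \<psi> "\<lambda>x h. G x \<bullet> h" B x y] assms has_derivative_at_withinI by fastforce
qed

text \<open>Difference quotients in direction v integrate to zero by translation invariance. They
  are bounded by the Lipschitz constant on a common ball and converge to the directional
  derivative.\<close>

lemma integral_directional_deriv_zero:
  fixes \<psi> :: "real^'d \<Rightarrow> real"
  assumes d: "\<And>x. (\<psi> has_derivative (\<lambda>h. G x \<bullet> h)) (at x)" and G: "continuous_on UNIV G"
    and K: "compact K" "\<And>x. x \<notin> K \<Longrightarrow> \<psi> x = 0" "\<And>x. x \<notin> K \<Longrightarrow> G x = 0"
  shows "integrable lborel (\<lambda>x. G x \<bullet> v)" "(LINT x|lborel. G x \<bullet> v) = 0"
proof -
  have cont: "continuous_on UNIV \<psi>" by (rule has_derivative_continuous_on[OF d])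
  have [measurable]: "\<psi> \<in> borel_measurable borel" "G \<in> borel_measurable borel"
    using cont G by (auto intro: borel_measurable_continuous_onI)
  have "compact (G ` K)" using G K by (intro compact_continuous_image) (auto intro: continuous_on_subset)
  then obtain B0 where B0: "\<And>x. x \<in> K \<Longrightarrow> norm (G x) \<le> B0" using compact_imp_bounded bounded_iff by (metis imageI)
  define B where "B = max B0 0"
  have B: "norm (G x) \<le> B" for x using B0[of x] K(3)[of x] by (cases "x \<in> K") (auto simp: B_def)
  have B0: "B \<ge> 0" by (simp add: B_def)
  have lip: "\<bar>\<psi> x - \<psi> y\<bar> \<le> B * norm (x - y)" for x y
    by (rule lipschitz_of_grad_bound[OF convex_UNIV d B]) auto
  obtain r where r: "\<And>x. x \<in> K \<Longrightarrow> norm x \<le> r" using compact_imp_bounded[OF K(1)] bounded_iff by metis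
  \<comment> \<open>Every shift is at most \<open>norm v\<close> long, so this ball contains the
    supports of all difference quotients.\<close>
  define C where "C = cball (0::real^'d) (r + norm v)"
  have ci: "integrable lborel (\<lambda>x. indicat_real C x * (B * norm v))"
    using emeasure_bounded_finite[of C]
    by (intro integrable_mult_left integrable_real_indicator) (auto simp: C_def)
  define s where "s n x = (\<psi> (x + (1 / real (Suc n)) *\<^sub>R v) - \<psi> x) * real (Suc n)" for n x
  have [measurable]: "s n \<in> borel_measurable borel" for n unfolding s_def by measurable
  have lim: "(\<lambda>n. s n x) \<longlonglongrightarrow> G x \<bullet> v" for x
  proof -
    have "((\<lambda>t. \<psi> (x + t *\<^sub>R v)) has_derivative (\<lambda>t. G x \<bullet> (t *\<^sub>R v))) (at 0)"
      by (rule has_derivative_compose[of "\<lambda>t. x + t *\<^sub>R v" "\<lambda>t. t *\<^sub>R v" 0 UNIV \<psi>, simplified])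
        (use d in \<open>auto intro!: derivative_eq_intros\<close>)
    then have "((\<lambda>t. \<psi> (x + t *\<^sub>R v)) has_real_derivative (G x \<bullet> v)) (at 0)"
      by (simp add: has_field_derivative_def mult.commute[of _ "G x \<bullet> v"] fun_eq_iff)
    then have "((\<lambda>t. (\<psi> (x + t *\<^sub>R v) - \<psi> x) / t) \<longlongrightarrow> G x \<bullet> v) (at 0)" by (simp add: DERIV_def)
    moreover have "filterlim (\<lambda>n. 1 / real (Suc n)) (at 0) sequentially"
      using lim_1_over_n[THEN LIMSEQ_Suc] by (auto simp: filterlim_at)
    ultimately have "(\<lambda>n. (\<psi> (x + (1 / real (Suc n)) *\<^sub>R v) - \<psi> x) / (1 / real (Suc n))) \<longlonglongrightarrow> G x \<bullet> v"
      by (rule filterlim_compose)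
    then show ?thesis by (simp add: s_def)
  qed
  have bd: "norm (s n x) \<le> indicat_real C x * (B * norm v)" for n x
  proof (cases "x \<in> C")
    case True
    have "\<bar>s n x\<bar> \<le> B * norm ((1 / real (Suc n)) *\<^sub>R v) * real (Suc n)"
      unfolding s_def abs_mult using lip[of "x + (1 / real (Suc n)) *\<^sub>R v" x] by (intro mult_mono) auto
    then show ?thesis using True by simp
  next
    case False
    have "norm v / real (Suc n) \<le> norm v" using mult_left_mono[of 1 "1 + real n" "norm v"] by (simp add: divide_le_eq)
    then have "x \<notin> K" "x + (1 / real (Suc n)) *\<^sub>R v \<notin> K"
      using False r[of x] r[of "x + (1 / real (Suc n)) *\<^sub>R v"] norm_triangle_ineq2[of x "- ((1 / real (Suc n)) *\<^sub>R v)"] norm_ge_zero[of v]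
      by (auto simp: C_def)
    then show ?thesis using K False by (simp add: s_def)
  qed
  note dct = integrable_dominated_convergence[where w = "\<lambda>x. indicat_real C x * (B * norm v)" and s = s and f = "\<lambda>x. G x \<bullet> v" and M = lborel]
    integral_dominated_convergence[where w = "\<lambda>x. indicat_real C x * (B * norm v)" and s = s and f = "\<lambda>x. G x \<bullet> v" and M = lborel]
  show "integrable lborel (\<lambda>x. G x \<bullet> v)"
    by (rule dct(1)) (use ci lim bd in auto)
  have "(\<lambda>n. LINT x|lborel. s n x) \<longlonglongrightarrow> (LINT x|lborel. G x \<bullet> v)"
    by (rule dct(2)) (use ci lim bd in auto)
  moreover have "(LINT x|lborel. s n x) = 0" for n
  proof -
    have i: "integrable lborel \<psi>"
    proof -
      have "compact (\<psi> ` K)" using cont K by (intro compact_continuous_image) (auto intro: continuous_on_subset)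
      then obtain A where A: "\<And>x. x \<in> K \<Longrightarrow> norm (\<psi> x) \<le> A" using compact_imp_bounded bounded_iff by (metis imageI)
      show ?thesis
      proof (rule Bochner_Integration.integrable_bound[of _ "\<lambda>x. indicat_real K x * A"])
        show "integrable lborel (\<lambda>x. indicat_real K x * A)"
          using K(1) emeasure_bounded_finite[OF compact_imp_bounded[OF K(1)]]
          by (intro integrable_mult_left integrable_real_indicator) (auto simp: compact_imp_closed)
        show "AE x in lborel. norm (\<psi> x) \<le> norm (indicat_real K x * A)"
          using A K(2) by (intro AE_I2) (fastforce simp: indicator_def)
      qed simp
    qed
    have j: "integrable lborel (\<lambda>x. \<psi> (x + c))" "(LINT x|lborel. \<psi> (x + c)) = (LINT x|lborel. \<psi> x)" for c
    proof -
      have D: "distr lborel borel ((+) c) = lborel" by (rule lborel_distr_plus)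
      have "integrable (distr lborel borel ((+) c)) \<psi>" using i D by simp
      then show "integrable lborel (\<lambda>x. \<psi> (x + c))"
        by (subst (asm) integrable_distr_eq) (auto simp: add.commute)
      have "(LINT x|distr lborel borel ((+) c). \<psi> x) = (LINT x|lborel. \<psi> (x + c))"
        by (subst integral_distr) (auto simp: add.commute)
      then show "(LINT x|lborel. \<psi> (x + c)) = (LINT x|lborel. \<psi> x)" using D by simp
    qed
    show ?thesis unfolding s_def using i j by (simp add: Bochner_Integration.integral_diff)
  qed
  ultimately show "(LINT x|lborel. G x \<bullet> v) = 0" by (simp add: LIMSEQ_const_iff)
qed

text \<open>Homotheties centred at the apex turn the divergence of \<open>\<psi>(x) (x - a)\<close> into the derivative at
  \<open>s = 1\<close> of the integral of \<open>\<psi>\<close> over the shrunken cone; as \<open>\<psi>\<close> vanishes on the base, the missing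
  layer contributes only \<open>o(1 - s)\<close>.\<close>

lemma cone_divergence:
  fixes \<psi> l :: "real^'d \<Rightarrow> real"
  assumes d: "\<And>x. (\<psi> has_derivative (\<lambda>h. G x \<bullet> h)) (at x)" and G: "continuous_on UNIV G"
    and T: "compact T" "convex T" "a \<in> T" and l: "continuous_on UNIV l"
    and img: "\<And>s. 0 < s \<Longrightarrow> s < 1 \<Longrightarrow> (\<lambda>x. a + s *\<^sub>R (x - a)) ` T = {x\<in>T. l x \<ge> 1 - s}"
    and bound: "\<And>x. x \<in> T \<Longrightarrow> \<bar>\<psi> x\<bar> \<le> C * l x"
    and l0: "\<And>x. x \<in> T \<Longrightarrow> l x \<ge> 0" and null: "AE x in lborel. x \<in> T \<longrightarrow> l x \<noteq> 0"
  shows "(LINT x:T|lborel. CARD('d) * \<psi> x + G x \<bullet> (x - a)) = 0"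
proof -
  have cont: "continuous_on UNIV \<psi>" by (rule has_derivative_continuous_on[OF d])
  have [measurable]: "\<psi> \<in> borel_measurable borel" "G \<in> borel_measurable borel" "l \<in> borel_measurable borel"
    using cont G l by (auto intro: borel_measurable_continuous_onI)
  have [measurable]: "T \<in> sets borel" using T by (simp add: compact_imp_closed)
  have "compact (G ` T)" "compact (\<psi> ` T)"
    using G T cont by (auto intro!: compact_continuous_image intro: continuous_on_subset)
  then obtain B M where B: "\<And>x. x \<in> T \<Longrightarrow> norm (G x) \<le> B" and M: "\<And>x. x \<in> T \<Longrightarrow> norm (\<psi> x) \<le> M"
    using compact_imp_bounded bounded_iff by (metis imageI)
  have B0: "B \<ge> 0" using B[OF T(3)] norm_ge_zero order_trans by blast
  have Mb: "\<bar>\<psi> x\<bar> \<le> \<bar>M\<bar>" if "x \<in> T" for x using M[OF that] by simp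
  have M0: "M \<ge> 0" using M[OF T(3)] norm_ge_zero order_trans by blast
  obtain R where R: "\<And>x. x \<in> T \<Longrightarrow> norm (x - a) \<le> R"
    using bounded_translation_minus[OF compact_imp_bounded[OF T(1)], of a] by (auto simp: bounded_iff)
  have Tfin: "emeasure lborel T < \<infinity>" using emeasure_bounded_finite[OF compact_imp_bounded[OF T(1)]] by simp
  have ind: "integrable lborel (\<lambda>x. indicat_real T x * c)" for c
    using Tfin by (intro integrable_mult_left integrable_real_indicator) auto
  let ?d = "CARD('d)"
  \<comment> \<open>The offset 2 keeps every \<open>s n\<close> strictly between 0 and 1.\<close>
  define s where "s n = 1 - 1 / real (n + 2)" for n
  have s: "0 < s n" "s n < 1" for n by (auto simp: s_def divide_simps)
  have slim: "filterlim s (at 1) sequentially"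
  proof -
    have "(\<lambda>n. 1 - 1 / real (n + 2)) \<longlonglongrightarrow> 1 - 0"
      by (intro tendsto_diff tendsto_const LIMSEQ_ignore_initial_segment lim_1_over_n)
    then show ?thesis using s(2) by (auto simp: filterlim_at s_def[abs_def] less_imp_neq)
  qed
  define h where "h n x = a + s n *\<^sub>R (x - a)" for n x
  have hT: "h n x \<in> T" if "x \<in> T" for n x
    using convexD_alt[OF T(2) T(3) that, of "s n"] s[of n] by (simp add: h_def algebra_simps)
  \<comment> \<open>Difference quotient at s = 1 of s^d \<psi>(a + s (x - a)); the power is the
    Jacobian of the homothety, and the limit is the divergence \<open>g\<close>.\<close>
  define D where "D n x = (s n ^ ?d * \<psi> (h n x) - \<psi> x) / (s n - 1)" for n x
  define g where "g x = ?d * \<psi> x + G x \<bullet> (x - a)" for x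
  have [measurable]: "h n \<in> borel_measurable borel" for n unfolding h_def by measurable
  have [measurable]: "D n \<in> borel_measurable borel" for n unfolding D_def by measurable
  have [measurable]: "g \<in> borel_measurable borel" unfolding g_def by measurable
  have limD: "(\<lambda>n. D n x) \<longlonglongrightarrow> g x" for x
  proof -
    have "((\<lambda>t. \<psi> (a + t *\<^sub>R (x - a))) has_derivative (\<lambda>t. G x \<bullet> (t *\<^sub>R (x - a)))) (at 1)"
    proof (rule has_derivative_compose[of "\<lambda>t. a + t *\<^sub>R (x - a)" "\<lambda>t. t *\<^sub>R (x - a)" 1 UNIV \<psi> "\<lambda>h. G x \<bullet> h"])
      show "((\<lambda>t. a + t *\<^sub>R (x - a)) has_derivative (\<lambda>t. t *\<^sub>R (x - a))) (at 1)"
        by (auto intro!: derivative_eq_intros)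
      show "(\<psi> has_derivative (\<lambda>h. G x \<bullet> h)) (at (a + 1 *\<^sub>R (x - a)))" using d by simp
    qed
    moreover have "(\<lambda>t. G x \<bullet> (t *\<^sub>R (x - a))) = (*) (G x \<bullet> (x - a))" by auto
    ultimately have e: "((\<lambda>t. \<psi> (a + t *\<^sub>R (x - a))) has_real_derivative (G x \<bullet> (x - a))) (at 1)"
      by (simp add: has_field_derivative_def)
    have "((\<lambda>t. t ^ ?d * \<psi> (a + t *\<^sub>R (x - a))) has_real_derivative g x) (at 1)"
      by (rule derivative_eq_intros refl e)+ (simp add: g_def)
    then have "((\<lambda>t. (t ^ ?d * \<psi> (a + t *\<^sub>R (x - a)) - \<psi> x) / (t - 1)) \<longlongrightarrow> g x) (at 1)"
      by (simp add: has_field_derivative_iff)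
    then show ?thesis unfolding D_def h_def using slim by (rule filterlim_compose)
  qed
  have bdD: "\<bar>D n x\<bar> \<le> B * R + M * ?d" if x: "x \<in> T" for n x
  proof -
    have "\<bar>\<psi> (h n x) - \<psi> x\<bar> \<le> B * norm (h n x - x)"
      by (rule lipschitz_of_grad_bound[OF T(2) d B]) (use x hT in auto)
    also have "h n x - x = (1 - s n) *\<^sub>R (a - x)" by (simp add: h_def algebra_simps)
    also have "norm \<dots> = (1 - s n) * norm (x - a)" using s[of n] by (simp add: norm_minus_commute)
    finally have 1: "\<bar>\<psi> (h n x) - \<psi> x\<bar> \<le> B * ((1 - s n) * R)"
      using R[OF x] B0 s[of n] by (meson diff_ge_0_iff_ge less_imp_le mult_left_mono order_trans)
    \<comment> \<open>Bernoulli's inequality bounds 1 - s^d by d (1 - s), which keeps the difference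
      quotients bounded uniformly in n.\<close>
    have "1 - ?d * (1 - s n) \<le> s n ^ ?d" using Bernoulli_inequality[of "s n - 1" ?d] s[of n] by (simp add: algebra_simps)
    then have 2: "\<bar>s n ^ ?d - 1\<bar> \<le> ?d * (1 - s n)" using s[of n] power_le_one[of "s n" ?d] by simp
    have "\<bar>s n ^ ?d * \<psi> (h n x) - \<psi> x\<bar> = \<bar>s n ^ ?d * (\<psi> (h n x) - \<psi> x) + (s n ^ ?d - 1) * \<psi> x\<bar>"
      by (simp add: algebra_simps)
    also have "\<dots> \<le> s n ^ ?d * \<bar>\<psi> (h n x) - \<psi> x\<bar> + \<bar>s n ^ ?d - 1\<bar> * \<bar>\<psi> x\<bar>"
      using abs_triangle_ineq s[of n] by (metis abs_mult abs_of_nonneg less_imp_le zero_le_power)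
    also have "\<dots> \<le> 1 * (B * ((1 - s n) * R)) + (?d * (1 - s n)) * M"
      using 1 2 M[OF x] s[of n] by (intro add_mono mult_mono) (auto intro: power_le_one)
    also have "\<dots> = (B * R + M * ?d) * (1 - s n)" by (simp add: algebra_simps)
    finally have "\<bar>s n ^ ?d * \<psi> (h n x) - \<psi> x\<bar> / (1 - s n) \<le> B * R + M * ?d"
      using s[of n] by (simp add: divide_le_eq)
    moreover have "\<bar>s n - 1\<bar> = 1 - s n" using s[of n] by simp
    ultimately show ?thesis by (simp add: D_def abs_divide)
  qed
  have A: "(\<lambda>n. LINT x|lborel. indicat_real T x * D n x) \<longlonglongrightarrow> (LINT x|lborel. indicat_real T x * g x)"
  proof (rule integral_dominated_convergence[where w = "\<lambda>x. indicat_real T x * (B * R + M * ?d)"])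
    show "AE x in lborel. (\<lambda>n. indicat_real T x * D n x) \<longlonglongrightarrow> indicat_real T x * g x"
      by (intro AE_I2 tendsto_mult tendsto_const limD)
    show "AE x in lborel. norm (indicat_real T x * D n x) \<le> indicat_real T x * (B * R + M * ?d)" for n
      using bdD by (intro AE_I2) (auto simp: indicator_def)
  qed (use ind in auto)
  \<comment> \<open>The layer of T that the homothety misses. On it |\<psi>| is at most |C| (1 - s),
    so the quotient is bounded, and the layers shrink to the null set l = 0.\<close>
  define E where "E n x = indicat_real T x * (indicat_real {y. l y < 1 - s n} x * (\<psi> x / (1 - s n)))" for n x
  have [measurable]: "E n \<in> borel_measurable borel" for n unfolding E_def by measurable
  have "(LINT x|lborel. indicat_real T x * D n x) = (LINT x|lborel. E n x)" for n
  proof -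
    \<comment> \<open>\<psi> cut off to the image of T under the homothety, so that F after h n is
      \<psi> after h n, cut off to T.\<close>
    define F where "F y = indicat_real T y * (indicat_real {y. l y \<ge> 1 - s n} y * \<psi> y)" for y
    have Fm[measurable]: "F \<in> borel_measurable borel" unfolding F_def by measurable
    have Fh: "F (h n x) = indicat_real T x * \<psi> (h n x)" for x
    proof -
      have "h n x \<in> T \<and> l (h n x) \<ge> 1 - s n \<longleftrightarrow> x \<in> T"
      proof -
        have "inj (h n)" using s[of n] by (auto simp: h_def inj_def)
        then have "h n x \<in> h n ` T \<longleftrightarrow> x \<in> T" by (simp add: inj_image_mem_iff)
        then show ?thesis using img[of "s n"] s[of n] unfolding h_def by auto
      qed
      then show ?thesis by (auto simp: F_def indicator_def)
    qed
    have iF: "integrable lborel F"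
      by (rule Bochner_Integration.integrable_bound[OF ind[of M]]) (use Mb in \<open>auto simp: F_def indicator_def intro!: AE_I2\<close>)
    have i\<psi>: "integrable lborel (\<lambda>x. indicat_real T x * \<psi> x)"
      by (rule Bochner_Integration.integrable_bound[OF ind[of M]]) (use Mb in \<open>auto simp: indicator_def intro!: AE_I2\<close>)
    have i\<psi>h: "integrable lborel (\<lambda>x. indicat_real T x * \<psi> (h n x))"
      by (rule Bochner_Integration.integrable_bound[OF ind[of M]]) (use Mb hT in \<open>auto simp: indicator_def intro!: AE_I2\<close>)
    have "(LINT x|lborel. indicat_real T x * D n x)
       = (LINT x|lborel. (s n ^ ?d * (indicat_real T x * \<psi> (h n x)) - indicat_real T x * \<psi> x) / (s n - 1))"
      by (intro Bochner_Integration.integral_cong) (auto simp: D_def indicator_def)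
    also have "\<dots> = (s n ^ ?d * (LINT x|lborel. indicat_real T x * \<psi> (h n x)) - (LINT x|lborel. indicat_real T x * \<psi> x)) / (s n - 1)"
      using i\<psi> i\<psi>h by simp
    also have "s n ^ ?d * (LINT x|lborel. indicat_real T x * \<psi> (h n x)) = (LINT x|lborel. F x)"
      using integral_homothety[OF Fm s(1), of n a] Fh by (simp add: h_def)
    also have "((LINT x|lborel. F x) - (LINT x|lborel. indicat_real T x * \<psi> x)) / (s n - 1)
       = (LINT x|lborel. (F x - indicat_real T x * \<psi> x) / (s n - 1))"
      using iF i\<psi> by simp
    also have "\<dots> = (LINT x|lborel. E n x)"
      using s[of n] by (intro Bochner_Integration.integral_cong) (auto simp: F_def E_def indicator_def divide_simps, simp add: algebra_simps)
    finally show ?thesis .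
  qed
  moreover have "(\<lambda>n. LINT x|lborel. E n x) \<longlonglongrightarrow> integral\<^sup>L lborel (\<lambda>x::real^'d. 0::real)"
  proof (rule integral_dominated_convergence[where w = "\<lambda>x. indicat_real T x * \<bar>C\<bar>"])
    show "AE x in lborel. (\<lambda>n. E n x) \<longlonglongrightarrow> 0"
    proof (rule eventually_mono[OF null])
      fix x assume x: "x \<in> T \<longrightarrow> l x \<noteq> 0"
      show "(\<lambda>n. E n x) \<longlonglongrightarrow> 0"
      proof (cases "x \<in> T")
        case True
        then have "l x > 0" using x l0 by force
        moreover have "(\<lambda>n. 1 - s n) \<longlonglongrightarrow> 0"
          using lim_1_over_n[THEN LIMSEQ_ignore_initial_segment, of 2] by (simp add: s_def)
        ultimately have "\<forall>\<^sub>F n in sequentially. 1 - s n < l x" by (auto dest: order_tendstoD)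
        then have "\<forall>\<^sub>F n in sequentially. E n x = 0" by (rule eventually_mono) (auto simp: E_def)
        then show ?thesis by (rule tendsto_eventually)
      qed (simp add: E_def)
    qed
    show "AE x in lborel. norm (E n x) \<le> indicat_real T x * \<bar>C\<bar>" for n
    proof (intro AE_I2)
      fix x
      have "\<bar>\<psi> x\<bar> / (1 - s n) \<le> \<bar>C\<bar>" if "x \<in> T" "l x < 1 - s n"
      proof -
        have "\<bar>\<psi> x\<bar> \<le> \<bar>C\<bar> * l x" using bound[OF that(1)] l0[OF that(1)]
          by (meson abs_ge_self mult_right_mono order_trans)
        also have "\<dots> \<le> \<bar>C\<bar> * (1 - s n)" using that by (intro mult_left_mono) auto
        finally show ?thesis using s[of n] by (simp add: divide_le_eq)
      qed
      then show "norm (E n x) \<le> indicat_real T x * \<bar>C\<bar>" using s[of n] by (auto simp: E_def indicator_def)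
    qed
  qed (use ind in auto)
  ultimately have "(LINT x|lborel. indicat_real T x * g x) = 0"
    using A by (simp add: LIMSEQ_unique)
  then show ?thesis by (simp add: set_lebesgue_integral_def g_def)
qed

section \<open>Barycentric coordinates\<close>

text \<open>Affinity is demanded of every \<open>l v\<close>, also for v outside C, so that
  statements about affine combinations need no membership premise. The cardinality makes the simplex
  full-dimensional.\<close>

definition barycentric :: "(real^'d) set \<Rightarrow> (real^'d \<Rightarrow> real^'d \<Rightarrow> real) \<Rightarrow> bool" where
  "barycentric C l \<longleftrightarrow> finite C \<and> card C = Suc CARD('d) \<and> (\<forall>v. \<exists>c n. \<forall>x. l v x = c + n \<bullet> x) \<and> (\<forall>x. (\<Sum>v\<in>C. l v x) = 1) \<and>
     (\<forall>x. (\<Sum>v\<in>C. l v x *\<^sub>R v) = x) \<and> (\<forall>v\<in>C. \<forall>w\<in>C. l v w = of_bool (v = w))"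

text \<open>The edge vectors from one vertex a form a basis; the coordinates of the other vertices
  are the dual basis evaluated at x - a.\<close>

lemma barycentric_exists:
  fixes C :: "(real^'d) set"
  assumes C: "\<not> affine_dependent C" "card C = Suc CARD('d)"
  shows "\<exists>l. barycentric C l"
proof -
  have fin: "finite C" using C(1) by (rule aff_independent_finite)
  obtain a where a: "a \<in> C" using C(2) by fastforce
  define B where "B = (\<lambda>x. x - a) ` (C - {a})"
  have ind: "independent B" using C(1) affine_dependent_iff_dependent2[OF a] by (simp add: B_def)
  have "affine hull C = UNIV" using C by (intro affine_independent_span_eq) auto
  then have "(\<lambda>x. a + x) ` span B = UNIV" using affine_hull_span2[OF a] by (simp add: B_def)
  then have span: "span B = UNIV"
    by (metis (no_types, lifting) UNIV_I UNIV_eq_I add_left_imp_eq imageE)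
  have "\<exists>n. \<forall>b\<in>B. n \<bullet> b = of_bool (b = v - a)" for v
  proof -
    obtain f where f: "linear f" "\<forall>b\<in>B. f b = (of_bool (b = v - a) :: real)"
      using linear_independent_extend[OF ind] by meson
    \<comment> \<open>The vector representing the linear functional f.\<close>
    have "adjoint f 1 \<bullet> x = f x" for x using adjoint_works[OF f(1), of x 1] by (simp add: inner_commute)
    then show ?thesis using f(2) by metis
  qed
  then obtain n where n: "\<And>v b. b \<in> B \<Longrightarrow> n v \<bullet> b = of_bool (b = v - a)" by metis
  have rep: "(\<Sum>v\<in>C - {a}. (n v \<bullet> y) *\<^sub>R (v - a)) = y" for y
  proof -
    define F where "F = (\<lambda>y. \<Sum>v\<in>C - {a}. (n v \<bullet> y) *\<^sub>R (v - a))"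
    have lF: "linear F" unfolding F_def
      by (intro linear_compose_sum ballI linearI) (auto simp: inner_add_right scaleR_add_left)
    have "F y = id y"
    proof (rule linear_eq_on_span[OF lF linear_id, of B])
      fix b assume "b \<in> B"
      then obtain w where w: "w \<in> C - {a}" "b = w - a" by (auto simp: B_def)
      have "(\<Sum>v\<in>C - {a}. (n v \<bullet> b) *\<^sub>R (v - a)) = (\<Sum>v\<in>C - {a}. if w = v then v - a else 0)"
        using n[OF \<open>b \<in> B\<close>] w by (intro sum.cong) (auto simp: of_bool_def)
      then show "F b = id b" using w fin by (simp add: F_def)
    qed (auto simp: span)
    then show ?thesis by (simp add: F_def)
  qed
  \<comment> \<open>The vertex a receives what is missing to the sum 1.\<close>
  define l where "l v x = (if v = a then 1 - (\<Sum>u\<in>C - {a}. n u \<bullet> (x - a)) else n v \<bullet> (x - a))" for v x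
  have "\<exists>c m. \<forall>x. l v x = c + m \<bullet> x" for v
  proof (cases "v = a")
    case True
    show ?thesis
      by (rule exI[of _ "1 + (\<Sum>u\<in>C - {a}. n u \<bullet> a)"], rule exI[of _ "- (\<Sum>u\<in>C - {a}. n u)"])
        (simp add: l_def True inner_diff_right inner_sum_left sum_subtractf)
  next
    case False
    show ?thesis
      by (rule exI[of _ "- (n v \<bullet> a)"], rule exI[of _ "n v"]) (simp add: l_def False inner_diff_right)
  qed
  moreover have one: "(\<Sum>v\<in>C. l v x) = 1" for x
    unfolding sum.remove[OF fin a] by (simp add: l_def)
  moreover have "(\<Sum>v\<in>C. l v x *\<^sub>R v) = x" for x
  proof -
    have "(\<Sum>v\<in>C. l v x *\<^sub>R v) = (\<Sum>v\<in>C. l v x *\<^sub>R (v - a)) + a"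
      using one[of x] by (simp add: scaleR_diff_right sum_subtractf flip: scaleR_left.sum)
    also have "(\<Sum>v\<in>C. l v x *\<^sub>R (v - a)) = (\<Sum>v\<in>C - {a}. (n v \<bullet> (x - a)) *\<^sub>R (v - a))"
      unfolding sum.remove[OF fin a] by (simp add: l_def)
    finally show ?thesis using rep[of "x - a"] by simp
  qed
  moreover have "l v w = of_bool (v = w)" if "v \<in> C" "w \<in> C" for v w
  proof (cases "w = a")
    case True
    then show ?thesis by (simp add: l_def)
  next
    case False
    then have wB: "w - a \<in> B" using that by (auto simp: B_def)
    have "(\<Sum>u\<in>C - {a}. n u \<bullet> (w - a)) = (\<Sum>u\<in>C - {a}. if w = u then 1 else 0)"
      by (intro sum.cong refl) (simp add: n[OF wB])
    then show ?thesis using n[OF wB, of v] False that fin by (auto simp: l_def)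
  qed
  ultimately show ?thesis using fin C(2) unfolding barycentric_def by blast
qed

context
  fixes C :: "(real^'d) set" and l
  assumes bary: "barycentric C l"
begin

lemma bary_finite: "finite C" and bary_sum: "(\<Sum>v\<in>C. l v x) = 1"
  and bary_rep: "(\<Sum>v\<in>C. l v x *\<^sub>R v) = x"
  and bary_vertex: "v \<in> C \<Longrightarrow> w \<in> C \<Longrightarrow> l v w = of_bool (v = w)"
  using bary unfolding barycentric_def by blast+

lemma bary_affine: "\<exists>c n. \<forall>x. l v x = c + n \<bullet> x"
  using bary unfolding barycentric_def by blast

lemma bary_comb:
  assumes "(\<Sum>i\<in>A. u i) = 1"
  shows "l v (\<Sum>i\<in>A. u i *\<^sub>R y i) = (\<Sum>i\<in>A. u i * l v (y i))"
proof -
  obtain c n where n: "\<And>x. l v x = c + n \<bullet> x" using bary_affine[of v] by blast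
  have "(\<Sum>i\<in>A. u i * l v (y i)) = (\<Sum>i\<in>A. u i) * c + (\<Sum>i\<in>A. u i * (n \<bullet> y i))"
    by (simp add: n distrib_left sum.distrib sum_distrib_right)
  then show ?thesis using assms by (simp add: n inner_sum_right)
qed

lemma bary_line: "l v (x + s *\<^sub>R (y - x)) = (1 - s) * l v x + s * l v y"
proof -
  obtain c n where n: "\<And>x. l v x = c + n \<bullet> x" using bary_affine[of v] by blast
  show ?thesis by (simp add: n inner_add_right inner_diff_right algebra_simps)
qed

lemma bary_continuous: "continuous_on UNIV (l v)"
proof -
  obtain c n where n: "\<And>x. l v x = c + n \<bullet> x" using bary_affine[of v] by blast
  have "l v = (\<lambda>x. c + n \<bullet> x)" using n by auto
  then show ?thesis by (simp add: continuous_intros)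
qed

lemma bary_unique:
  assumes "(\<Sum>w\<in>C. u w) = 1" "(\<Sum>w\<in>C. u w *\<^sub>R w) = x" "v \<in> C"
  shows "l v x = u v"
proof -
  have "l v x = (\<Sum>w\<in>C. u w * l v w)" using bary_comb[OF assms(1), of v "\<lambda>w. w"] assms(2) by simp
  also have "\<dots> = (\<Sum>w\<in>C. if v = w then u w else 0)"
    using bary_vertex[OF assms(3)] by (intro sum.cong) auto
  finally show ?thesis using assms(3) bary_finite by simp
qed

lemma bary_hull: "convex hull C = {x. \<forall>v\<in>C. 0 \<le> l v x}"
proof -
  have "\<forall>v\<in>C. 0 \<le> l v x" if x: "x \<in> convex hull C" for x
  proof -
    obtain u where u: "\<forall>v\<in>C. 0 \<le> u v" "sum u C = 1" "(\<Sum>v\<in>C. u v *\<^sub>R v) = x"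
      using x unfolding convex_hull_finite[OF bary_finite] by auto
    show ?thesis using bary_unique[OF u(2,3)] u(1) by simp
  qed
  moreover have "x \<in> convex hull C" if "\<forall>v\<in>C. 0 \<le> l v x" for x
    unfolding convex_hull_finite[OF bary_finite] using that bary_sum bary_rep by (intro CollectI exI[of _ "\<lambda>v. l v x"]) auto
  ultimately show ?thesis by blast
qed

lemma bary_open: "open {x. \<forall>v\<in>C. 0 < l v x}"
proof -
  have "{x. \<forall>v\<in>C. 0 < l v x} = (\<Inter>v\<in>C. l v -` {0<..})" by auto
  then show ?thesis using bary_finite bary_continuous by (auto intro!: open_INT open_vimage)
qed

lemma bary_interior: "{x. \<forall>v\<in>C. 0 < l v x} \<subseteq> interior (convex hull C)"
  using bary_open unfolding bary_hull by (intro interior_maximal) (auto intro: less_imp_le)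

lemma bary_card: "card C = Suc CARD('d)" using bary unfolding barycentric_def by blast

lemma bary_interior_nonempty: "interior (convex hull C) \<noteq> {}"
proof -
  define x where "x = (\<Sum>v\<in>C. (1 / real (card C)) *\<^sub>R v)"
  have c: "card C > 0" using bary_card by simp
  then have "l v x = 1 / real (card C)" if "v \<in> C" for v
    by (intro bary_unique[OF _ _ that]) (auto simp: x_def)
  then have "x \<in> {x. \<forall>v\<in>C. 0 < l v x}" using c by auto
  then show ?thesis using bary_interior by blast
qed

text \<open>The homothety multiplies the coordinates of the other vertices by s and turns that of a
  into 1 - s + s times itself. Hence the inverse image has nonnegative coordinates exactly when
  \<open>l a\<close> is at least 1 - s.\<close>

lemma bary_homothety_image:
  assumes a: "a \<in> C" and s: "0 < s" "s < 1"
  shows "(\<lambda>x. a + s *\<^sub>R (x - a)) ` (convex hull C) = {x \<in> convex hull C. l a x \<ge> 1 - s}"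
proof (intro equalityI subsetI)
  fix y assume "y \<in> (\<lambda>x. a + s *\<^sub>R (x - a)) ` (convex hull C)"
  then obtain x where x: "\<forall>v\<in>C. 0 \<le> l v x" "y = a + s *\<^sub>R (x - a)" unfolding bary_hull by auto
  show "y \<in> {x \<in> convex hull C. l a x \<ge> 1 - s}"
    using x(1) s a by (auto simp: bary_hull x(2) bary_line bary_vertex of_bool_def)
next
  fix y assume y: "y \<in> {x \<in> convex hull C. l a x \<ge> 1 - s}"
  define x where "x = a + (1 / s) *\<^sub>R (y - a)"
  have "y = a + s *\<^sub>R (x - a)" using s by (simp add: x_def)
  moreover have "0 \<le> l v x" if v: "v \<in> C" for v
  proof (cases "v = a")
    case True
    have "l a x = (l a y - (1 - s)) / s"
      unfolding x_def bary_line using s a by (simp add: bary_vertex field_simps)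
    then show ?thesis using y s True by simp
  next
    case False
    then show ?thesis unfolding x_def bary_line using y s a v by (auto simp: bary_vertex bary_hull)
  qed
  then have "x \<in> convex hull C" by (simp add: bary_hull)
  ultimately show "y \<in> (\<lambda>x. a + s *\<^sub>R (x - a)) ` (convex hull C)" by blast
qed

lemma bary_nonconst:
  assumes "a \<in> C" "\<And>x. l a x = c + n \<bullet> x" shows "n \<noteq> 0"
proof
  assume "n = 0"
  have "card (C - {a}) = CARD('d)" using bary_card assms(1) bary_finite by simp
  then have "C - {a} \<noteq> {}" by (metis card.empty zero_less_card_finite less_irrefl)
  then obtain b where "b \<in> C" "b \<noteq> a" by blast
  then show False using bary_vertex[of a a] bary_vertex[of a b] assms \<open>n = 0\<close> by simp
qed

lemma bary_null:
  assumes "a \<in> C" shows "AE x in lborel. l a x \<noteq> 0"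
proof -
  obtain c n where n: "\<And>x. l a x = c + n \<bullet> x" using bary_affine[of a] by blast
  have "negligible {x. n \<bullet> x = - c}" using negligible_hyperplane bary_nonconst[OF assms n] by blast
  moreover have "{x. n \<bullet> x = - c} \<in> sets borel" by (simp add: closed_hyperplane)
  ultimately have "{x. n \<bullet> x = - c} \<in> null_sets lborel"
    by (metis negligible_iff_null_sets null_sets_completion_iff sets_lborel)
  then have "AE x in lborel. x \<notin> {x. n \<bullet> x = - c}" by (rule AE_not_in)
  then show ?thesis by (rule eventually_mono) (auto simp: n)
qed

end

text \<open>What remains is the linear bound of \<psi> by \<open>l a\<close>: x lies on the segment
  from a to a point y of the opposite facet, at the fraction \<open>l a x\<close> away from y, and
  \<psi> vanishes at y, so the mean value inequality applies.\<close>

lemma cone_divergence_simplex: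
  fixes \<psi> :: "real^'d \<Rightarrow> real"
  assumes bary: "barycentric C l" and a: "a \<in> C"
    and d: "\<And>x. (\<psi> has_derivative (\<lambda>h. G x \<bullet> h)) (at x)" and G: "continuous_on UNIV G"
    and base: "\<And>x. x \<in> convex hull (C - {a}) \<Longrightarrow> \<psi> x = 0"
  shows "(LINT x:convex hull C|lborel. CARD('d) * \<psi> x + G x \<bullet> (x - a)) = 0"
proof -
  define T where "T = convex hull C"
  have fin: "finite C" by (rule bary_finite[OF bary])
  have T: "compact T" "convex T" "a \<in> T"
    using fin a by (auto simp: T_def finite_imp_compact_convex_hull hull_inc)
  have cont: "continuous_on UNIV \<psi>" by (rule has_derivative_continuous_on[OF d])
  have "compact (G ` T)" "compact (\<psi> ` T)"
    using G T cont by (auto intro!: compact_continuous_image intro: continuous_on_subset)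
  then obtain B M where B: "\<And>x. x \<in> T \<Longrightarrow> norm (G x) \<le> B" and M: "\<And>x. x \<in> T \<Longrightarrow> norm (\<psi> x) \<le> M"
    using compact_imp_bounded bounded_iff by (metis imageI)
  obtain R where R: "\<And>x. x \<in> T \<Longrightarrow> norm (x - a) \<le> R"
    using bounded_translation_minus[OF compact_imp_bounded[OF T(1)], of a] by (auto simp: bounded_iff)
  have B0: "B \<ge> 0" using B[OF T(3)] norm_ge_zero order_trans by blast
  have M0: "M \<ge> 0" using M[OF T(3)] norm_ge_zero order_trans by blast
  show ?thesis unfolding T_def[symmetric]
  \<comment> \<open>\<open>B * R\<close> is gradient bound times diameter bound; M covers the apex,
    where \<open>l a x = 1\<close> and no projection to the facet exists.\<close>
  proof (rule cone_divergence[OF d G, where l = "l a" and C = "B * R + M"])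
    show "(\<lambda>x. a + s *\<^sub>R (x - a)) ` T = {x \<in> T. 1 - s \<le> l a x}" if "0 < s" "s < 1" for s
      unfolding T_def by (rule bary_homothety_image[OF bary a that])
    show "AE x in lborel. x \<in> T \<longrightarrow> l a x \<noteq> 0" using bary_null[OF bary a] by (rule eventually_mono) simp
    fix x assume x: "x \<in> T"
    then have l: "\<And>v. v \<in> C \<Longrightarrow> 0 \<le> l v x" unfolding T_def bary_hull[OF bary] by blast
    show "0 \<le> l a x" using l a by simp
    have le1: "l a x \<le> 1"
      using bary_sum[OF bary, of x] sum_nonneg[of "C - {a}" "\<lambda>v. l v x"] l sum.remove[OF fin a, of "\<lambda>v. l v x"] by auto
    show "\<bar>\<psi> x\<bar> \<le> (B * R + M) * l a x"
    proof (cases "l a x = 1")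
      case True
      have "R \<ge> 0" using R[OF T(3)] by simp
      then show ?thesis using M[OF x] B0 True by (simp add: add_increasing)
    next
      case False
      \<comment> \<open>With this t, y below is the central projection of x from a onto the opposite
        facet.\<close>
      define t where "t = 1 - l a x"
      have t: "0 < t" "t \<le> 1" using False le1 l[OF a] by (auto simp: t_def)
      define y where "y = a + (1 / t) *\<^sub>R (x - a)"
      have ly: "l v y = (1 - 1 / t) * l v a + (1 / t) * l v x" for v
        unfolding y_def by (rule bary_line[OF bary])
      have "l a y = 0" using t bary_vertex[OF bary a a] unfolding ly by (simp add: t_def field_simps)
      moreover have "0 \<le> l v y" if "v \<in> C" "v \<noteq> a" for v
        using t l[OF that(1)] bary_vertex[OF bary that(1) a] that unfolding ly by simp
      ultimately have ly0: "\<forall>v\<in>C. 0 \<le> l v y" "l a y = 0" by (metis order_refl)+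
      then have yT: "y \<in> T" by (simp add: T_def bary_hull[OF bary])
      have "(\<Sum>v\<in>C - {a}. l v y *\<^sub>R v) = y" "(\<Sum>v\<in>C - {a}. l v y) = 1"
        using bary_rep[OF bary, of y] bary_sum[OF bary, of y] ly0(2)
          sum.remove[OF fin a, of "\<lambda>v. l v y"] sum.remove[OF fin a, of "\<lambda>v. l v y *\<^sub>R v"] by auto
      then have "y \<in> convex hull (C - {a})"
        using ly0(1) fin by (subst convex_hull_finite) (auto intro!: exI[of _ "\<lambda>v. l v y"])
      then have "\<psi> y = 0" by (rule base)
      have "\<bar>\<psi> x - \<psi> y\<bar> \<le> B * norm (x - y)"
        by (rule lipschitz_of_grad_bound[OF T(2) d B x yT])
      also have "x - y = (1 - t) *\<^sub>R (a - y)"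
      proof -
        have "x - y = (1 - 1 / t) *\<^sub>R (x - a)" by (simp add: y_def scaleR_diff_left)
        moreover have "(1 - t) *\<^sub>R (a - y) = - (((1 - t) / t) *\<^sub>R (x - a))" by (simp add: y_def)
        moreover have "1 - 1 / t = - ((1 - t) / t)" using t by (simp add: field_simps)
        ultimately show ?thesis by (metis scaleR_minus_left)
      qed
      also have "norm \<dots> = l a x * norm (y - a)" using t by (simp add: t_def norm_minus_commute)
      also have "B * \<dots> \<le> B * (l a x * R)" using R[OF yT] l[OF a] B0 by (intro mult_left_mono) auto
      finally show ?thesis using \<open>\<psi> y = 0\<close> mult_nonneg_nonneg[OF M0 l[OF a]] by (simp add: algebra_simps)
    qed
  qed (use T bary_continuous[OF bary] in auto)
qed

section \<open>Two simplices sharing a facet\<close>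

text \<open>The coordinates of a1 and a2 both vanish on the hyperplane of K, so they are
  proportional. A nonnegative factor \<kappa> would make the simplices overlap near p beyond their
  common facet. With \<kappa> negative, and the coordinates of K positive near p, the sign of
  \<open>l1 a1\<close> alone decides membership.\<close>

lemma facet_neighbours:
  fixes K :: "(real^'d) set"
  assumes b1: "barycentric (insert a1 K) l1" and b2: "barycentric (insert a2 K) l2"
    and nin: "a1 \<notin> K" "a2 \<notin> K"
    and int: "convex hull (insert a1 K) \<inter> convex hull (insert a2 K) = convex hull K"
    and p: "\<And>v. v \<in> K \<Longrightarrow> l1 v p > 0" "l1 a1 p = 0"
  shows "\<exists>e>0. \<forall>x\<in>ball p e. (l1 a1 x \<ge> 0 \<longrightarrow> x \<in> convex hull (insert a1 K)) \<and> (l1 a1 x \<le> 0 \<longrightarrow> x \<in> convex hull (insert a2 K))"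
proof -
  have fin: "finite K" using bary_finite[OF b1] by simp
  have prep: "(\<Sum>v\<in>K. l1 v p *\<^sub>R v) = p" "(\<Sum>v\<in>K. l1 v p) = 1"
    using bary_rep[OF b1, of p] bary_sum[OF b1, of p] p(2) fin nin by auto
  have l2K: "l2 v p = l1 v p" if "v \<in> K" for v
  proof -
    have "l2 v p = (\<Sum>w\<in>K. l1 w p * l2 v w)" using bary_comb[OF b2 prep(2), of v "\<lambda>w. w"] prep(1) by simp
    also have "\<dots> = (\<Sum>w\<in>K. if v = w then l1 w p else 0)"
      using bary_vertex[OF b2] that by (intro sum.cong) auto
    finally show ?thesis using that fin by simp
  qed
  have l2a2: "l2 a2 x = 0" if xK: "x \<in> convex hull K" for x
  proof -
    obtain u where u: "sum u K = 1" "(\<Sum>v\<in>K. u v *\<^sub>R v) = x"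
      using xK unfolding convex_hull_finite[OF fin] by blast
    have "l2 a2 x = (\<Sum>w\<in>K. u w * l2 a2 w)" using bary_comb[OF b2 u(1), of a2 "\<lambda>w. w"] u(2) by simp
    also have "\<dots> = 0" using bary_vertex[OF b2, of a2] nin by (intro sum.neutral) auto
    finally show ?thesis .
  qed
  have pK: "p \<in> convex hull K" unfolding convex_hull_finite[OF fin]
    using prep p(1) by (auto intro!: exI[of _ "\<lambda>v. l1 v p"] less_imp_le)
  define \<kappa> where "\<kappa> = l1 a1 a2"
  \<comment> \<open>Expand x in the coordinates of the second simplex; \<open>l1 a1\<close> kills
    the vertices in K.\<close>
  have prp: "l1 a1 x = \<kappa> * l2 a2 x" for x
  proof -
    have "l1 a1 x = (\<Sum>v\<in>insert a2 K. l2 v x * l1 a1 v)"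
      using bary_comb[OF b1 bary_sum[OF b2, of x], of a1 "\<lambda>w. w"] bary_rep[OF b2, of x] by simp
    also have "\<dots> = l2 a2 x * l1 a1 a2 + (\<Sum>v\<in>K. l2 v x * l1 a1 v)" using fin nin by simp
    also have "(\<Sum>v\<in>K. l2 v x * l1 a1 v) = 0"
      using bary_vertex[OF b1, of a1] nin by (intro sum.neutral) auto
    finally show ?thesis by (simp add: \<kappa>_def)
  qed
  have "open (\<Inter>v\<in>K. l1 v -` {0<..} \<inter> l2 v -` {0<..})"
    using fin bary_continuous[OF b1] bary_continuous[OF b2] by (auto intro!: open_INT open_Int open_vimage)
  moreover have "p \<in> (\<Inter>v\<in>K. l1 v -` {0<..} \<inter> l2 v -` {0<..})" using p(1) l2K by auto
  ultimately obtain e where e: "e > 0" "ball p e \<subseteq> (\<Inter>v\<in>K. l1 v -` {0<..} \<inter> l2 v -` {0<..})"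
    unfolding open_contains_ball by blast
  have "\<kappa> < 0"
  proof (rule ccontr)
    assume "\<not> \<kappa> < 0"
    \<comment> \<open>A step towards a2 that stays in the ball; the summand 1 keeps the denominator
      positive.\<close>
    define t where "t = min 1 (e / (2 * (norm (a2 - p) + 1)))"
    have t: "0 < t" "t \<le> 1" using e(1) by (auto simp: t_def add_nonneg_pos)
    define x where "x = p + t *\<^sub>R (a2 - p)"
    have "t * norm (a2 - p) \<le> (e / (2 * (norm (a2 - p) + 1))) * norm (a2 - p)"
      by (intro mult_right_mono) (auto simp: t_def)
    also have "\<dots> = e * (norm (a2 - p) / (2 * (norm (a2 - p) + 1)))" by simp
    also have "\<dots> < e * 1" using e(1) norm_ge_zero[of "a2 - p"]
      by (intro mult_strict_left_mono) (auto simp: divide_less_eq add_nonneg_pos)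
    finally have "t * norm (a2 - p) < e" by simp
    then have "x \<in> ball p e" using t by (simp add: x_def dist_norm)
    then have "\<forall>v\<in>K. 0 < l1 v x" using e(2) by auto
    moreover have "l1 a1 x \<ge> 0" unfolding x_def bary_line[OF b1] using p(2) t \<open>\<not> \<kappa> < 0\<close> by (simp add: \<kappa>_def)
    ultimately have "x \<in> convex hull (insert a1 K)" unfolding bary_hull[OF b1] by (auto intro: less_imp_le)
    moreover have "x \<in> convex hull (insert a2 K)"
    proof -
      have "p \<in> convex hull (insert a2 K)" using pK hull_mono[of K "insert a2 K"] by blast
      moreover have "a2 \<in> convex hull (insert a2 K)" by (simp add: hull_inc)
      ultimately show ?thesis using convexD_alt[OF convex_convex_hull, of p "insert a2 K" a2 t] t
        by (simp add: x_def algebra_simps)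
    qed
    ultimately have "l2 a2 x = 0" using int l2a2 by blast
    moreover have "l2 a2 x = t" unfolding x_def bary_line[OF b2] using l2a2[OF pK] bary_vertex[OF b2, of a2 a2] by simp
    ultimately show False using t by simp
  qed
  have "(l1 a1 x \<ge> 0 \<longrightarrow> x \<in> convex hull (insert a1 K)) \<and> (l1 a1 x \<le> 0 \<longrightarrow> x \<in> convex hull (insert a2 K))"
    if x: "x \<in> ball p e" for x
  proof -
    have K: "\<forall>v\<in>K. 0 < l1 v x \<and> 0 < l2 v x" using e(2) x by auto
    have "l2 a2 x \<ge> 0" if "l1 a1 x \<le> 0"
      using that \<open>\<kappa> < 0\<close> unfolding prp by (simp add: mult_le_0_iff)
    then show ?thesis unfolding bary_hull[OF b1] bary_hull[OF b2] using K by (auto intro: less_imp_le)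
  qed
  then show ?thesis using e(1) by blast
qed

section \<open>Facet connectivity of the mesh\<close>

lemma negligible_affine_hull_lowdim:
  fixes S :: "(real^'d) set"
  assumes "aff_dim S < int CARD('d)" shows "negligible (affine hull S)"
proof -
  have "interior (affine hull S) = {}"
    using aff_dim_nonempty_interior[of "affine hull S"] assms by (force simp: aff_dim_affine_hull)
  then show ?thesis by (simp add: negligible_convex_interior affine_imp_convex)
qed

text \<open>A face of full dimension is the whole simplex, so an intersection of full dimension
  would equal both simplices.\<close>

lemma mesh_Int_lowdim:
  fixes \<T> :: "(real^'d) set set"
  assumes mesh: "simplicial_mesh \<Omega> \<T>" and T: "S \<in> \<T>" "T \<in> \<T>" "S \<noteq> T"
  shows "aff_dim (S \<inter> T) < int CARD('d)"
proof (rule ccontr)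
  assume nl: "\<not> aff_dim (S \<inter> T) < int CARD('d)"
  have d: "aff_dim S = int CARD('d)" "aff_dim T = int CARD('d)" "convex S" "convex T"
    using mesh T aff_dim_simplex convex_simplex unfolding simplicial_mesh_def by blast+
  have "(S \<inter> T) face_of S" "(T \<inter> S) face_of T"
    using mesh T unfolding simplicial_mesh_def triangulation_def by blast+
  then have "S \<inter> T = S" "T \<inter> S = T"
    using face_of_aff_dim_lt[of S "S \<inter> T"] face_of_aff_dim_lt[of T "T \<inter> S"] nl d by (auto simp: Int_commute)
  then show False using T(3) by blast
qed

lemma mesh_simplex:
  fixes \<T> :: "(real^'d) set set"
  assumes "simplicial_mesh \<Omega> \<T>" "T \<in> \<T>"
  obtains C l where "barycentric C l" "T = convex hull C" "\<not> affine_dependent C"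
proof -
  have "int CARD('d) simplex T" using assms by (auto simp: simplicial_mesh_def)
  then obtain C where C: "\<not> affine_dependent C" "int (card C) = int CARD('d) + 1" "T = convex hull C"
    unfolding simplex_def by blast
  then have "card C = Suc CARD('d)" by linarith
  then show ?thesis using barycentric_exists[OF C(1)] C that by blast
qed

lemma mesh_element:
  fixes \<T> :: "(real^'d) set set"
  assumes "simplicial_mesh \<Omega> \<T>" "T \<in> \<T>"
  shows "compact T" "convex T" "interior T \<noteq> {}" "interior T \<subseteq> \<Omega>" "closure (interior T) = T" "negligible (T - interior T)"
proof -
  obtain C l where C: "barycentric C l" "T = convex hull C" "\<not> affine_dependent C"
    by (rule mesh_simplex[OF assms])
  show cT: "compact T" "convex T" using C(2) bary_finite[OF C(1)] by (auto simp: finite_imp_compact_convex_hull)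
  show iT: "interior T \<noteq> {}" using bary_interior_nonempty[OF C(1)] C(2) by simp
  show "interior T \<subseteq> \<Omega>" using assms by (auto simp: simplicial_mesh_def)
  show "closure (interior T) = T" using convex_closure_interior[OF cT(2) iT] cT(1) by (simp add: compact_imp_closed)
  have "T - interior T = frontier T" using cT by (simp add: frontier_def compact_imp_closed)
  then show "negligible (T - interior T)" using negligible_convex_frontier[OF cT(2)] by simp
qed

text \<open>Connectedness only gives a point x0 of \<Omega> common to both classes, where simplices
  may touch in a mere vertex or edge. Two generic points of such simplices close to x0 are joined by
  a segment that misses all intersections of codimension two or more, so the segment passes from one
  class to the other through a facet.\<close>

lemma mesh_facet_connected:
  fixes \<Omega> :: "(real^'d) set"
  assumes \<Omega>: "open \<Omega>" "connected \<Omega>" and mesh: "simplicial_mesh \<Omega> \<T>"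
    and UN: "\<T> = \<U> \<union> \<N>" "\<U> \<noteq> {}" "\<N> \<noteq> {}" "\<U> \<inter> \<N> = {}"
  shows "\<exists>S\<in>\<U>. \<exists>T\<in>\<N>. S \<inter> T \<inter> \<Omega> \<noteq> {} \<and> aff_dim (S \<inter> T) = int CARD('d) - 1"
proof -
  have fin: "finite \<T>" using mesh by (simp add: simplicial_mesh_def triangulation_def)
  have cover: "\<Omega> \<subseteq> \<Union>\<U> \<union> \<Union>\<N>" using mesh closure_subset UN(1) by (auto simp: simplicial_mesh_def)
  note el = mesh_element[OF mesh]
  have cl: "closed (\<Union>\<U>)" "closed (\<Union>\<N>)"
    using fin UN(1) el(1) by (auto intro!: closed_Union compact_imp_closed intro: finite_subset)
  have meet: "\<Union>\<U> \<inter> \<Omega> \<noteq> {}" "\<Union>\<N> \<inter> \<Omega> \<noteq> {}"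
  proof -
    have "\<Union>A \<inter> \<Omega> \<noteq> {}" if A: "A \<noteq> {}" "A \<subseteq> \<T>" for A
    proof -
      obtain T where T: "T \<in> A" using A by blast
      then obtain x where "x \<in> interior T" using el(3)[of T] A by blast
      then have "x \<in> T" "x \<in> \<Omega>" using el(4)[of T] T A interior_subset by blast+
      then show ?thesis using T by blast
    qed
    then show "\<Union>\<U> \<inter> \<Omega> \<noteq> {}" "\<Union>\<N> \<inter> \<Omega> \<noteq> {}" using UN by auto
  qed
  have "\<Union>\<U> \<inter> \<Union>\<N> \<inter> \<Omega> \<noteq> {}"
    using \<Omega>(2) cl cover meet unfolding connected_closed by blast
  then obtain x0 U0 N0 where x0: "x0 \<in> \<Omega>" "x0 \<in> U0" "x0 \<in> N0" "U0 \<in> \<U>" "N0 \<in> \<N>" by blast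
  obtain r where r: "r > 0" "ball x0 r \<subseteq> \<Omega>" using \<Omega>(1) x0(1) open_contains_ball by blast
  define P where "P = {(S, T). S \<in> \<T> \<and> T \<in> \<T> \<and> S \<noteq> T}"
  have finP: "finite P" by (rule finite_subset[of _ "\<T> \<times> \<T>"]) (auto simp: P_def fin)
  have generic: "\<exists>y. y \<in> interior T \<inter> ball x0 r \<and> y \<notin> Z" if "T \<in> \<T>" "x0 \<in> T" "negligible Z" for T Z
  proof -
    have "x0 \<in> closure (interior T)" using el(5) that by simp
    then have "interior T \<inter> ball x0 r \<noteq> {}" using r(1)
      by (metis centre_in_ball disjoint_iff open_ball open_Int_closure_eq_empty)
    then have "\<not> negligible (interior T \<inter> ball x0 r)" by (intro open_not_negligible) auto
    then show ?thesis using negligible_subset that(3) by blast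
  qed
  have "negligible (\<Union>(S, T)\<in>P. affine hull (S \<inter> T))"
    using finP mesh_Int_lowdim[OF mesh]
    by (intro negligible_Union) (auto simp: P_def intro!: negligible_affine_hull_lowdim)
  \<comment> \<open>In particular y lies in no intersection of two distinct simplices, so the
    crossing point found later is not y itself.\<close>
  then obtain y where y: "y \<in> interior U0 \<inter> ball x0 r" "y \<notin> (\<Union>(S, T)\<in>P. affine hull (S \<inter> T))"
    using generic[of U0] x0 UN by blast
  \<comment> \<open>Pairs meeting in codimension at least two: joining such an intersection with y
    raises the dimension by at most one and still gives a null set.\<close>
  define Q where "Q = {(S, T). (S, T) \<in> P \<and> aff_dim (S \<inter> T) < int CARD('d) - 1}"
  have "negligible (\<Union>(S, T)\<in>Q. affine hull (insert y (S \<inter> T)))"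
  proof (intro negligible_Union)
    show "finite ((\<lambda>(S, T). affine hull (insert y (S \<inter> T))) ` Q)"
      using finP by (intro finite_imageI) (auto simp: Q_def intro: finite_subset[of _ P])
    show "negligible A" if "A \<in> (\<lambda>(S, T). affine hull (insert y (S \<inter> T))) ` Q" for A
      using that aff_dim_insert[of y] by (auto simp: Q_def intro!: negligible_affine_hull_lowdim split: if_splits)
  qed
  \<comment> \<open>Off these hulls, the segment from y to y' cannot meet any intersection belonging
    to Q.\<close>
  then obtain y' where y': "y' \<in> interior N0 \<inter> ball x0 r" "y' \<notin> (\<Union>(S, T)\<in>Q. affine hull (insert y (S \<inter> T)))"
    using generic[of N0] x0 UN by blast
  define z where "z t = y + t *\<^sub>R (y' - y)" for t :: real
  have zb: "z t \<in> ball x0 r" if "t \<in> {0..1}" for t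
    using convexD_alt[OF convex_ball, of y x0 r y' t] y(1) y'(1) that by (simp add: z_def algebra_simps)
  have cz: "continuous_on UNIV z" unfolding z_def by (intro continuous_intros)
  have "\<exists>t\<in>{0..1}. z t \<in> \<Union>\<U> \<and> z t \<in> \<Union>\<N>"
  proof (rule ccontr)
    assume no: "\<not> ?thesis"
    have c: "closed (z -` \<Union>\<U>)" "closed (z -` \<Union>\<N>)" using cl cz by (auto intro: closed_vimage)
    have cov: "{0..1} \<subseteq> z -` \<Union>\<U> \<union> z -` \<Union>\<N>"
    proof
      fix t :: real assume "t \<in> {0..1}"
      then have "z t \<in> \<Omega>" using zb r(2) by blast
      then show "t \<in> z -` \<Union>\<U> \<union> z -` \<Union>\<N>" using cover by auto
    qed
    have "z 0 \<in> U0" "z 1 \<in> N0"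
      using y(1) y'(1) interior_subset[of U0] interior_subset[of N0] by (auto simp: z_def)
    then have ends: "z -` \<Union>\<U> \<inter> {0..1} \<noteq> {}" "z -` \<Union>\<N> \<inter> {0..1} \<noteq> {}"
      using x0(4,5) by (fastforce intro: exI[of _ 0], fastforce intro: exI[of _ 1])
    have "z -` \<Union>\<U> \<inter> z -` \<Union>\<N> \<inter> {0..1} = {}" using no by blast
    moreover have "connected {0..1::real}" by simp
    ultimately show False using c cov ends unfolding connected_closed by blast
  qed
  then obtain t S T where t: "t \<in> {0..1}" "z t \<in> S" "z t \<in> T" "S \<in> \<U>" "T \<in> \<N>" by blast
  have ST: "(S, T) \<in> P" using t UN by (auto simp: P_def)
  have "t \<noteq> 0"
  proof
    assume "t = 0"
    then have "y \<in> affine hull (S \<inter> T)" using t by (simp add: z_def hull_inc)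
    then show False using y(2) ST by blast
  qed
  have "aff_dim (S \<inter> T) = int CARD('d) - 1"
  proof (rule ccontr)
    assume "aff_dim (S \<inter> T) \<noteq> int CARD('d) - 1"
    moreover have "aff_dim (S \<inter> T) < int CARD('d)" using mesh_Int_lowdim[OF mesh] ST by (auto simp: P_def)
    ultimately have Q: "(S, T) \<in> Q" using ST by (auto simp: Q_def)
    have "y \<in> affine hull (insert y (S \<inter> T))" "z t \<in> affine hull (insert y (S \<inter> T))"
      using t by (auto intro: hull_inc)
    \<comment> \<open>Solving z t = y + t (y' - y) for y' exhibits it as an affine combination of y
      and z t.\<close>
    then have "(1 - 1 / t) *\<^sub>R y + (1 / t) *\<^sub>R z t \<in> affine hull (insert y (S \<inter> T))"
      by (intro mem_affine[OF affine_affine_hull]) auto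
    moreover have "(1 / t) *\<^sub>R z t = (1 / t) *\<^sub>R y + (y' - y)"
      using \<open>t \<noteq> 0\<close> by (simp add: z_def scaleR_add_right)
    then have "(1 - 1 / t) *\<^sub>R y + (1 / t) *\<^sub>R z t = y'" by (simp add: scaleR_diff_left)
    ultimately have "y' \<in> affine hull (insert y (S \<inter> T))" by (simp only:)
    then show False using y'(2) Q by blast
  qed
  moreover have "z t \<in> S \<inter> T \<inter> \<Omega>" using t zb r(2) by blast
  ultimately show ?thesis using t by blast
qed

text \<open>A face of a simplex is the hull of a subset of its vertices; the dimension of the
  intersection leaves exactly one vertex over on either side.\<close>

lemma mesh_shared_facet:
  fixes \<T> :: "(real^'d) set set"
  assumes mesh: "simplicial_mesh \<Omega> \<T>" and ST: "S \<in> \<T>" "T \<in> \<T>" "aff_dim (S \<inter> T) = int CARD('d) - 1"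
  obtains K a b l m where "barycentric (insert a K) l" "barycentric (insert b K) m" "a \<notin> K" "b \<notin> K"
    "S = convex hull (insert a K)" "T = convex hull (insert b K)" "S \<inter> T = convex hull K"
proof -
  obtain C l where C: "barycentric C l" "S = convex hull C" "\<not> affine_dependent C"
    by (rule mesh_simplex[OF mesh ST(1)])
  obtain D m where D: "barycentric D m" "T = convex hull D" "\<not> affine_dependent D"
    by (rule mesh_simplex[OF mesh ST(2)])
  have "(S \<inter> T) face_of S" "(T \<inter> S) face_of T"
    using mesh ST unfolding simplicial_mesh_def triangulation_def by blast+
  then obtain c e where ce: "c \<subseteq> C" "S \<inter> T = convex hull c" "e \<subseteq> D" "S \<inter> T = convex hull e"
    using face_of_convex_hull_affine_independent[OF C(3)] face_of_convex_hull_affine_independent[OF D(3)] C(2) D(2)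
    by (metis Int_commute)
  have ind: "\<not> affine_dependent c" "\<not> affine_dependent e"
    using ce C(3) D(3) affine_independent_subset by blast+
  have card: "card c = CARD('d)" "card e = CARD('d)"
    using aff_dim_affine_independent[OF ind(1)] aff_dim_affine_independent[OF ind(2)] ST(3) ce aff_dim_convex_hull
    by (metis add_diff_cancel_right' diff_eq_eq int_int_eq of_nat_eq_iff)+
  \<comment> \<open>Extreme points recover the vertices from the hull, so both descriptions of the
    common face use the same vertex set.\<close>
  have "c = {x. x extreme_point_of (convex hull c)}" "e = {x. x extreme_point_of (convex hull e)}"
    using extreme_point_of_convex_hull_affine_independent ind by blast+
  then have "c = e" using ce by simp
  have "card (C - c) = 1" "card (D - c) = 1"
    using bary_card[OF C(1)] bary_card[OF D(1)] card ce \<open>c = e\<close> bary_finite[OF C(1)] bary_finite[OF D(1)]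
    by (auto simp: card_Diff_subset finite_subset)
  then obtain a b where ab: "C - c = {a}" "D - c = {b}" by (auto simp: card_1_singleton_iff)
  then have "C = insert a c" "D = insert b c" "a \<notin> c" "b \<notin> c" using ce \<open>c = e\<close> by auto
  then show ?thesis using that C D ce by metis
qed

section \<open>Square integrable functions\<close>

lemma L2_spaceD:
  assumes "v \<in> L2_space X"
  shows "(\<lambda>x. indicator X x *\<^sub>R v x) \<in> borel_measurable lebesgue"
    "integrable lebesgue (\<lambda>x. (norm (indicator X x *\<^sub>R v x))\<^sup>2)"
proof -
  show "(\<lambda>x. indicator X x *\<^sub>R v x) \<in> borel_measurable lebesgue"
    using assms by (simp add: L2_space_def set_borel_measurable_def)
  have "(\<lambda>x. (norm (indicator X x *\<^sub>R v x))\<^sup>2) = (\<lambda>x. indicator X x *\<^sub>R (norm (v x))\<^sup>2)"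
    by (auto simp: indicator_def)
  then show "integrable lebesgue (\<lambda>x. (norm (indicator X x *\<^sub>R v x))\<^sup>2)"
    using assms by (simp add: L2_space_def set_integrable_def)
qed

lemma L2_spaceI:
  assumes "(\<lambda>x. indicator X x *\<^sub>R v x) \<in> borel_measurable lebesgue"
    "integrable lebesgue (\<lambda>x. (norm (indicator X x *\<^sub>R v x))\<^sup>2)"
  shows "v \<in> L2_space X"
proof -
  have "(\<lambda>x. (norm (indicator X x *\<^sub>R v x))\<^sup>2) = (\<lambda>x. indicator X x *\<^sub>R (norm (v x))\<^sup>2)"
    by (auto simp: indicator_def)
  then show ?thesis
    using assms by (simp add: L2_space_def set_integrable_def set_borel_measurable_def)
qed

lemma L2_dominated:
  assumes m: "(\<lambda>x. indicator X x *\<^sub>R v x) \<in> borel_measurable lebesgue"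
    and f: "integrable lebesgue f" and le: "AE x\<in>X in lebesgue. (norm (v x))\<^sup>2 \<le> f x"
    and nn: "\<And>x. f x \<ge> 0"
  shows "v \<in> L2_space X"
proof (rule L2_spaceI[OF m])
  show "integrable lebesgue (\<lambda>x. (norm (indicator X x *\<^sub>R v x))\<^sup>2)"
  proof (rule Bochner_Integration.integrable_bound[OF f])
    show "(\<lambda>x. (norm (indicat_real X x *\<^sub>R v x))\<^sup>2) \<in> borel_measurable lebesgue" using m by measurable
    show "AE x in lebesgue. norm ((norm (indicat_real X x *\<^sub>R v x))\<^sup>2) \<le> norm (f x)"
      using le by eventually_elim (use nn in \<open>auto simp: indicator_def\<close>)
  qed
qed

lemma L2_comb:
  assumes v: "v \<in> L2_space X" and w: "w \<in> L2_space X"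
  shows "(\<lambda>x. v x + a *\<^sub>R w x) \<in> L2_space X"
proof (rule L2_dominated)
  let ?v = "\<lambda>x. indicator X x *\<^sub>R v x" and ?w = "\<lambda>x. indicator X x *\<^sub>R w x"
  have "(\<lambda>x. indicator X x *\<^sub>R (v x + a *\<^sub>R w x)) = (\<lambda>x. ?v x + a *\<^sub>R ?w x)"
    by (auto simp: indicator_def)
  then show "(\<lambda>x. indicator X x *\<^sub>R (v x + a *\<^sub>R w x)) \<in> borel_measurable lebesgue"
    by (simp only:) (intro borel_measurable_add borel_measurable_scaleR borel_measurable_const L2_spaceD(1) v w)
  show "integrable lebesgue (\<lambda>x. 2 * (norm (?v x))\<^sup>2 + 2 * a\<^sup>2 * (norm (?w x))\<^sup>2)"
    using L2_spaceD(2)[OF v] L2_spaceD(2)[OF w] by (intro Bochner_Integration.integrable_add integrable_mult_right)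
  have "(norm (v x + a *\<^sub>R w x))\<^sup>2 \<le> 2 * (norm (v x))\<^sup>2 + 2 * a\<^sup>2 * (norm (w x))\<^sup>2" for x
  proof -
    have "(norm (v x + a *\<^sub>R w x))\<^sup>2 \<le> (norm (v x) + norm (a *\<^sub>R w x))\<^sup>2"
      by (intro power_mono norm_triangle_ineq) simp
    also have "\<dots> \<le> 2 * (norm (v x))\<^sup>2 + 2 * (norm (a *\<^sub>R w x))\<^sup>2"
      using sum_squares_bound[of "norm (v x)" "norm (a *\<^sub>R w x)"] by (simp add: power2_sum)
    finally show ?thesis by (simp add: power_mult_distrib)
  qed
  then show "AE x\<in>X in lebesgue. (norm (v x + a *\<^sub>R w x))\<^sup>2 \<le> 2 * (norm (?v x))\<^sup>2 + 2 * a\<^sup>2 * (norm (?w x))\<^sup>2"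
    by (intro AE_I2) simp
qed simp

lemma L2_zero: "(\<lambda>x. 0) \<in> L2_space X"
  by (rule L2_spaceI) auto

lemma L2_scaleR: "w \<in> L2_space X \<Longrightarrow> (\<lambda>x. a *\<^sub>R w x) \<in> L2_space X"
  using L2_comb[OF L2_zero, of w X a] by simp

lemma L2_uminus: "w \<in> L2_space X \<Longrightarrow> (\<lambda>x. - w x) \<in> L2_space X"
  using L2_scaleR[of w X "-1"] by simp

lemma L2_diff: "v \<in> L2_space X \<Longrightarrow> w \<in> L2_space X \<Longrightarrow> (\<lambda>x. v x - w x) \<in> L2_space X"
  using L2_comb[of v X w "-1"] by simp

lemma L2_inner_integrable:
  assumes v: "v \<in> L2_space X" and w: "w \<in> L2_space X"
  shows "set_integrable lebesgue X (\<lambda>x. v x \<bullet> w x)"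
proof -
  let ?v = "\<lambda>x. indicator X x *\<^sub>R v x" and ?w = "\<lambda>x. indicator X x *\<^sub>R w x"
  have eq: "(\<lambda>x. indicator X x *\<^sub>R (v x \<bullet> w x)) = (\<lambda>x. ?v x \<bullet> ?w x)"
    by (auto simp: indicator_def)
  have bd: "\<bar>?v x \<bullet> ?w x\<bar> \<le> (norm (?v x))\<^sup>2 + (norm (?w x))\<^sup>2" for x
  proof -
    have "\<bar>?v x \<bullet> ?w x\<bar> \<le> norm (?v x) * norm (?w x)" by (rule Cauchy_Schwarz_ineq2)
    also have "p * q \<le> p\<^sup>2 + q\<^sup>2" if "0 \<le> p" "0 \<le> q" for p q :: real
      using sum_squares_bound[of p q] mult_nonneg_nonneg[OF that] by linarith
    then have "norm (?v x) * norm (?w x) \<le> (norm (?v x))\<^sup>2 + (norm (?w x))\<^sup>2" using norm_ge_zero by blast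
    finally show ?thesis .
  qed
  show ?thesis unfolding set_integrable_def eq
  proof (rule Bochner_Integration.integrable_bound)
    show "integrable lebesgue (\<lambda>x. (norm (?v x))\<^sup>2 + (norm (?w x))\<^sup>2)"
      using L2_spaceD(2)[OF v] L2_spaceD(2)[OF w] by (rule Bochner_Integration.integrable_add)
    show "(\<lambda>x. ?v x \<bullet> ?w x) \<in> borel_measurable lebesgue"
      using L2_spaceD(1)[OF v] L2_spaceD(1)[OF w] by (rule borel_measurable_inner)
  qed (use bd in \<open>auto intro!: AE_I2\<close>)
qed

lemma L2_inner_comb:
  assumes "u \<in> L2_space X" "v \<in> L2_space X" "w \<in> L2_space X"
  shows "L2_inner X (\<lambda>x. v x + a *\<^sub>R w x) u = L2_inner X v u + a * L2_inner X w u"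
  using assms L2_inner_integrable[of v X u] L2_inner_integrable[of w X u]
  by (simp add: L2_inner_def inner_add_left set_integral_add)

lemma L2_inner_commute: "L2_inner X v w = L2_inner X w v"
  by (simp add: L2_inner_def inner_commute)

lemma L2_AE_cong:
  assumes v: "v \<in> L2_space X" and eq: "AE x\<in>X in lebesgue. v x = w x"
  shows "w \<in> L2_space X"
proof (rule L2_dominated)
  have "AE x in lebesgue. indicator X x *\<^sub>R v x = indicator X x *\<^sub>R w x"
    using eq by eventually_elim (auto simp: indicator_def)
  then show "(\<lambda>x. indicator X x *\<^sub>R w x) \<in> borel_measurable lebesgue"
    by (rule borel_measurable_AE[OF L2_spaceD(1)[OF v]])
  show "AE x\<in>X in lebesgue. (norm (w x))\<^sup>2 \<le> (norm (indicator X x *\<^sub>R v x))\<^sup>2"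
    using eq by eventually_elim auto
qed (use L2_spaceD(2)[OF v] in auto)

lemma set_integral_AE_cong:
  fixes f g :: "real^'d \<Rightarrow> real"
  assumes f: "(\<lambda>x. indicator X x *\<^sub>R f x) \<in> borel_measurable lebesgue" and eq: "AE x\<in>X in lebesgue. f x = g x"
  shows "set_lebesgue_integral lebesgue X f = set_lebesgue_integral lebesgue X g"
proof -
  have ae: "AE x in lebesgue. indicator X x *\<^sub>R f x = indicator X x *\<^sub>R g x"
    using eq by eventually_elim (auto simp: indicator_def)
  then have "(\<lambda>x. indicator X x *\<^sub>R g x) \<in> borel_measurable lebesgue"
    by (rule borel_measurable_AE[OF f])
  then show ?thesis unfolding set_lebesgue_integral_def using ae f by (intro integral_cong_AE)
qed

lemma L2_inner_AE_cong:
  fixes v v' :: "real^'d \<Rightarrow> 'b::euclidean_space"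
  assumes "v \<in> L2_space X" "w \<in> L2_space X" "AE x\<in>X in lebesgue. v x = v' x" "AE x\<in>X in lebesgue. w x = w' x"
  shows "L2_inner X v w = L2_inner X v' w'"
  unfolding L2_inner_def
proof (rule set_integral_AE_cong)
  show "(\<lambda>x. indicat_real X x *\<^sub>R (v x \<bullet> w x)) \<in> borel_measurable lebesgue"
    using L2_inner_integrable[OF assms(1,2)] by (auto simp: set_integrable_def)
  show "AE x\<in>X in lebesgue. v x \<bullet> w x = v' x \<bullet> w' x"
    using assms(3,4) by eventually_elim auto
qed

lemma L2_inner_self_zero:
  fixes v :: "real^'d \<Rightarrow> 'b::euclidean_space"
  assumes v: "v \<in> L2_space X" and z: "L2_inner X v v = 0"
  shows "AE x\<in>X in lebesgue. v x = 0"
proof -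
  have i: "integrable lebesgue (\<lambda>x. indicator X x *\<^sub>R (v x \<bullet> v x))"
    using L2_inner_integrable[OF v v] by (simp add: set_integrable_def)
  have "AE x in lebesgue. indicator X x *\<^sub>R (v x \<bullet> v x) = 0"
    using z integral_nonneg_eq_0_iff_AE[OF i] by (auto simp: L2_inner_def set_lebesgue_integral_def)
  then show ?thesis by eventually_elim auto
qed

lemma L2_inner_self_nonneg: "L2_inner X v v \<ge> 0"
  unfolding L2_inner_def set_lebesgue_integral_def by (intro Bochner_Integration.integral_nonneg) auto

lemma L2_bounded_mult:
  fixes v :: "real^'d \<Rightarrow> 'b::euclidean_space"
  assumes g: "(\<lambda>x. indicator X x *\<^sub>R g x) \<in> borel_measurable lebesgue" and C: "AE x\<in>X in lebesgue. \<bar>g x\<bar> \<le> C"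
    and v: "v \<in> L2_space X"
  shows "(\<lambda>x. g x *\<^sub>R v x) \<in> L2_space X"
proof (rule L2_dominated)
  have "(\<lambda>x. indicator X x *\<^sub>R (g x *\<^sub>R v x)) = (\<lambda>x. (indicator X x *\<^sub>R g x) *\<^sub>R (indicator X x *\<^sub>R v x))"
    by (auto simp: indicator_def)
  then show "(\<lambda>x. indicator X x *\<^sub>R (g x *\<^sub>R v x)) \<in> borel_measurable lebesgue"
    using borel_measurable_scaleR[OF g L2_spaceD(1)[OF v]] by simp
  show "integrable lebesgue (\<lambda>x. C\<^sup>2 * (norm (indicator X x *\<^sub>R v x))\<^sup>2)"
    using L2_spaceD(2)[OF v] by (rule integrable_mult_right)
  show "AE x\<in>X in lebesgue. (norm (g x *\<^sub>R v x))\<^sup>2 \<le> C\<^sup>2 * (norm (indicator X x *\<^sub>R v x))\<^sup>2"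
    using C
  proof eventually_elim
    case (elim x)
    show ?case
    proof
      assume x: "x \<in> X"
      then have "\<bar>g x\<bar>\<^sup>2 \<le> C\<^sup>2" using elim by (intro power_mono) auto
      then show "(norm (g x *\<^sub>R v x))\<^sup>2 \<le> C\<^sup>2 * (norm (indicator X x *\<^sub>R v x))\<^sup>2"
        using x by (simp add: power_mult_distrib mult_right_mono)
    qed
  qed
qed simp

lemma L2_subset:
  fixes v :: "real^'d \<Rightarrow> 'b::euclidean_space"
  assumes v: "v \<in> L2_space X" and Y: "Y \<subseteq> X" "Y \<in> sets lebesgue"
  shows "v \<in> L2_space Y"
proof (rule L2_dominated)
  have "indicator Y x *\<^sub>R v x = indicat_real Y x *\<^sub>R (indicator X x *\<^sub>R v x)" for x
    using Y(1) by (cases "x \<in> Y") auto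
  then have "(\<lambda>x. indicator Y x *\<^sub>R v x) = (\<lambda>x. indicat_real Y x *\<^sub>R (indicator X x *\<^sub>R v x))" by blast
  then show "(\<lambda>x. indicator Y x *\<^sub>R v x) \<in> borel_measurable lebesgue"
    using borel_measurable_scaleR[of "indicat_real Y" lebesgue "\<lambda>x. indicator X x *\<^sub>R v x"] L2_spaceD(1)[OF v] Y(2) by simp
  show "AE x\<in>Y in lebesgue. (norm (v x))\<^sup>2 \<le> (norm (indicator X x *\<^sub>R v x))\<^sup>2"
    using Y(1) by (intro AE_I2) auto
qed (use L2_spaceD(2)[OF v] in auto)

text \<open>On a compact set the integrable function 1 + |v|^2 dominates |v|.\<close>

lemma L2_locally_integrable:
  fixes v :: "real^'d \<Rightarrow> 'b::euclidean_space"
  assumes v: "v \<in> L2_space X" shows "locally_integrable X v"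
  unfolding locally_integrable_def
proof (intro allI impI)
  fix K assume K: "compact K \<and> K \<subseteq> X"
  then have Km: "K \<in> sets lebesgue" by (simp add: compact_imp_closed)
  have vK: "v \<in> L2_space K" using L2_subset[OF v _ Km] K by simp
  have "emeasure lebesgue K < \<infinity>"
    using emeasure_bounded_finite[OF compact_imp_bounded, of K] K by (simp add: emeasure_completion compact_imp_closed)
  then have i1: "integrable lebesgue (indicat_real K)" using Km by (intro integrable_real_indicator)
  show "set_integrable lebesgue K v" unfolding set_integrable_def
  proof (rule Bochner_Integration.integrable_bound)
    show "integrable lebesgue (\<lambda>x. indicat_real K x + (norm (indicator K x *\<^sub>R v x))\<^sup>2)"
      using i1 L2_spaceD(2)[OF vK] by (rule Bochner_Integration.integrable_add)
    show "(\<lambda>x. indicator K x *\<^sub>R v x) \<in> borel_measurable lebesgue" by (rule L2_spaceD(1)[OF vK])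
    have "n \<le> 1 + n\<^sup>2" for n :: real
      using sum_squares_bound[of n 1] zero_le_power2[of n] by (simp, smt (verit))
    then show "AE x in lebesgue. norm (indicat_real K x *\<^sub>R v x) \<le> norm (indicat_real K x + (norm (indicator K x *\<^sub>R v x))\<^sup>2)"
      by (intro AE_I2) (auto simp: indicator_def)
  qed
qed

lemma L2_continuous_bounded:
  fixes v :: "real^'d \<Rightarrow> 'b::euclidean_space"
  assumes "continuous_on UNIV v" "bounded X" "X \<in> sets lebesgue"
  shows "v \<in> L2_space X"
proof -
  have c: "compact (closure X)" using assms(2) by (simp add: compact_closure)
  have m: "v \<in> borel_measurable lebesgue" using assms(1) by (simp add: borel_measurable_continuous_onI measurable_completion)
  have "compact (v ` closure X)" using c assms(1) by (intro compact_continuous_image) (auto intro: continuous_on_subset)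
  then obtain C where C: "\<And>x. x \<in> closure X \<Longrightarrow> norm (v x) \<le> C" using compact_imp_bounded bounded_iff by (metis imageI)
  have K: "closure X \<in> sets lebesgue" by simp
  have "emeasure lebesgue (closure X) < \<infinity>"
    using emeasure_bounded_finite[OF compact_imp_bounded[OF c]] by (simp add: emeasure_completion)
  then have i1: "integrable lebesgue (\<lambda>x. C\<^sup>2 * indicat_real (closure X) x)" using K
    by (intro integrable_mult_right integrable_real_indicator)
  show ?thesis
  proof (rule L2_dominated[OF _ i1])
    show "(\<lambda>x. indicator X x *\<^sub>R v x) \<in> borel_measurable lebesgue" using assms(3) m by measurable
    show "AE x\<in>X in lebesgue. (norm (v x))\<^sup>2 \<le> C\<^sup>2 * indicat_real (closure X) x"
    proof (intro AE_I2 impI)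
      fix x assume "x \<in> X"
      then have x: "x \<in> closure X" using closure_subset by blast
      then show "(norm (v x))\<^sup>2 \<le> C\<^sup>2 * indicat_real (closure X) x"
        using power_mono[OF C[OF x] norm_ge_zero, of 2] by simp
    qed
  qed simp
qed

section \<open>Weak derivatives\<close>

lemma locally_integrable_comb:
  "locally_integrable X v \<Longrightarrow> locally_integrable X w \<Longrightarrow> locally_integrable X (\<lambda>x. v x + a *\<^sub>R w x)"
  by (auto simp: locally_integrable_def)

lemma locally_integrable_inner:
  assumes "locally_integrable X v" shows "locally_integrable X (\<lambda>x. v x \<bullet> c)"
proof -
  have "set_integrable lebesgue K (\<lambda>x. v x \<bullet> c)" if "set_integrable lebesgue K v" for K
    using integrable_inner_left[OF that[unfolded set_integrable_def], of c] by (simp add: set_integrable_def)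
  then show ?thesis using assms by (auto simp: locally_integrable_def)
qed

lemma locally_integrable_nth:
  fixes v :: "real^'d \<Rightarrow> real^'d"
  shows "locally_integrable X v \<Longrightarrow> locally_integrable X (\<lambda>x. v x $ i)"
  using locally_integrable_inner[of X v "axis i 1"] by (simp add: inner_axis)

lemma locally_integrable_continuous:
  fixes v :: "real^'d \<Rightarrow> 'b::euclidean_space"
  assumes "continuous_on UNIV v" shows "locally_integrable X v"
proof -
  have "set_integrable lebesgue K v" if K: "compact K" for K
  proof -
    have "v \<in> L2_space K" using K by (intro L2_continuous_bounded[OF assms]) (auto simp: compact_imp_bounded compact_imp_closed)
    then show ?thesis using L2_locally_integrable K by (auto simp: locally_integrable_def)
  qed
  then show ?thesis by (simp add: locally_integrable_def)
qed

lemma locally_integrable_subset: "locally_integrable X v \<Longrightarrow> Y \<subseteq> X \<Longrightarrow> locally_integrable Y v"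
  by (auto simp: locally_integrable_def)

lemma test_integrable:
  fixes v :: "real^'d \<Rightarrow> real"
  assumes v: "locally_integrable X v" and \<phi>: "\<phi> \<in> test_functions X"
  shows "integrable lebesgue (\<lambda>x. v x * \<phi> x)" "integrable lebesgue (\<lambda>x. v x * grad \<phi> x $ i)"
    "set_integrable lebesgue X (\<lambda>x. v x * \<phi> x)" "set_integrable lebesgue X (\<lambda>x. v x * grad \<phi> x $ i)"
    "(LINT x:X|lebesgue. v x * \<phi> x) = (LINT x|lebesgue. v x * \<phi> x)"
    "(LINT x:X|lebesgue. v x * grad \<phi> x $ i) = (LINT x|lebesgue. v x * grad \<phi> x $ i)"
proof -
  obtain K where K: "compact K" "K \<subseteq> X" "\<And>x. x \<notin> K \<Longrightarrow> \<phi> x = 0" "\<And>x. x \<notin> K \<Longrightarrow> grad \<phi> x = 0"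
    "continuous_on UNIV \<phi>" "continuous_on UNIV (grad \<phi>)" by (rule test_functionE[OF \<phi>]) (rule that)
  show i: "integrable lebesgue (\<lambda>x. v x * \<phi> x)" "integrable lebesgue (\<lambda>x. v x * grad \<phi> x $ i)"
    using locally_integrable_mult[OF v K(1,2,5,3)]
      locally_integrable_mult[OF v K(1,2), of "\<lambda>x. grad \<phi> x $ i"] K(4,6)
    by (auto simp: mult.commute intro!: continuous_intros)
  have "v x * \<phi> x = 0" "v x * grad \<phi> x $ i = 0" if x: "x \<notin> X" for x
  proof -
    have "x \<notin> K" using x K(2) by blast
    then show "v x * \<phi> x = 0" "v x * grad \<phi> x $ i = 0" using K(3,4) by simp_all
  qed
  note z = this
  show "set_integrable lebesgue X (\<lambda>x. v x * \<phi> x)" "set_integrable lebesgue X (\<lambda>x. v x * grad \<phi> x $ i)"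
    "(LINT x:X|lebesgue. v x * \<phi> x) = (LINT x|lebesgue. v x * \<phi> x)"
    "(LINT x:X|lebesgue. v x * grad \<phi> x $ i) = (LINT x|lebesgue. v x * grad \<phi> x $ i)"
    using i set_integrable_iff_of_support[of X "\<lambda>x. v x * \<phi> x" lebesgue, OF z(1)]
      set_integrable_iff_of_support[of X "\<lambda>x. v x * grad \<phi> x $ i" lebesgue, OF z(2)] by simp_all
qed

text \<open>Test functions vanish outside X, so the integrals may run over the whole space, where
  translation arguments apply.\<close>

lemma has_weak_grad_alt:
  "has_weak_grad X u g \<longleftrightarrow> locally_integrable X u \<and> locally_integrable X g \<and>
     (\<forall>\<phi>\<in>test_functions X. \<forall>i.
        (LINT x|lebesgue. u x * grad \<phi> x $ i) = - (LINT x|lebesgue. g x $ i * \<phi> x))"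
proof -
  have "(LINT x:X|lebesgue. u x * partial_deriv i \<phi> x) = (LINT x|lebesgue. u x * grad \<phi> x $ i)"
    "(LINT x:X|lebesgue. g x $ i * \<phi> x) = (LINT x|lebesgue. g x $ i * \<phi> x)"
    if "locally_integrable X u" "locally_integrable X g" "\<phi> \<in> test_functions X" for \<phi> i
    using test_integrable(6)[OF that(1,3), of i] test_integrable(5)[OF locally_integrable_nth[OF that(2)] that(3)]
    by (simp_all add: grad_def)
  then show ?thesis unfolding has_weak_grad_def
    by (intro conj_cong refl ball_cong all_cong1) simp
qed

lemma test_inner_integrable:
  fixes v :: "real^'d \<Rightarrow> real^'d"
  assumes v: "locally_integrable X v" and \<phi>: "\<phi> \<in> test_functions X"
  shows "integrable lebesgue (\<lambda>x. v x \<bullet> grad \<phi> x)"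
    "(LINT x|lebesgue. v x \<bullet> grad \<phi> x) = (\<Sum>i\<in>UNIV. (LINT x|lebesgue. v x $ i * grad \<phi> x $ i))"
    "(LINT x:X|lebesgue. v x \<bullet> grad \<phi> x) = (LINT x|lebesgue. v x \<bullet> grad \<phi> x)"
proof -
  have i: "integrable lebesgue (\<lambda>x. v x $ i * grad \<phi> x $ i)" for i
    using test_integrable(2)[OF locally_integrable_nth[OF v] \<phi>] .
  show "integrable lebesgue (\<lambda>x. v x \<bullet> grad \<phi> x)"
    "(LINT x|lebesgue. v x \<bullet> grad \<phi> x) = (\<Sum>i\<in>UNIV. (LINT x|lebesgue. v x $ i * grad \<phi> x $ i))"
    using i by (simp_all add: inner_vec_def)
  obtain K where "K \<subseteq> X" "\<And>x. x \<notin> K \<Longrightarrow> grad \<phi> x = 0" by (rule test_functionE[OF \<phi>]) (rule that; simp)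
  then show "(LINT x:X|lebesgue. v x \<bullet> grad \<phi> x) = (LINT x|lebesgue. v x \<bullet> grad \<phi> x)"
    by (intro set_integrable_iff_of_support) (metis inner_zero_right subsetD)
qed

lemma has_weak_div_alt:
  "has_weak_div X \<tau> g \<longleftrightarrow> locally_integrable X \<tau> \<and> locally_integrable X g \<and>
     (\<forall>\<phi>\<in>test_functions X.
        (LINT x|lebesgue. \<tau> x \<bullet> grad \<phi> x) = - (LINT x|lebesgue. g x * \<phi> x))"
proof -
  have "(LINT x:X|lebesgue. \<tau> x \<bullet> (\<chi> i. partial_deriv i \<phi> x)) = (LINT x|lebesgue. \<tau> x \<bullet> grad \<phi> x)"
    "(LINT x:X|lebesgue. g x * \<phi> x) = (LINT x|lebesgue. g x * \<phi> x)"
    if "locally_integrable X \<tau>" "locally_integrable X g" "\<phi> \<in> test_functions X" for \<phi>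
    using test_inner_integrable(3)[OF that(1,3)] test_integrable(5)[OF that(2,3)] by (simp_all add: grad_def[abs_def])
  then show ?thesis unfolding has_weak_div_def
    by (intro conj_cong refl ball_cong all_cong1) simp
qed

lemma AE_eq_of_test_integrals:
  fixes f g :: "real^'d \<Rightarrow> real"
  assumes "open X" "locally_integrable X f" "locally_integrable X g"
    "\<And>\<phi>. \<phi> \<in> test_functions X \<Longrightarrow> (LINT x|lebesgue. f x * \<phi> x) = (LINT x|lebesgue. g x * \<phi> x)"
  shows "AE x\<in>X in lebesgue. f x = g x"
proof -
  have l: "locally_integrable X (\<lambda>x. f x + (-1) *\<^sub>R g x)" by (rule locally_integrable_comb[OF assms(2,3)])
  have "AE x\<in>X in lebesgue. f x + (-1) *\<^sub>R g x = 0"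
  proof (rule fundamental_lemma[OF assms(1) l])
    fix \<phi> assume \<phi>: "\<phi> \<in> test_functions X"
    show "(LINT x:X|lebesgue. (f x + (-1) *\<^sub>R g x) * \<phi> x) = 0"
      unfolding test_integrable(5)[OF l \<phi>]
      using assms(4)[OF \<phi>] test_integrable(1)[OF assms(2) \<phi>] test_integrable(1)[OF assms(3) \<phi>]
      by (simp add: left_diff_distrib)
  qed
  then show ?thesis by eventually_elim auto
qed

lemma AE_vec_eq: "(\<And>i. AE x\<in>X in M. f x $ i = g x $ i) \<Longrightarrow> AE x\<in>X in M. f x = (g x :: real^'d)"
  using eventually_all_finite[of "\<lambda>x i. x \<in> X \<longrightarrow> f x $ i = g x $ i" "ae_filter M"]
  by (auto simp: vec_eq_iff elim: eventually_mono)

lemma weak_grad_unique: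
  assumes "open X" "has_weak_grad X u g" "has_weak_grad X u g'"
  shows "AE x\<in>X in lebesgue. g x = g' x"
proof (rule AE_vec_eq)
  show "AE x\<in>X in lebesgue. g x $ i = g' x $ i" for i
    by (rule AE_eq_of_test_integrals[OF assms(1)])
      (use assms(2,3) in \<open>auto simp: has_weak_grad_alt intro: locally_integrable_nth\<close>)
qed

lemma weak_div_unique:
  assumes "open X" "has_weak_div X \<tau> g" "has_weak_div X \<tau> g'"
  shows "AE x\<in>X in lebesgue. g x = g' x"
  by (rule AE_eq_of_test_integrals[OF assms(1)]) (use assms(2,3) in \<open>auto simp: has_weak_div_alt\<close>)

text \<open>\<open>weak_grad\<close> picks some weak gradient, not necessarily the square integrable
  one from the definition of the space; uniqueness up to null sets transfers square
  integrability.\<close>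

lemma H1_weak_grad:
  assumes "open X" "u \<in> H1_space X"
  shows "has_weak_grad X u (weak_grad X u)" "weak_grad X u \<in> L2_space X"
proof -
  obtain g where g: "g \<in> L2_space X" "has_weak_grad X u g" using assms(2) by (auto simp: H1_space_def)
  show h: "has_weak_grad X u (weak_grad X u)" unfolding weak_grad_def by (rule someI[of "has_weak_grad X u", OF g(2)])
  show "weak_grad X u \<in> L2_space X"
    by (rule L2_AE_cong[OF g(1) weak_grad_unique[OF assms(1) g(2) h]])
qed

lemma Hdiv_weak_div:
  assumes "open X" "\<tau> \<in> Hdiv_space X"
  shows "has_weak_div X \<tau> (weak_div X \<tau>)" "weak_div X \<tau> \<in> L2_space X"
proof -
  obtain g where g: "g \<in> L2_space X" "has_weak_div X \<tau> g" using assms(2) by (auto simp: Hdiv_space_def)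
  show h: "has_weak_div X \<tau> (weak_div X \<tau>)" unfolding weak_div_def by (rule someI[of "has_weak_div X \<tau>", OF g(2)])
  show "weak_div X \<tau> \<in> L2_space X"
    by (rule L2_AE_cong[OF g(1) weak_div_unique[OF assms(1) g(2) h]])
qed

lemma has_weak_grad_comb:
  assumes "has_weak_grad X u g" "has_weak_grad X v h"
  shows "has_weak_grad X (\<lambda>x. u x + a * v x) (\<lambda>x. g x + a *\<^sub>R h x)"
proof -
  have l: "locally_integrable X u" "locally_integrable X g" "locally_integrable X v" "locally_integrable X h"
    using assms by (auto simp: has_weak_grad_alt)
  have "(LINT x|lebesgue. (u x + a * v x) * grad \<phi> x $ i) = - (LINT x|lebesgue. (g x + a *\<^sub>R h x) $ i * \<phi> x)"
    if \<phi>: "\<phi> \<in> test_functions X" for \<phi> i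
  proof -
    note i = test_integrable(2)[OF l(1) \<phi>, of i] test_integrable(2)[OF l(3) \<phi>, of i]
      test_integrable(1)[OF locally_integrable_nth[OF l(2)] \<phi>, of i] test_integrable(1)[OF locally_integrable_nth[OF l(4)] \<phi>, of i]
    have "(LINT x|lebesgue. u x * grad \<phi> x $ i) = - (LINT x|lebesgue. g x $ i * \<phi> x)"
      "(LINT x|lebesgue. v x * grad \<phi> x $ i) = - (LINT x|lebesgue. h x $ i * \<phi> x)"
      using assms \<phi> by (auto simp: has_weak_grad_alt)
    then show ?thesis using i by (simp add: distrib_right mult.assoc)
  qed
  then show ?thesis using locally_integrable_comb[OF l(1,3), of a] locally_integrable_comb[OF l(2,4), of a]
    by (simp add: has_weak_grad_alt)
qed

lemma has_weak_div_comb: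
  assumes "has_weak_div X u g" "has_weak_div X v h"
  shows "has_weak_div X (\<lambda>x. u x + a *\<^sub>R v x) (\<lambda>x. g x + a * h x)"
proof -
  have l: "locally_integrable X u" "locally_integrable X g" "locally_integrable X v" "locally_integrable X h"
    using assms by (auto simp: has_weak_div_alt)
  have "(LINT x|lebesgue. (u x + a *\<^sub>R v x) \<bullet> grad \<phi> x) = - (LINT x|lebesgue. (g x + a * h x) * \<phi> x)"
    if \<phi>: "\<phi> \<in> test_functions X" for \<phi>
  proof -
    note i = test_inner_integrable(1)[OF l(1) \<phi>] test_inner_integrable(1)[OF l(3) \<phi>]
      test_integrable(1)[OF l(2) \<phi>] test_integrable(1)[OF l(4) \<phi>]
    have "(LINT x|lebesgue. u x \<bullet> grad \<phi> x) = - (LINT x|lebesgue. g x * \<phi> x)"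
      "(LINT x|lebesgue. v x \<bullet> grad \<phi> x) = - (LINT x|lebesgue. h x * \<phi> x)"
      using assms \<phi> by (auto simp: has_weak_div_alt)
    then show ?thesis using i by (simp add: inner_add_left distrib_right mult.assoc)
  qed
  then show ?thesis using locally_integrable_comb[OF l(1,3), of a] locally_integrable_comb[OF l(2,4), of a]
    by (simp add: has_weak_div_alt)
qed

text \<open>The gradients are independent choices, so linearity can only hold almost
  everywhere.\<close>

lemma H1_comb:
  assumes X: "open X" and u: "u \<in> H1_space X" and v: "v \<in> H1_space X"
  shows "(\<lambda>x. u x + a * v x) \<in> H1_space X"
    "AE x\<in>X in lebesgue. weak_grad X (\<lambda>x. u x + a * v x) x = weak_grad X u x + a *\<^sub>R weak_grad X v x"
proof -
  note g = H1_weak_grad[OF X u] and h = H1_weak_grad[OF X v]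
  note c = has_weak_grad_comb[OF g(1) h(1), of a]
  show m: "(\<lambda>x. u x + a * v x) \<in> H1_space X"
    using c L2_comb[OF g(2) h(2), of a] L2_comb[of u X v a] u v by (auto simp: H1_space_def)
  show "AE x\<in>X in lebesgue. weak_grad X (\<lambda>x. u x + a * v x) x = weak_grad X u x + a *\<^sub>R weak_grad X v x"
    by (rule weak_grad_unique[OF X H1_weak_grad(1)[OF X m] c])
qed

lemma Hdiv_comb:
  assumes X: "open X" and u: "u \<in> Hdiv_space X" and v: "v \<in> Hdiv_space X"
  shows "(\<lambda>x. u x + a *\<^sub>R v x) \<in> Hdiv_space X"
    "AE x\<in>X in lebesgue. weak_div X (\<lambda>x. u x + a *\<^sub>R v x) x = weak_div X u x + a * weak_div X v x"
proof -
  note g = Hdiv_weak_div[OF X u] and h = Hdiv_weak_div[OF X v]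
  note c = has_weak_div_comb[OF g(1) h(1), of a]
  show m: "(\<lambda>x. u x + a *\<^sub>R v x) \<in> Hdiv_space X"
    using c L2_comb[OF g(2) h(2), of a] L2_comb[of u X v a] u v by (auto simp: Hdiv_space_def)
  show "AE x\<in>X in lebesgue. weak_div X (\<lambda>x. u x + a *\<^sub>R v x) x = weak_div X u x + a * weak_div X v x"
    by (rule weak_div_unique[OF X Hdiv_weak_div(1)[OF X m] c])
qed

section \<open>Classical derivatives as weak derivatives\<close>

lemma integral_lebesgue_continuous:
  fixes f :: "real^'d \<Rightarrow> real"
  assumes "continuous_on UNIV f"
  shows "(LINT x|lebesgue. f x) = (LINT x|lborel. f x)"
  using assms by (intro integral_completion) (simp add: borel_measurable_continuous_onI)

text \<open>The product of P and \<phi> has compact support, so the integrals of its partial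
  derivatives vanish.\<close>

lemma test_integration_by_parts:
  fixes P :: "real^'d \<Rightarrow> real"
  assumes P: "\<And>x. (P has_derivative (\<lambda>h. G x \<bullet> h)) (at x)" "continuous_on UNIV G" and \<phi>: "\<phi> \<in> test_functions X"
  shows "(LINT x|lebesgue. P x * grad \<phi> x $ i) = - (LINT x|lebesgue. G x $ i * \<phi> x)"
proof -
  obtain K where K: "compact K" "K \<subseteq> X" "\<And>x. x \<notin> K \<Longrightarrow> \<phi> x = 0" "\<And>x. x \<notin> K \<Longrightarrow> grad \<phi> x = 0"
    "\<And>x. (\<phi> has_derivative (\<lambda>h. grad \<phi> x \<bullet> h)) (at x)"
    "continuous_on UNIV \<phi>" "continuous_on UNIV (grad \<phi>)" by (rule test_functionE[OF \<phi>]) (rule that)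
  have cP: "continuous_on UNIV P" by (rule has_derivative_continuous_on[OF P(1)])
  have d: "((\<lambda>x. P x * \<phi> x) has_derivative (\<lambda>h. (P x *\<^sub>R grad \<phi> x + \<phi> x *\<^sub>R G x) \<bullet> h)) (at x)" for x
    using has_derivative_mult[OF P(1)[of x] K(5)[of x]] by (simp add: inner_add_left mult.commute)
  have c: "continuous_on UNIV (\<lambda>x. P x *\<^sub>R grad \<phi> x + \<phi> x *\<^sub>R G x)"
    using cP K P(2) by (intro continuous_intros)
  have "(LINT x|lborel. (P x *\<^sub>R grad \<phi> x + \<phi> x *\<^sub>R G x) \<bullet> axis i 1) = 0"
    by (rule integral_directional_deriv_zero(2)[OF d c K(1)]) (use K in auto)
  then have "(LINT x|lebesgue. (P x *\<^sub>R grad \<phi> x + \<phi> x *\<^sub>R G x) \<bullet> axis i 1) = 0"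
    using c by (subst integral_lebesgue_continuous) (auto intro!: continuous_intros)
  moreover have "(P x *\<^sub>R grad \<phi> x + \<phi> x *\<^sub>R G x) \<bullet> axis i 1 = P x * grad \<phi> x $ i + G x $ i * \<phi> x" for x
    by (simp add: inner_axis mult.commute)
  moreover note test_integrable(2)[OF locally_integrable_continuous[OF cP] \<phi>, of i]
    test_integrable(1)[OF locally_integrable_nth[OF locally_integrable_continuous[OF P(2)]] \<phi>, of i]
  ultimately show ?thesis by simp
qed

lemma integral_test_AE_cong:
  fixes f g \<phi> :: "real^'d \<Rightarrow> real"
  assumes "AE x\<in>Y in lebesgue. f x = g x" "\<And>x. x \<notin> Y \<Longrightarrow> \<phi> x = 0" "integrable lebesgue (\<lambda>x. f x * \<phi> x)"
  shows "(LINT x|lebesgue. f x * \<phi> x) = (LINT x|lebesgue. g x * \<phi> x)"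
proof -
  have ae: "AE x in lebesgue. f x * \<phi> x = g x * \<phi> x"
    using assms(1) by eventually_elim (use assms(2) in force)
  have "(\<lambda>x. g x * \<phi> x) \<in> borel_measurable lebesgue"
    by (rule borel_measurable_AE[OF _ ae]) (use assms(3) in auto)
  then show ?thesis using ae assms(3) by (intro integral_cong_AE) auto
qed

text \<open>Testing only with functions supported in Y allows u to be replaced by P. This identifies
  weak gradients element by element without looking at boundaries.\<close>

lemma weak_grad_classical:
  assumes wg: "has_weak_grad X u g" and Y: "open Y" "Y \<subseteq> X" and eq: "AE x\<in>Y in lebesgue. u x = P x"
    and P: "\<And>x. (P has_derivative (\<lambda>h. G x \<bullet> h)) (at x)" "continuous_on UNIV G"
  shows "AE x\<in>Y in lebesgue. g x = G x"
proof (rule AE_vec_eq, rule AE_eq_of_test_integrals[OF Y(1)])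
  have l: "locally_integrable X u" "locally_integrable X g" using wg by (auto simp: has_weak_grad_alt)
  fix i
  show "locally_integrable Y (\<lambda>x. g x $ i)" using l Y locally_integrable_subset locally_integrable_nth by blast
  show "locally_integrable Y (\<lambda>x. G x $ i)" by (intro locally_integrable_nth locally_integrable_continuous P)
  fix \<phi> assume \<phi>: "\<phi> \<in> test_functions Y"
  then have \<phi>X: "\<phi> \<in> test_functions X" using test_functions_mono[OF Y(2)] by blast
  obtain K where K: "K \<subseteq> Y" "\<And>x. x \<notin> K \<Longrightarrow> grad \<phi> x = 0" by (rule test_functionE[OF \<phi>]) (rule that; simp)
  have zY: "grad \<phi> x $ i = 0" if "x \<notin> Y" for x i
    using that K(1) by (subst K(2)) auto
  have "(LINT x|lebesgue. u x * grad \<phi> x $ i) = (LINT x|lebesgue. P x * grad \<phi> x $ i)"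
    by (rule integral_test_AE_cong[OF eq _ test_integrable(2)[OF l(1) \<phi>X]]) (rule zY)
  moreover have "(LINT x|lebesgue. u x * grad \<phi> x $ i) = - (LINT x|lebesgue. g x $ i * \<phi> x)"
    using wg \<phi>X by (auto simp: has_weak_grad_alt)
  ultimately show "(LINT x|lebesgue. g x $ i * \<phi> x) = (LINT x|lebesgue. G x $ i * \<phi> x)"
    using test_integration_by_parts[OF P \<phi>, of i] by simp
qed

lemma test_divergence_by_parts:
  fixes R :: "real^'d \<Rightarrow> real^'d"
  assumes R: "\<And>i x. ((\<lambda>x. R x $ i) has_derivative (\<lambda>h. D i x \<bullet> h)) (at x)" "\<And>i. continuous_on UNIV (D i)"
    and \<phi>: "\<phi> \<in> test_functions X"
  shows "(LINT x|lebesgue. R x \<bullet> grad \<phi> x) = - (LINT x|lebesgue. (\<Sum>i\<in>UNIV. D i x $ i) * \<phi> x)"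
proof -
  have "continuous_on UNIV (\<lambda>x. R x $ i)" for i by (rule has_derivative_continuous_on[OF R(1)])
  then have cR: "continuous_on UNIV R"
    using continuous_on_vec_lambda[of UNIV "\<lambda>i x. R x $ i"] by simp
  have "(LINT x|lebesgue. R x \<bullet> grad \<phi> x) = (\<Sum>i\<in>UNIV. - (LINT x|lebesgue. D i x $ i * \<phi> x))"
    using test_inner_integrable(2)[OF locally_integrable_continuous[OF cR] \<phi>]
      test_integration_by_parts[OF R(1) R(2) \<phi>] by simp
  moreover have "integrable lebesgue (\<lambda>x. D i x $ i * \<phi> x)" for i
    by (rule test_integrable(1)[OF locally_integrable_nth[OF locally_integrable_continuous[OF R(2)]] \<phi>])
  ultimately show ?thesis by (simp add: sum_distrib_right sum_negf)
qed

lemma weak_div_classical: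
  fixes R :: "real^'d \<Rightarrow> real^'d"
  assumes wd: "has_weak_div X \<tau> g" and Y: "open Y" "Y \<subseteq> X" and eq: "AE x\<in>Y in lebesgue. \<tau> x = R x"
    and R: "\<And>i x. ((\<lambda>x. R x $ i) has_derivative (\<lambda>h. D i x \<bullet> h)) (at x)" "\<And>i. continuous_on UNIV (D i)"
  shows "AE x\<in>Y in lebesgue. g x = (\<Sum>i\<in>UNIV. D i x $ i)"
proof (rule AE_eq_of_test_integrals[OF Y(1)])
  have l: "locally_integrable X \<tau>" "locally_integrable X g" using wd by (auto simp: has_weak_div_alt)
  have "continuous_on UNIV (\<lambda>x. R x $ i)" for i by (rule has_derivative_continuous_on[OF R(1)])
  then have cR: "continuous_on UNIV R"
    using continuous_on_vec_lambda[of UNIV "\<lambda>i x. R x $ i"] by simp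
  show "locally_integrable Y g" using l Y locally_integrable_subset by blast
  show "locally_integrable Y (\<lambda>x. \<Sum>i\<in>UNIV. D i x $ i)"
    by (intro locally_integrable_continuous continuous_intros R)
  fix \<phi> assume \<phi>: "\<phi> \<in> test_functions Y"
  then have \<phi>X: "\<phi> \<in> test_functions X" using test_functions_mono[OF Y(2)] by blast
  obtain K where K: "K \<subseteq> Y" "\<And>x. x \<notin> K \<Longrightarrow> grad \<phi> x = 0" by (rule test_functionE[OF \<phi>]) (rule that; simp)
  have zY: "grad \<phi> x $ i = 0" if "x \<notin> Y" for x i
    using that K(1) by (subst K(2)) auto
  have "(LINT x|lebesgue. \<tau> x $ i * grad \<phi> x $ i) = (LINT x|lebesgue. R x $ i * grad \<phi> x $ i)" for i
    by (rule integral_test_AE_cong[OF _ _ test_integrable(2)[OF locally_integrable_nth[OF l(1)] \<phi>X], of Y])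
      (use eq zY in \<open>auto elim: eventually_mono\<close>)
  then have "(LINT x|lebesgue. \<tau> x \<bullet> grad \<phi> x) = (LINT x|lebesgue. R x \<bullet> grad \<phi> x)"
    using test_inner_integrable(2)[OF l(1) \<phi>X] test_inner_integrable(2)[OF locally_integrable_continuous[OF cR] \<phi>] by simp
  moreover have "(LINT x|lebesgue. \<tau> x \<bullet> grad \<phi> x) = - (LINT x|lebesgue. g x * \<phi> x)"
    using wd \<phi>X by (auto simp: has_weak_div_alt)
  ultimately show "(LINT x|lebesgue. g x * \<phi> x) = (LINT x|lebesgue. (\<Sum>i\<in>UNIV. D i x $ i) * \<phi> x)"
    using test_divergence_by_parts[OF R \<phi>] by simp
qed

section \<open>Piecewise polynomial functions\<close>

lemma poly_space_continuous: "P \<in> poly_space p \<Longrightarrow> continuous_on UNIV P"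
  using poly_space_Ck_fun[of P p 0] by simp

lemma poly_space_C1E:
  fixes P :: "real^'d \<Rightarrow> real"
  assumes "P \<in> poly_space p"
  obtains G where "\<And>x. (P has_derivative (\<lambda>h. G x \<bullet> h)) (at x)" "\<And>i. (\<lambda>x. G x $ i) \<in> poly_space (p - 1)"
    "p = 0 \<Longrightarrow> G = (\<lambda>x. 0)" "(\<lambda>x. G x \<bullet> x) \<in> poly_space p" "continuous_on UNIV G"
proof -
  obtain G where G: "\<And>x. (P has_derivative (\<lambda>h. G x \<bullet> h)) (at x)" "\<And>i. (\<lambda>x. G x $ i) \<in> poly_space (p - 1)"
    "p = 0 \<Longrightarrow> G = (\<lambda>x. 0)" "(\<lambda>x. G x \<bullet> x) \<in> poly_space p" by (rule poly_space_derivE[OF assms]) (rule that)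
  have "continuous_on UNIV G"
    using continuous_on_vec_lambda[of UNIV "\<lambda>i x. G x $ i"] poly_space_continuous[OF G(2)] by simp
  from that[OF G this] show ?thesis .
qed

text \<open>The divergence of b(x) x is d b + grad b . x, which does not exceed degree p although
  the field has degree p + 1.\<close>

lemma RT_local_divE:
  fixes R :: "real^'d \<Rightarrow> real^'d"
  assumes "R \<in> RT_local p"
  obtains D where "\<And>i x. ((\<lambda>x. R x $ i) has_derivative (\<lambda>h. D i x \<bullet> h)) (at x)" "\<And>i. continuous_on UNIV (D i)"
    "(\<lambda>x. \<Sum>i\<in>UNIV. D i x $ i) \<in> poly_space p"
proof -
  obtain a b where ab: "\<And>i. (\<lambda>x. a x $ i) \<in> poly_space p" "b \<in> poly_space p" "R = (\<lambda>x. a x + b x *\<^sub>R x)"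
    using assms unfolding RT_local_def by blast
  have "\<exists>G. (\<forall>x. ((\<lambda>x. a x $ i) has_derivative (\<lambda>h. G x \<bullet> h)) (at x)) \<and> (\<forall>j. (\<lambda>x. G x $ j) \<in> poly_space (p - 1)) \<and>
      continuous_on UNIV G" for i
  proof -
    obtain G where "\<And>x. ((\<lambda>x. a x $ i) has_derivative (\<lambda>h. G x \<bullet> h)) (at x)"
      "\<And>j. (\<lambda>x. G x $ j) \<in> poly_space (p - 1)" "continuous_on UNIV G"
      by (rule poly_space_C1E[OF ab(1)[of i]]) (rule that)
    then show ?thesis by (intro exI[of _ G]) simp
  qed
  then obtain G where G: "\<And>i x. ((\<lambda>x. a x $ i) has_derivative (\<lambda>h. G i x \<bullet> h)) (at x)"
    "\<And>i j. (\<lambda>x. G i x $ j) \<in> poly_space (p - 1)" "\<And>i. continuous_on UNIV (G i)" by metis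
  obtain H where H: "\<And>x. (b has_derivative (\<lambda>h. H x \<bullet> h)) (at x)" "(\<lambda>x. H x \<bullet> x) \<in> poly_space p" "continuous_on UNIV H"
    by (rule poly_space_C1E[OF ab(2)]) (rule that)
  define D where "D i x = G i x + (b x *\<^sub>R axis i 1 + (x $ i) *\<^sub>R H x)" for i x
  show ?thesis
  proof (rule that[of D])
    fix i :: 'd and x :: "real^'d"
    have "((\<lambda>x::real^'d. x $ i) has_derivative (\<lambda>h. h $ i)) (at x)" by (rule bounded_linear.has_derivative[OF bounded_linear_vec_nth has_derivative_ident])
    from has_derivative_add[OF G(1)[of i x] has_derivative_mult[OF H(1)[of x] this]]
    show "((\<lambda>x. R x $ i) has_derivative (\<lambda>h. D i x \<bullet> h)) (at x)"
      by (simp add: ab(3) D_def inner_add_left inner_axis' mult.commute)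
  next
    fix i
    show "continuous_on UNIV (D i)" unfolding D_def
      using poly_space_continuous[OF ab(2)] G(3) H(3) by (intro continuous_intros) auto
  next
    have "(\<Sum>i\<in>UNIV. D i x $ i) = (\<Sum>i\<in>UNIV. G i x $ i) + (CARD('d) * b x + H x \<bullet> x)" for x
      by (simp add: D_def sum.distrib inner_vec_def mult.commute)
    moreover have "(\<lambda>x. (\<Sum>i\<in>UNIV. G i x $ i) + (CARD('d) * b x + H x \<bullet> x)) \<in> poly_space p"
      using G(2) poly_space_mono[of "p - 1" p] ab(2) H(2)
      by (intro poly_space_add poly_space_sum poly_space_cmult) auto
    ultimately show "(\<lambda>x. \<Sum>i\<in>UNIV. D i x $ i) \<in> poly_space p" by simp
  qed
qed

lemma RT_local_continuous:
  fixes R :: "real^'d \<Rightarrow> real^'d"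
  assumes "R \<in> RT_local p" shows "continuous_on UNIV R"
proof -
  obtain D where "\<And>i x. ((\<lambda>x. R x $ i) has_derivative (\<lambda>h. D i x \<bullet> h)) (at x)"
    by (rule RT_local_divE[OF assms]) (rule that)
  then have "continuous_on UNIV (\<lambda>x. R x $ i)" for i by (rule has_derivative_continuous_on)
  then show ?thesis using continuous_on_vec_lambda[of UNIV "\<lambda>i x. R x $ i"] by simp
qed

lemma RT_local_comb:
  assumes "R \<in> RT_local p" "S \<in> RT_local p" shows "(\<lambda>x. R x + c *\<^sub>R S x) \<in> RT_local p"
proof -
  obtain a b a' b' where ab: "\<And>i. (\<lambda>x. a x $ i) \<in> poly_space p" "b \<in> poly_space p" "R = (\<lambda>x. a x + b x *\<^sub>R x)"
    "\<And>i. (\<lambda>x. a' x $ i) \<in> poly_space p" "b' \<in> poly_space p" "S = (\<lambda>x. a' x + b' x *\<^sub>R x)"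
    using assms unfolding RT_local_def by blast
  then show ?thesis unfolding RT_local_def
    by (intro CollectI exI[of _ "\<lambda>x. a x + c *\<^sub>R a' x"] exI[of _ "\<lambda>x. b x + c * b' x"])
      (auto intro!: poly_space_comb simp: algebra_simps)
qed

text \<open>These radial fields are tangential to every facet through v, which makes their fluxes
  easy to control; in the definition take a = - Q v and b = Q.\<close>

lemma cone_field_RT_local:
  assumes Q: "Q \<in> poly_space p" shows "(\<lambda>x. Q x *\<^sub>R (x - v)) \<in> RT_local p"
  unfolding RT_local_def
  by (intro CollectI exI[of _ "\<lambda>x. Q x *\<^sub>R (- v)"] exI[of _ Q])
    (auto simp: Q algebra_simps poly_space_cmult[OF Q, of "- (v $ _)"] mult.commute intro!: poly_space_cmult[OF Q, of "- (v $ _)", simplified])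

lemma zero_RT_local: "(\<lambda>x. 0) \<in> RT_local p"
  using cone_field_RT_local[OF poly_space_zero, of 0 p] by simp

lemma X_space_comb:
  assumes "v \<in> X_space \<Omega> \<T> p" "w \<in> X_space \<Omega> \<T> p"
  shows "(\<lambda>x. v x + a * w x) \<in> X_space \<Omega> \<T> p"
proof -
  have "\<exists>P\<in>poly_space p. AE x\<in>T in lebesgue. v x + a * w x = P x" if T: "T \<in> \<T>" for T
  proof -
    obtain P where P: "P \<in> poly_space p" "AE x\<in>T in lebesgue. v x = P x"
      using assms(1) T unfolding X_space_def by auto
    obtain Q where Q: "Q \<in> poly_space p" "AE x\<in>T in lebesgue. w x = Q x"
      using assms(2) T unfolding X_space_def by auto
    have "AE x\<in>T in lebesgue. v x + a * w x = P x + a * Q x" using P(2) Q(2) by eventually_elim auto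
    then show ?thesis using poly_space_comb[OF P(1) Q(1)] by (rule bexI)
  qed
  then show ?thesis using assms L2_comb[of v \<Omega> w a] by (auto simp: X_space_def)
qed

lemma V_space_comb:
  assumes "open \<Omega>" "v \<in> V_space \<Omega> \<T> p" "w \<in> V_space \<Omega> \<T> p"
  shows "(\<lambda>x. v x + a * w x) \<in> V_space \<Omega> \<T> p"
  using X_space_comb H1_comb(1)[OF assms(1)] assms by (auto simp: V_space_def)

lemma RT_space_comb:
  assumes "open \<Omega>" "v \<in> RT_space \<Omega> \<T> p" "w \<in> RT_space \<Omega> \<T> p"
  shows "(\<lambda>x. v x + a *\<^sub>R w x) \<in> RT_space \<Omega> \<T> p"
proof -
  have "\<exists>P\<in>RT_local p. AE x\<in>T in lebesgue. v x + a *\<^sub>R w x = P x" if T: "T \<in> \<T>" for T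
  proof -
    obtain P where P: "P \<in> RT_local p" "AE x\<in>T in lebesgue. v x = P x"
      using assms(2) T unfolding RT_space_def by auto
    obtain Q where Q: "Q \<in> RT_local p" "AE x\<in>T in lebesgue. w x = Q x"
      using assms(3) T unfolding RT_space_def by auto
    have "AE x\<in>T in lebesgue. v x + a *\<^sub>R w x = P x + a *\<^sub>R Q x" using P(2) Q(2) by eventually_elim auto
    then show ?thesis using RT_local_comb[OF P(1) Q(1)] by (rule bexI)
  qed
  then show ?thesis using assms Hdiv_comb(1)[OF assms(1), of v w a] by (auto simp: RT_space_def)
qed

lemma mesh_interiors_disjoint:
  fixes \<T> :: "(real^'d) set set"
  assumes mesh: "simplicial_mesh \<Omega> \<T>" and T: "S \<in> \<T>" "T \<in> \<T>" "S \<noteq> T"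
  shows "interior S \<inter> interior T = {}"
  using mesh_Int_lowdim[OF assms] aff_dim_nonempty_interior[of "S \<inter> T"] by (auto simp: interior_Int)

lemma AE_interior_imp:
  fixes T :: "(real^'d) set"
  assumes "negligible (T - interior T)" "AE x\<in>interior T in lebesgue. P x" shows "AE x\<in>T in lebesgue. P x"
proof -
  have "AE x in lebesgue. x \<notin> T - interior T" by (rule AE_not_in) (use assms(1) negligible_iff_null_sets in blast)
  then show ?thesis using assms(2) by eventually_elim auto
qed

section \<open>Element-wise polynomial fields on a meshed domain\<close>

locale meshed_domain =
  fixes \<Omega> :: "(real^'d) set" and \<T> :: "(real^'d) set set"
  assumes open_dom: "open \<Omega>" and bounded_dom: "bounded \<Omega>" and connected_dom: "connected \<Omega>"
    and mesh: "simplicial_mesh \<Omega> \<T>"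
begin

lemma mesh_finite: "finite \<T>" using mesh by (simp add: simplicial_mesh_def triangulation_def)

lemma mesh_cover: "x \<in> \<Omega> \<Longrightarrow> \<exists>T\<in>\<T>. x \<in> T"
  using mesh closure_subset[of \<Omega>] by (auto simp: simplicial_mesh_def)

lemma mesh_AE:
  assumes "\<And>T. T \<in> \<T> \<Longrightarrow> AE x\<in>interior T in lebesgue. P x"
  shows "AE x\<in>\<Omega> in lebesgue. P x"
proof -
  have "AE x\<in>T in lebesgue. P x" if "T \<in> \<T>" for T
    using AE_interior_imp[OF mesh_element(6)[OF mesh that] assms[OF that]] .
  then have "AE x in lebesgue. \<forall>T\<in>\<T>. x \<in> T \<longrightarrow> P x"
    by (intro AE_ball_countable[OF countable_finite[OF mesh_finite], THEN iffD2] ballI)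
  then show ?thesis by (rule eventually_mono) (use mesh_cover in blast)
qed

lemma V_space_elementE:
  assumes u: "u \<in> V_space \<Omega> \<T> k" and T: "T \<in> \<T>"
  obtains P G where "P \<in> poly_space k" "\<And>x. (P has_derivative (\<lambda>h. G x \<bullet> h)) (at x)" "continuous_on UNIV G"
    "AE x\<in>T in lebesgue. u x = P x" "AE x\<in>T in lebesgue. weak_grad \<Omega> u x = G x"
proof -
  obtain P where P: "P \<in> poly_space k" "AE x\<in>T in lebesgue. u x = P x"
    using u T by (auto simp: V_space_def X_space_def)
  obtain G where G: "\<And>x. (P has_derivative (\<lambda>h. G x \<bullet> h)) (at x)" "continuous_on UNIV G"
    by (rule poly_space_C1E[OF P(1)]) (rule that)
  have "u \<in> H1_space \<Omega>" using u by (simp add: V_space_def)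
  note wg = H1_weak_grad(1)[OF open_dom this]
  have ae: "AE x\<in>interior T in lebesgue. u x = P x"
    using P(2) by eventually_elim (use interior_subset[of T] in auto)
  have "AE x\<in>interior T in lebesgue. weak_grad \<Omega> u x = G x"
    by (rule weak_grad_classical[OF wg open_interior mesh_element(4)[OF mesh T] ae G])
  then have "AE x\<in>T in lebesgue. weak_grad \<Omega> u x = G x"
    by (rule AE_interior_imp[OF mesh_element(6)[OF mesh T]])
  then show ?thesis by (rule that[OF P(1) G P(2)])
qed

lemma weak_div_in_X_space:
  assumes \<tau>: "\<tau> \<in> RT_space \<Omega> \<T> p" shows "weak_div \<Omega> \<tau> \<in> X_space \<Omega> \<T> p"
proof -
  have hd: "\<tau> \<in> Hdiv_space \<Omega>" using \<tau> by (simp add: RT_space_def)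
  have "\<exists>P\<in>poly_space p. AE x\<in>T in lebesgue. weak_div \<Omega> \<tau> x = P x" if T: "T \<in> \<T>" for T
  proof -
    obtain R where R: "R \<in> RT_local p" "AE x\<in>T in lebesgue. \<tau> x = R x" using \<tau> T by (auto simp: RT_space_def)
    obtain D where D: "\<And>i x. ((\<lambda>x. R x $ i) has_derivative (\<lambda>h. D i x \<bullet> h)) (at x)" "\<And>i. continuous_on UNIV (D i)"
      "(\<lambda>x. \<Sum>i\<in>UNIV. D i x $ i) \<in> poly_space p"
      by (rule RT_local_divE[OF R(1)]) (rule that)
    have ae: "AE x\<in>interior T in lebesgue. \<tau> x = R x"
      using R(2) by eventually_elim (use interior_subset[of T] in auto)
    have "AE x\<in>interior T in lebesgue. weak_div \<Omega> \<tau> x = (\<Sum>i\<in>UNIV. D i x $ i)"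
      by (rule weak_div_classical[OF Hdiv_weak_div(1)[OF open_dom hd] open_interior mesh_element(4)[OF mesh T] ae D(1,2)])
    then have "AE x\<in>T in lebesgue. weak_div \<Omega> \<tau> x = (\<Sum>i\<in>UNIV. D i x $ i)"
      by (rule AE_interior_imp[OF mesh_element(6)[OF mesh T]])
    then show ?thesis using D(3) by (rule bexI)
  qed
  then show ?thesis using Hdiv_weak_div(2)[OF open_dom hd] by (simp add: X_space_def)
qed

text \<open>Interiors of elements are disjoint, so at most one summand is nonzero; the value on the
  null skeleton is 0.\<close>

definition pw :: "((real^'d) set \<Rightarrow> real^'d \<Rightarrow> 'b::euclidean_space) \<Rightarrow> real^'d \<Rightarrow> 'b" where
  "pw R x = (\<Sum>T\<in>\<T>. indicator (interior T) x *\<^sub>R R T x)"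

lemma pw_interior:
  assumes T: "T \<in> \<T>" "x \<in> interior T" shows "pw R x = R T x"
proof -
  have "pw R x = (\<Sum>S\<in>\<T>. if T = S then R S x else 0)"
    unfolding pw_def using mesh_interiors_disjoint[OF mesh T(1)] T by (intro sum.cong) (auto simp: indicator_def)
  then show ?thesis using T mesh_finite by simp
qed

lemma pw_L2:
  fixes R :: "(real^'d) set \<Rightarrow> real^'d \<Rightarrow> 'b::euclidean_space"
  assumes "\<And>T. T \<in> \<T> \<Longrightarrow> continuous_on UNIV (R T)" shows "pw R \<in> L2_space \<Omega>"
proof -
  have m: "\<Omega> \<in> sets lebesgue" using open_dom by simp
  have 1: "(\<lambda>x. indicat_real (interior T) x *\<^sub>R R T x) \<in> L2_space \<Omega>" if "T \<in> \<T>" for T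
  proof (rule L2_bounded_mult[where C = 1])
    show "(\<lambda>x. indicat_real \<Omega> x *\<^sub>R indicat_real (interior T) x) \<in> borel_measurable lebesgue"
      using m by (intro borel_measurable_scaleR borel_measurable_indicator) auto
    show "R T \<in> L2_space \<Omega>" by (rule L2_continuous_bounded[OF assms[OF that] bounded_dom m])
  qed (auto simp: indicator_def)
  have "(\<lambda>x. \<Sum>T\<in>A. indicat_real (interior T) x *\<^sub>R R T x) \<in> L2_space \<Omega>" if "finite A" "A \<subseteq> \<T>" for A
    using that
  proof (induction A rule: finite_induct)
    case empty then show ?case by (simp add: L2_zero)
  next
    case (insert T A)
    have "(\<lambda>x. (\<Sum>T\<in>A. indicat_real (interior T) x *\<^sub>R R T x) + 1 *\<^sub>R (indicat_real (interior T) x *\<^sub>R R T x)) \<in> L2_space \<Omega>"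
      using insert by (intro L2_comb 1) auto
    then show ?case unfolding sum.insert[OF insert(1,2)] by (simp only: scaleR_one add.commute)
  qed
  then show ?thesis using mesh_finite by (simp add: pw_def[abs_def])
qed

text \<open>Weak derivatives live on open sets with the completed measure, the cone identities on
  closed simplices with Borel sets; the two integrals differ only on the null boundary of T.\<close>

lemma mesh_integral_bridge:
  fixes f :: "real^'d \<Rightarrow> real"
  assumes T: "T \<in> \<T>" and f: "continuous_on UNIV f"
  shows "set_integrable lborel T f" "integrable lebesgue (\<lambda>x. indicator (interior T) x *\<^sub>R f x)"
    "(LINT x|lebesgue. indicator (interior T) x *\<^sub>R f x) = (LINT x:T|lborel. f x)"
proof -
  note el = mesh_element[OF mesh T]
  show i: "set_integrable lborel T f"
    using f el(1) borel_integrable_compact[of T f] continuous_on_subset by (auto simp: set_integrable_def)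
  have m: "(\<lambda>x. indicat_real T x *\<^sub>R f x) \<in> borel_measurable lborel" using i by (auto simp: set_integrable_def)
  have i': "integrable lebesgue (\<lambda>x. indicat_real T x *\<^sub>R f x)"
    using i m by (simp add: set_integrable_def integrable_completion)
  have "AE x in lebesgue. x \<notin> T - interior T" by (rule AE_not_in) (use el(6) negligible_iff_null_sets in blast)
  then have ae: "AE x in lebesgue. indicat_real T x *\<^sub>R f x = indicator (interior T) x *\<^sub>R f x"
    by eventually_elim (use interior_subset[of T] in \<open>auto simp: indicator_def\<close>)
  have m': "(\<lambda>x. indicat_real (interior T) x *\<^sub>R f x) \<in> borel_measurable lebesgue"
    by (rule borel_measurable_AE[OF _ ae]) (use i' in auto)
  show "integrable lebesgue (\<lambda>x. indicator (interior T) x *\<^sub>R f x)"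
    using i' integrable_cong_AE[OF _ m' ae] by auto
  have "(LINT x|lebesgue. indicator (interior T) x *\<^sub>R f x) = (LINT x|lebesgue. indicat_real T x *\<^sub>R f x)"
    using ae m' i' by (intro integral_cong_AE) auto
  also have "\<dots> = (LINT x:T|lborel. f x)" using m by (simp add: set_lebesgue_integral_def integral_completion)
  finally show "(LINT x|lebesgue. indicator (interior T) x *\<^sub>R f x) = (LINT x:T|lborel. f x)" .
qed

lemma pw_integral:
  fixes f :: "(real^'d) set \<Rightarrow> real^'d \<Rightarrow> real"
  assumes "\<And>T. T \<in> \<T> \<Longrightarrow> continuous_on UNIV (f T)"
  shows "(LINT x|lebesgue. pw f x) = (\<Sum>T\<in>\<T>. LINT x:T|lborel. f T x)"
  unfolding pw_def using mesh_integral_bridge[OF _ assms] by simp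

text \<open>The hypothesis \<open>id\<close> says that the boundary terms of integration by parts on
  the elements cancel in total. It stands for continuity of the normal component across facets and
  makes the element-wise D the weak divergence.\<close>

lemma pw_RT:
  assumes R: "\<And>T. T \<in> \<T> \<Longrightarrow> R T \<in> RT_local p" and D: "\<And>T. T \<in> \<T> \<Longrightarrow> continuous_on UNIV (D T)"
    and id: "\<And>\<phi>. \<phi> \<in> test_functions \<Omega> \<Longrightarrow> (\<Sum>T\<in>\<T>. LINT x:T|lborel. R T x \<bullet> grad \<phi> x + D T x * \<phi> x) = 0"
  shows "pw R \<in> RT_space \<Omega> \<T> p" "has_weak_div \<Omega> (pw R) (pw D)"
proof -
  have cR: "continuous_on UNIV (R T)" if "T \<in> \<T>" for T using RT_local_continuous[OF R[OF that]] .
  have L2: "pw R \<in> L2_space \<Omega>" "pw D \<in> L2_space \<Omega>" using pw_L2 cR D by blast+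
  show wd: "has_weak_div \<Omega> (pw R) (pw D)"
    unfolding has_weak_div_alt
  proof (intro conjI ballI)
    show l: "locally_integrable \<Omega> (pw R)" "locally_integrable \<Omega> (pw D)" using L2 L2_locally_integrable by blast+
    fix \<phi> assume \<phi>: "\<phi> \<in> test_functions \<Omega>"
    have c: "continuous_on UNIV \<phi>" "continuous_on UNIV (grad \<phi>)" by (rule test_functionE[OF \<phi>], assumption)+
    have "pw R x \<bullet> grad \<phi> x + pw D x * \<phi> x = pw (\<lambda>T x. R T x \<bullet> grad \<phi> x + D T x * \<phi> x) x" for x
      unfolding pw_def inner_sum_left sum_distrib_right sum.distrib[symmetric] by (intro sum.cong) (auto simp: algebra_simps)
    moreover have "(LINT x|lebesgue. pw (\<lambda>T x. R T x \<bullet> grad \<phi> x + D T x * \<phi> x) x) = 0"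
      using id[OF \<phi>] by (subst pw_integral) (auto intro!: continuous_intros cR D c)
    ultimately have "(LINT x|lebesgue. pw R x \<bullet> grad \<phi> x + pw D x * \<phi> x) = 0" by simp
    then show "(LINT x|lebesgue. pw R x \<bullet> grad \<phi> x) = - (LINT x|lebesgue. pw D x * \<phi> x)"
      using test_inner_integrable(1)[OF l(1) \<phi>] test_integrable(1)[OF l(2) \<phi>] by simp
  qed
  have "AE x\<in>T in lebesgue. pw R x = R T x" if "T \<in> \<T>" for T
    by (rule AE_interior_imp[OF mesh_element(6)[OF mesh that]]) (use pw_interior[OF that] in auto)
  then show "pw R \<in> RT_space \<Omega> \<T> p" using L2 wd R by (auto simp: RT_space_def Hdiv_space_def)
qed

text \<open>Turns any element-wise field with cancelling fluxes into one scalar equation for the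
  local polynomials of z.\<close>

lemma pw_orthogonal:
  assumes R: "\<And>T. T \<in> \<T> \<Longrightarrow> R T \<in> RT_local p" and D: "\<And>T. T \<in> \<T> \<Longrightarrow> continuous_on UNIV (D T)"
    and id: "\<And>\<phi>. \<phi> \<in> test_functions \<Omega> \<Longrightarrow> (\<Sum>T\<in>\<T>. LINT x:T|lborel. R T x \<bullet> grad \<phi> x + D T x * \<phi> x) = 0"
    and z: "z \<in> X_space \<Omega> \<T> p" and orth: "\<And>\<tau>. \<tau> \<in> RT_space \<Omega> \<T> p \<Longrightarrow> L2_inner \<Omega> (weak_div \<Omega> \<tau>) z = 0"
    and Z: "\<And>T. T \<in> \<T> \<Longrightarrow> Z T \<in> poly_space p" "\<And>T. T \<in> \<T> \<Longrightarrow> AE x\<in>T in lebesgue. z x = Z T x"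
  shows "(\<Sum>T\<in>\<T>. LINT x:T|lborel. D T x * Z T x) = 0"
proof -
  note pR = pw_RT[OF R D id]
  have hd: "pw R \<in> Hdiv_space \<Omega>" using pR(1) by (simp add: RT_space_def)
  have wd: "AE x\<in>\<Omega> in lebesgue. weak_div \<Omega> (pw R) x = pw D x"
    by (rule weak_div_unique[OF open_dom Hdiv_weak_div(1)[OF open_dom hd] pR(2)])
  have "AE x\<in>\<Omega> in lebesgue. z x = pw Z x"
  proof (rule mesh_AE)
    fix T assume T: "T \<in> \<T>"
    show "AE x\<in>interior T in lebesgue. z x = pw Z x"
      using Z(2)[OF T] by eventually_elim (use pw_interior[OF T, of _ Z] interior_subset[of T] in auto)
  qed
  then have "L2_inner \<Omega> (pw D) (pw Z) = L2_inner \<Omega> (weak_div \<Omega> (pw R)) z"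
    using wd z by (intro L2_inner_AE_cong[symmetric] Hdiv_weak_div(2)[OF open_dom hd]) (auto simp: X_space_def)
  also have "\<dots> = 0" by (rule orth[OF pR(1)])
  \<comment> \<open>\<open>pw D\<close> lives on the element interiors, which lie in \<Omega>, so
    the integral may run over the whole space.\<close>
  also have "L2_inner \<Omega> (pw D) (pw Z) = (LINT x|lebesgue. pw D x * pw Z x)"
  proof -
    have "pw D x = 0" if "x \<notin> \<Omega>" for x
      unfolding pw_def using that subsetD[OF mesh_element(4)[OF mesh]]
      by (intro sum.neutral ballI) (auto simp: indicator_def)
    then show ?thesis unfolding L2_inner_def by (subst set_integrable_iff_of_support(2)) auto
  qed
  also have "(\<lambda>x. pw D x * pw Z x) = pw (\<lambda>T x. D T x * Z T x)"
  proof
    fix x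
    show "pw D x * pw Z x = pw (\<lambda>T x. D T x * Z T x) x"
    proof (cases "\<exists>T\<in>\<T>. x \<in> interior T")
      case True
      then obtain T where "T \<in> \<T>" "x \<in> interior T" by blast
      then show ?thesis by (simp only: pw_interior)
    next
      case False
      then have "pw f x = 0" for f :: "(real^'d) set \<Rightarrow> real^'d \<Rightarrow> real" by (auto simp: pw_def intro!: sum.neutral)
      then show ?thesis by simp
    qed
  qed
  also have "(LINT x|lebesgue. pw (\<lambda>T x. D T x * Z T x) x) = (\<Sum>T\<in>\<T>. LINT x:T|lborel. D T x * Z T x)"
    using D poly_space_continuous[OF Z(1)] by (intro pw_integral continuous_intros) auto
  finally show ?thesis .
qed

end

section \<open>Comparison of cones over a common facet\<close>

lemma bary_opposite_facet:
  assumes b: "barycentric C l" and v: "v \<in> C" and x: "x \<in> convex hull (C - {v})"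
  shows "l v x = 0"
proof -
  have fin: "finite (C - {v})" using bary_finite[OF b] by simp
  obtain u where u: "sum u (C - {v}) = 1" "(\<Sum>w\<in>C - {v}. u w *\<^sub>R w) = x"
    using x unfolding convex_hull_finite[OF fin] by blast
  have "l v x = (\<Sum>w\<in>C - {v}. u w * l v w)" using bary_comb[OF b u(1), of v "\<lambda>w. w"] u(2) by simp
  also have "\<dots> = 0" using bary_vertex[OF b v] by (intro sum.neutral) auto
  finally show ?thesis .
qed

lemma continuous_set_integrable_lborel:
  fixes f :: "real^'d \<Rightarrow> real"
  assumes "compact T" "continuous_on UNIV f" shows "set_integrable lborel T f"
  using assms borel_integrable_compact[of T f] continuous_on_subset by (auto simp: set_integrable_def)

text \<open>The integrand is the divergence of \<psi>(x) (x - a), whose flux leaves only through the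
  facet opposite to a and equals the height of the cone times the integral of \<psi> over that
  facet; k is the ratio of the heights. To avoid the facet integral, an affine map that fixes the
  facet carries one cone onto the other.\<close>

lemma cone_compare:
  fixes K :: "(real^'d) set"
  assumes b1: "barycentric (insert a K) l" and b2: "barycentric (insert b K) m" and nin: "a \<notin> K" "b \<notin> K"
  shows "\<exists>k>0. \<forall>(\<psi> :: real^'d \<Rightarrow> real) G. (\<forall>x. (\<psi> has_derivative (\<lambda>h. G x \<bullet> h)) (at x)) \<longrightarrow> continuous_on UNIV G \<longrightarrow>
     (LINT x:convex hull (insert a K)|lborel. CARD('d) * \<psi> x + G x \<bullet> (x - a))
      = k * (LINT x:convex hull (insert b K)|lborel. CARD('d) * \<psi> x + G x \<bullet> (x - b))"
proof -
  define S T where "S = convex hull (insert a K)" and "T = convex hull (insert b K)"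
  have fin: "finite K" using bary_finite[OF b1] by simp
  have cS: "compact S" "compact T" using fin by (auto simp: S_def T_def finite_imp_compact_convex_hull)
  obtain c n where n: "\<And>x. m b x = c + n \<bullet> x" using bary_affine[OF b2, of b] by blast
  \<comment> \<open>Fixes the hyperplane of K pointwise and sends b to a.\<close>
  define A where "A x = x + m b x *\<^sub>R (a - b)" for x
  define L where "L x = x + (n \<bullet> x) *\<^sub>R (a - b)" for x
  have AL: "A x = c *\<^sub>R (a - b) + L x" for x by (simp add: A_def L_def n algebra_simps)
  have lin: "linear L" unfolding L_def by (intro linearI) (auto simp: inner_add_right algebra_simps)
  have diffA: "A x - A y = L (x - y)" for x y using lin by (simp add: AL linear_diff)
  \<comment> \<open>A preserves barycentric coordinates, with a in the role of b; injectivity of L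
    and A x \<in> S \<longleftrightarrow> x \<in> T follow.\<close>
  have lA: "l v (A x) = (if v = a then m b x else m v x)" if "v \<in> insert a K" for v x
  proof -
    let ?u = "\<lambda>v. if v = a then m b x else m v x"
    have K: "(\<Sum>w\<in>K. ?u w) = (\<Sum>w\<in>K. m w x)" "(\<Sum>w\<in>K. ?u w *\<^sub>R w) = (\<Sum>w\<in>K. m w x *\<^sub>R w)"
      using nin by (auto intro!: sum.cong)
    have "m b x + (\<Sum>w\<in>K. m w x) = 1" "m b x *\<^sub>R b + (\<Sum>w\<in>K. m w x *\<^sub>R w) = x"
      using bary_sum[OF b2, of x] bary_rep[OF b2, of x] fin nin by auto
    then have "(\<Sum>w\<in>insert a K. ?u w) = 1" "(\<Sum>w\<in>insert a K. ?u w *\<^sub>R w) = A x"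
      using fin nin K by (auto simp: A_def algebra_simps)
    then show ?thesis using bary_unique[OF b1, of ?u "A x" v] that by simp
  qed
  have inj: "inj L"
  proof (rule injI)
    fix x y assume "L x = L y"
    then have "A x = A y" by (simp add: AL)
    then have "m b x = m b y" using lA[of a x] lA[of a y] by simp
    moreover have "m v x = m v y" if "v \<in> K" for v
      using \<open>A x = A y\<close> lA[of v x] lA[of v y] that nin by (cases "v = a") auto
    ultimately have "(\<Sum>v\<in>insert b K. m v x *\<^sub>R v) = (\<Sum>v\<in>insert b K. m v y *\<^sub>R v)"
      by (intro sum.cong) auto
    then show "x = y" by (simp only: bary_rep[OF b2])
  qed
  obtain k where k0: "k > 0" and k1: "\<forall>f::real^'d \<Rightarrow> real. f \<in> borel_measurable borel \<longrightarrow>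
      (LINT x|lborel. f (c *\<^sub>R (a - b) + L x)) = k * (LINT x|lborel. f x)"
    using integral_affine_change[OF lin inj, of "c *\<^sub>R (a - b)"] by blast
  note k = k0 k1[rule_format]
  have AST: "A x \<in> S \<longleftrightarrow> x \<in> T" for x
    using lA[of _ x] nin unfolding S_def T_def bary_hull[OF b1] bary_hull[OF b2] by auto
  have Ab: "A b = a" using bary_vertex[OF b2, of b b] by (simp add: A_def)
  have "(LINT x:S|lborel. CARD('d) * \<psi> x + G x \<bullet> (x - a)) = (1 / k) * (LINT x:T|lborel. CARD('d) * \<psi> x + G x \<bullet> (x - b))"
    if d: "\<forall>x. (\<psi> has_derivative (\<lambda>h. G x \<bullet> h)) (at x)" and G: "continuous_on UNIV G" for \<psi> :: "real^'d \<Rightarrow> real" and G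
  proof -
    have c\<psi>: "continuous_on UNIV \<psi>" by (rule has_derivative_continuous_on[OF d[rule_format]])
    have cm: "continuous_on UNIV (m b)" by (rule bary_continuous[OF b2])
    have cA: "continuous_on UNIV A" unfolding A_def using cm by (intro continuous_intros)
    define F where "F x = CARD('d) * \<psi> x + G x \<bullet> (x - a)" for x
    have cF: "continuous_on UNIV F" unfolding F_def using c\<psi> G by (intro continuous_intros)
    define \<psi>' where "\<psi>' x = \<psi> (A x)" for x
    \<comment> \<open>Chain rule: the transpose of L applied to G at A x.\<close>
    define G' where "G' x = G (A x) + (G (A x) \<bullet> (a - b)) *\<^sub>R n" for x
    have G'L: "G' x \<bullet> h = G (A x) \<bullet> L h" for x h by (simp add: G'_def L_def inner_add_left inner_add_right mult.commute)
    have cGA: "continuous_on UNIV (\<lambda>x. G (A x))" using G cA by (rule continuous_on_compose2) auto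
    have cG': "continuous_on UNIV G'" unfolding G'_def using cGA by (intro continuous_intros)
    have dA: "(A has_derivative L) (at x)" for x
      unfolding AL[abs_def] using lin
      by (intro has_derivative_add_const has_derivative_eq_rhs[OF has_derivative_add[OF has_derivative_const linear_imp_has_derivative]]) auto
    have d': "(\<psi>' has_derivative (\<lambda>h. G' x \<bullet> h)) (at x)" for x
      unfolding G'L \<psi>'_def by (rule has_derivative_compose[OF dA d[rule_format]])
    \<comment> \<open>\<psi> after A and \<psi> agree on the common facet, so their difference
      satisfies the hypothesis of the cone identity on T.\<close>
    have "(LINT x:T|lborel. CARD('d) * (\<psi>' x - \<psi> x) + (G' x - G x) \<bullet> (x - b)) = 0"
      unfolding T_def
    proof (rule cone_divergence_simplex[OF b2])
      show "((\<lambda>x. \<psi>' x - \<psi> x) has_derivative (\<lambda>h. (G' x - G x) \<bullet> h)) (at x)" for x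
        using has_derivative_diff[OF d' d[rule_format]] by (simp add: inner_diff_left)
      show "\<psi>' x - \<psi> x = 0" if "x \<in> convex hull (insert b K - {b})" for x
        using bary_opposite_facet[OF b2 _ that] by (simp add: \<psi>'_def A_def)
    qed (use G cG' in \<open>auto intro: continuous_intros\<close>)
    moreover have "set_integrable lborel T (\<lambda>x. CARD('d) * \<psi>' x + G' x \<bullet> (x - b))" "set_integrable lborel T (\<lambda>x. CARD('d) * \<psi> x + G x \<bullet> (x - b))"
      using has_derivative_continuous_on[OF d'] cG' c\<psi> G
      by (auto intro!: continuous_set_integrable_lborel cS continuous_intros)
    ultimately have eq: "(LINT x:T|lborel. CARD('d) * \<psi>' x + G' x \<bullet> (x - b)) = (LINT x:T|lborel. CARD('d) * \<psi> x + G x \<bullet> (x - b))"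
      using set_integral_diff(2)[of lborel T "\<lambda>x. CARD('d) * \<psi>' x + G' x \<bullet> (x - b)" "\<lambda>x. CARD('d) * \<psi> x + G x \<bullet> (x - b)"]
      by (simp add: algebra_simps inner_diff_left)
    have FA: "F (A x) = CARD('d) * \<psi>' x + G' x \<bullet> (x - b)" for x
      unfolding G'L diffA[symmetric] Ab by (simp add: F_def \<psi>'_def)
    define f where "f x = indicator S x * F x" for x
    have f: "f \<in> borel_measurable borel" unfolding f_def using cS cF
      by (intro borel_measurable_times borel_measurable_indicator borel_measurable_continuous_onI) (auto simp: compact_imp_closed)
    have "(LINT x|lborel. f (A x)) = k * (LINT x|lborel. f x)" unfolding AL using k(2)[OF f] .
    moreover have "(\<lambda>x. f (A x)) = (\<lambda>x. indicator T x * F (A x))" using AST by (simp add: f_def indicator_def)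
    ultimately have "(LINT x|lborel. indicator T x * F (A x)) = k * (LINT x|lborel. indicator S x * F x)"
      by (simp only: f_def)
    then have "(LINT x:T|lborel. F (A x)) = k * (LINT x:S|lborel. F x)"
      by (simp add: set_lebesgue_integral_def)
    then show ?thesis using k(1) unfolding FA eq by (simp add: F_def field_simps)
  qed
  then show ?thesis using k(1) unfolding S_def T_def by (intro exI[of _ "1 / k"]) auto
qed

lemma continuous_AE_zero_open:
  fixes f :: "real^'d \<Rightarrow> real"
  assumes "open U" "continuous_on UNIV f" "AE x\<in>U in lebesgue. f x = 0" "x \<in> U"
  shows "f x = 0"
proof (rule ccontr)
  assume "f x \<noteq> 0"
  define V where "V = U \<inter> f -` (- {0})"
  have "open V" unfolding V_def using assms by (intro open_Int open_vimage) auto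
  moreover have "x \<in> V" using assms \<open>f x \<noteq> 0\<close> by (simp add: V_def)
  ultimately have "\<not> negligible V" by (intro open_not_negligible) auto
  moreover have "AE x in lebesgue. x \<notin> V" using assms(3) by eventually_elim (auto simp: V_def)
  then have "negligible V"
    using AE_iff_null_sets[of V lebesgue] \<open>open V\<close> by (simp add: negligible_iff_null_sets)
  ultimately show False by simp
qed

section \<open>The multiplier: a function orthogonal to all Raviart-Thomas divergences\<close>

context meshed_domain
begin

context
  fixes p z
  assumes z: "z \<in> X_space \<Omega> \<T> p"
    and orth: "\<And>\<tau>. \<tau> \<in> RT_space \<Omega> \<T> p \<Longrightarrow> L2_inner \<Omega> (weak_div \<Omega> \<tau>) z = 0"
begin

lemma multiplier_polys:
  obtains Z where "\<And>T. T \<in> \<T> \<Longrightarrow> Z T \<in> poly_space p" "\<And>T. T \<in> \<T> \<Longrightarrow> AE x\<in>T in lebesgue. z x = Z T x"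
proof -
  have "\<forall>T\<in>\<T>. \<exists>P. P \<in> poly_space p \<and> (AE x\<in>T in lebesgue. z x = P x)" using z by (auto simp: X_space_def)
  then obtain Z where "\<forall>T\<in>\<T>. Z T \<in> poly_space p \<and> (AE x\<in>T in lebesgue. z x = Z T x)" by (rule bchoice[THEN exE])
  then show ?thesis by (intro that) auto
qed

text \<open>The field Q(x) (x - v) on T, extended by zero, has no flux through the boundary: it is
  tangential to the facets through v and zero on the opposite one. So its divergence is orthogonal
  to z, and integrating by parts against P moves the derivative onto P.\<close>

lemma bubble_orthogonal:
  assumes T: "T \<in> \<T>" and C: "barycentric C l" "T = convex hull C" and v: "v \<in> C"
    and Q: "Q \<in> poly_space p" "\<And>x. x \<in> convex hull (C - {v}) \<Longrightarrow> Q x = 0"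
    and P: "P \<in> poly_space p" "AE x\<in>T in lebesgue. z x = P x"
    and g: "\<And>x. (P has_derivative (\<lambda>h. g x \<bullet> h)) (at x)" "continuous_on UNIV g"
  shows "(LINT x:T|lborel. Q x * (g x \<bullet> (x - v))) = 0"
proof -
  obtain Z where Z: "\<And>T. T \<in> \<T> \<Longrightarrow> Z T \<in> poly_space p" "\<And>T. T \<in> \<T> \<Longrightarrow> AE x\<in>T in lebesgue. z x = Z T x"
    by (rule multiplier_polys) (rule that)
  obtain H where H: "\<And>x. (Q has_derivative (\<lambda>h. H x \<bullet> h)) (at x)" "continuous_on UNIV H"
    by (rule poly_space_C1E[OF Q(1)]) (rule that)
  note cQ = poly_space_continuous[OF Q(1)] and cP = poly_space_continuous[OF P(1)]
  define R where "R U = (if U = T then \<lambda>x. Q x *\<^sub>R (x - v) else (\<lambda>x. 0))" for U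
  define D where "D U = (if U = T then \<lambda>x. CARD('d) * Q x + H x \<bullet> (x - v) else (\<lambda>x. 0))" for U
  \<comment> \<open>On T the prescribed polynomial P replaces the arbitrarily chosen one.\<close>
  define Y where "Y = Z(T := P)"
  \<comment> \<open>Used twice: with a test function it verifies the weak divergence, with P it is
    the final integration by parts.\<close>
  have div0: "(LINT x:T|lborel. CARD('d) * (Q x * \<psi> x) + (Q x *\<^sub>R \<psi>' x + \<psi> x *\<^sub>R H x) \<bullet> (x - v)) = 0"
    if d: "\<And>x. (\<psi> has_derivative (\<lambda>h. \<psi>' x \<bullet> h)) (at x)" and c: "continuous_on UNIV \<psi>'" for \<psi> \<psi>'
    unfolding C(2)
  proof (rule cone_divergence_simplex[OF C(1) v])
    show "((\<lambda>x. Q x * \<psi> x) has_derivative (\<lambda>h. (Q x *\<^sub>R \<psi>' x + \<psi> x *\<^sub>R H x) \<bullet> h)) (at x)" for x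
      using has_derivative_mult[OF H(1)[of x] d[of x]] by (simp add: inner_add_left mult.commute)
    show "continuous_on UNIV (\<lambda>x. Q x *\<^sub>R \<psi>' x + \<psi> x *\<^sub>R H x)"
      using cQ c H(2) has_derivative_continuous_on[OF d] by (intro continuous_intros)
  qed (use Q(2) in simp)
  have "(\<Sum>U\<in>\<T>. LINT x:U|lborel. D U x * Y U x) = 0"
  proof (rule pw_orthogonal[OF _ _ _ z orth])
    show "R U \<in> RT_local p" for U using cone_field_RT_local[OF Q(1)] by (simp add: R_def zero_RT_local)
    show "continuous_on UNIV (D U)" for U using cQ H(2) by (auto simp: D_def intro!: continuous_intros)
    show "Y U \<in> poly_space p" "AE x\<in>U in lebesgue. z x = Y U x" if "U \<in> \<T>" for U
      using Z[OF that] P by (auto simp: Y_def)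
    fix \<phi> assume \<phi>: "\<phi> \<in> test_functions \<Omega>"
    have d: "(\<phi> has_derivative (\<lambda>h. grad \<phi> x \<bullet> h)) (at x)" and c: "continuous_on UNIV (grad \<phi>)" for x
      by (rule test_functionE[OF \<phi>], assumption)+
    have "(LINT x:U|lborel. R U x \<bullet> grad \<phi> x + D U x * \<phi> x) = 0" for U
    proof (cases "U = T")
      case True
      have "(\<lambda>x. R T x \<bullet> grad \<phi> x + D T x * \<phi> x) = (\<lambda>x. CARD('d) * (Q x * \<phi> x) + (Q x *\<^sub>R grad \<phi> x + \<phi> x *\<^sub>R H x) \<bullet> (x - v))"
        by (simp add: R_def D_def fun_eq_iff inner_add_left inner_commute algebra_simps)
      then show ?thesis using div0[OF d c] True by simp
    qed (simp add: R_def D_def)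
    then show "(\<Sum>U\<in>\<T>. LINT x:U|lborel. R U x \<bullet> grad \<phi> x + D U x * \<phi> x) = 0" by simp
  qed
  also have "(\<Sum>U\<in>\<T>. LINT x:U|lborel. D U x * Y U x) = (\<Sum>U\<in>\<T>. if T = U then LINT x:T|lborel. D T x * P x else 0)"
    by (intro sum.cong) (auto simp: D_def Y_def)
  finally have 1: "(LINT x:T|lborel. (CARD('d) * Q x + H x \<bullet> (x - v)) * P x) = 0"
    using T mesh_finite by (simp add: D_def)
  have cT: "compact T" by (rule mesh_element(1)[OF mesh T])
  have i: "set_integrable lborel T (\<lambda>x. (CARD('d) * Q x + H x \<bullet> (x - v)) * P x)"
    "set_integrable lborel T (\<lambda>x. Q x * (g x \<bullet> (x - v)))"
    using cQ cP H(2) g(2) by (auto intro!: continuous_set_integrable_lborel[OF cT] continuous_intros)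
  have "(LINT x:T|lborel. (CARD('d) * Q x + H x \<bullet> (x - v)) * P x + Q x * (g x \<bullet> (x - v))) = 0"
    using div0[OF g] by (simp add: inner_add_left algebra_simps)
  then show ?thesis using set_integral_add(2)[OF i] 1 by simp
qed

text \<open>With \<open>g\<close> the gradient of the multiplier and barycentric coordinates \<open>l\<close>, the bubble fields are weighted so that
  their pairing with \<open>g\<close> is the variance \<open>\<Sum>v. l v x (g \<bullet> (v - x))\<^sup>2\<close>.\<close>

lemma multiplier_piecewise_constant:
  assumes T: "T \<in> \<T>" shows "\<exists>c. AE x\<in>T in lebesgue. z x = c"
proof -
  obtain P where P: "P \<in> poly_space p" "AE x\<in>T in lebesgue. z x = P x" using z T by (auto simp: X_space_def)
  have "\<exists>c. P = (\<lambda>x. c)"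
  proof (cases "p = 0")
    case True
    then show ?thesis using P poly_space_0 by blast
  next
    case False
    obtain g where g: "\<And>x. (P has_derivative (\<lambda>h. g x \<bullet> h)) (at x)" "\<And>i. (\<lambda>x. g x $ i) \<in> poly_space (p - 1)"
      "continuous_on UNIV g" by (rule poly_space_C1E[OF P(1)]) (rule that)
    obtain C l where C: "barycentric C l" "T = convex hull C" by (rule mesh_simplex[OF mesh T])
    have fin: "finite C" by (rule bary_finite[OF C(1)])
    \<comment> \<open>An affine coordinate times a component of the gradient, hence degree p; for p
      = 0 the gradient has no degree to spare, which explains the case split.\<close>
    define Q where "Q v x = l v x * (- (g x \<bullet> v))" for v x
    have Qp: "Q v \<in> poly_space p" for v
    proof -
      obtain c n where n: "\<And>x. l v x = c + n \<bullet> x" using bary_affine[OF C(1), of v] by blast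
      have "(\<lambda>x. \<Sum>i\<in>UNIV. (- (v $ i)) * g x $ i) \<in> poly_space (p - 1)"
        using g(2) by (intro poly_space_sum poly_space_cmult)
      then have "(\<lambda>x. - (g x \<bullet> v)) \<in> poly_space (p - 1)" by (simp add: inner_vec_def sum_negf mult.commute)
      from poly_space_mult_affine[OF this, of c n] show ?thesis using False by (simp add: Q_def[abs_def] n)
    qed
    have cQ: "continuous_on UNIV (Q v)" for v by (rule poly_space_continuous[OF Qp])
    have cT: "compact T" by (rule mesh_element(1)[OF mesh T])
    have b0: "(LINT x:T|lborel. Q v x * (g x \<bullet> (x - v))) = 0" if "v \<in> C" for v
      by (rule bubble_orthogonal[OF T C that Qp _ P g(1,3)])
        (simp add: Q_def bary_opposite_facet[OF C(1) that])
    define f where "f x = (\<Sum>v\<in>C. l v x * (g x \<bullet> (v - x))\<^sup>2)" for x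
    have fQ: "(\<Sum>v\<in>C. Q v x * (g x \<bullet> (x - v))) = f x" for x
    proof -
      \<comment> \<open>The mean of g . (v - x) with weights \<open>l v x\<close> is zero, so
        replacing g . v by g . (v - x) in one factor does not change the sum.\<close>
      have 1: "(\<Sum>v\<in>C. l v x * (g x \<bullet> (v - x))) = 0"
      proof -
        have "(\<Sum>v\<in>C. l v x * (g x \<bullet> (v - x))) = g x \<bullet> (\<Sum>v\<in>C. l v x *\<^sub>R v) - (\<Sum>v\<in>C. l v x) * (g x \<bullet> x)"
          by (simp add: inner_diff_right inner_sum_right right_diff_distrib sum_subtractf sum_distrib_right)
        then show ?thesis by (simp add: bary_rep[OF C(1)] bary_sum[OF C(1)])
      qed
      have "Q v x * (g x \<bullet> (x - v)) = l v x * (g x \<bullet> (v - x))\<^sup>2 + (g x \<bullet> x) * (l v x * (g x \<bullet> (v - x)))" for v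
        by (simp add: Q_def inner_diff_right power2_eq_square algebra_simps)
      then have "(\<Sum>v\<in>C. Q v x * (g x \<bullet> (x - v))) = f x + (g x \<bullet> x) * (\<Sum>v\<in>C. l v x * (g x \<bullet> (v - x)))"
        by (simp add: f_def sum.distrib sum_distrib_left)
      then show ?thesis using 1 by simp
    qed
    have cf: "continuous_on UNIV f" unfolding f_def using g(3) bary_continuous[OF C(1)] by (intro continuous_intros) auto
    have int0: "(LINT x:T|lborel. f x) = 0"
    proof -
      have "set_integrable lborel T (\<lambda>x. Q v x * (g x \<bullet> (x - v)))" for v
        using cQ g(3) by (intro continuous_set_integrable_lborel[OF cT] continuous_intros)
      then have "(LINT x:T|lborel. \<Sum>v\<in>C. Q v x * (g x \<bullet> (x - v))) = (\<Sum>v\<in>C. LINT x:T|lborel. Q v x * (g x \<bullet> (x - v)))"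
        unfolding set_lebesgue_integral_def set_integrable_def by (simp add: sum_distrib_left)
      then show ?thesis using b0 fQ by simp
    qed
    have f0: "f x \<ge> 0" if "x \<in> T" for x
      using that unfolding f_def C(2) bary_hull[OF C(1)] by (intro sum_nonneg mult_nonneg_nonneg) auto
    have intT: "(LINT x|lebesgue. indicator (interior T) x *\<^sub>R f x) = 0"
      "integrable lebesgue (\<lambda>x. indicator (interior T) x *\<^sub>R f x)"
      using mesh_integral_bridge[OF T cf] int0 by auto
    have "indicator (interior T) x *\<^sub>R f x \<ge> 0" for x
      using f0[of x] interior_subset[of T] by (auto simp: indicator_def)
    then have "AE x in lebesgue. indicator (interior T) x *\<^sub>R f x = 0"
      using integral_nonneg_eq_0_iff_AE[OF intT(2)] intT(1) by simp
    then have "AE x\<in>interior T in lebesgue. f x = 0" by eventually_elim auto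
    then have fz: "f x = 0" if "x \<in> interior T" for x
      using continuous_AE_zero_open[OF open_interior cf _ that] by blast
    define U where "U = {x. \<forall>v\<in>C. 0 < l v x}"
    have g0: "g x = 0" if x: "x \<in> U" for x
    proof -
      have "f x = 0" using fz x bary_interior[OF C(1)] C(2) by (auto simp: U_def)
      then have "\<forall>v\<in>C. l v x * (g x \<bullet> (v - x))\<^sup>2 = 0"
        unfolding f_def using x fin by (subst (asm) sum_nonneg_eq_0_iff) (auto simp: U_def less_imp_le)
      \<comment> \<open>Zero variance with positive weights: g has the same product with all
        vertices, and hence with every point.\<close>
      then have gv: "g x \<bullet> v = g x \<bullet> x" if "v \<in> C" for v using x that by (force simp: U_def inner_diff_right)
      have "g x \<bullet> y = g x \<bullet> x" for y
      proof -
        have "g x \<bullet> y = g x \<bullet> (\<Sum>v\<in>C. l v y *\<^sub>R v)" by (simp add: bary_rep[OF C(1)])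
        also have "\<dots> = (\<Sum>v\<in>C. l v y * (g x \<bullet> x))" using gv by (simp add: inner_sum_right)
        also have "\<dots> = g x \<bullet> x" by (simp add: sum_distrib_right[symmetric] bary_sum[OF C(1)])
        finally show ?thesis .
      qed
      \<comment> \<open>The point 0 gives g . x = 0, and the point g itself then gives |g|^2 =
        0.\<close>
      from this[of 0] this[of "g x"] show ?thesis by simp
    qed
    obtain x0 where x0: "x0 \<in> U"
    proof -
      have c: "card C > 0" using bary_card[OF C(1)] by simp
      have "l v (\<Sum>v\<in>C. (1 / real (card C)) *\<^sub>R v) = 1 / real (card C)" if "v \<in> C" for v
        by (rule bary_unique[OF C(1) _ refl that]) (use c in auto)
      then have "(\<Sum>v\<in>C. (1 / real (card C)) *\<^sub>R v) \<in> U" using c by (simp add: U_def)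
      then show ?thesis by (rule that)
    qed
    have "g x $ i = 0" for x i
      by (rule rpf_zero_on_open[OF poly_space_imp_rpf[OF g(2)] _ x0]) (use g0 bary_open[OF C(1)] in \<open>auto simp: U_def\<close>)
    then have "g x = 0" for x by (simp add: vec_eq_iff)
    then have "\<bar>P x - P 0\<bar> \<le> 0 * norm (x - 0)" for x
      by (intro lipschitz_of_grad_bound[OF convex_UNIV g(1)]) auto
    then show ?thesis by (intro exI[of _ "P 0"]) (simp add: fun_eq_iff)
  qed
  then show ?thesis using P(2) by auto
qed

text \<open>The factor k from \<open>cone_compare\<close> makes the fluxes of x - a and of - k (x -
  b) cancel on the common facet, while both fields are tangential to the remaining facets of their
  simplices. Pairing with z gives c |S| = k d |T|, and constant \<psi> gives |S| = k |T|.\<close>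

lemma multiplier_facet_eq:
  assumes S: "S \<in> \<T>" and T: "T \<in> \<T>" and facet: "aff_dim (S \<inter> T) = int CARD('d) - 1"
    and c: "AE x\<in>S in lebesgue. z x = c" and d: "AE x\<in>T in lebesgue. z x = d"
  shows "c = d"
proof -
  obtain K a b l m where K: "barycentric (insert a K) l" "barycentric (insert b K) m" "a \<notin> K" "b \<notin> K"
    "S = convex hull (insert a K)" "T = convex hull (insert b K)" "S \<inter> T = convex hull K"
    by (rule mesh_shared_facet[OF mesh S T facet])
  have ST: "S \<noteq> T"
  proof
    assume "S = T"
    moreover have "int CARD('d) simplex T" using mesh T by (auto simp: simplicial_mesh_def)
    ultimately show False using facet aff_dim_simplex by force
  qed
  obtain k where k0: "k > 0" and k1: "\<forall>(\<psi> :: real^'d \<Rightarrow> real) G. (\<forall>x. (\<psi> has_derivative (\<lambda>h. G x \<bullet> h)) (at x)) \<longrightarrow> continuous_on UNIV G \<longrightarrow>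
     (LINT x:S|lborel. CARD('d) * \<psi> x + G x \<bullet> (x - a)) = k * (LINT x:T|lborel. CARD('d) * \<psi> x + G x \<bullet> (x - b))"
    using cone_compare[OF K(1-4)] unfolding K(5,6) by blast
  note k = k0 k1[rule_format]
  obtain Z where Z: "\<And>T. T \<in> \<T> \<Longrightarrow> Z T \<in> poly_space p" "\<And>T. T \<in> \<T> \<Longrightarrow> AE x\<in>T in lebesgue. z x = Z T x"
    by (rule multiplier_polys) (rule that)
  define R where "R U = (if U = S then \<lambda>x. 1 *\<^sub>R (x - a) else if U = T then \<lambda>x. (- k) *\<^sub>R (x - b) else (\<lambda>x. 0))" for U
  define D where "D U = (\<lambda>x::real^'d. if U = S then real CARD('d) else if U = T then - k * CARD('d) else 0)" for U
  define Y where "Y = Z(S := \<lambda>x. c, T := \<lambda>x. d)"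
  have split: "(\<Sum>U\<in>\<T>. h U) = h S + h T" if "\<And>U. U \<noteq> S \<Longrightarrow> U \<noteq> T \<Longrightarrow> h U = 0" for h :: "(real^'d) set \<Rightarrow> real"
  proof -
    have "(\<Sum>U\<in>\<T>. h U) = (\<Sum>U\<in>{S, T}. h U)"
      using S T mesh_finite that by (intro sum.mono_neutral_right) auto
    then show ?thesis using ST by simp
  qed
  have "(\<Sum>U\<in>\<T>. LINT x:U|lborel. D U x * Y U x) = 0"
  proof (rule pw_orthogonal[OF _ _ _ z orth])
    show "R U \<in> RT_local p" for U
      by (simp add: R_def zero_RT_local cone_field_RT_local[OF poly_space_const[of 1 p]]
          cone_field_RT_local[OF poly_space_const[of "- k" p]] del: scaleR_minus_left scaleR_one)
    show "continuous_on UNIV (D U)" for U by (auto simp: D_def)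
    show "Y U \<in> poly_space p" "AE x\<in>U in lebesgue. z x = Y U x" if "U \<in> \<T>" for U
      using Z[OF that] c d poly_space_const by (auto simp: Y_def)
    fix \<phi> assume \<phi>: "\<phi> \<in> test_functions \<Omega>"
    have dd: "(\<phi> has_derivative (\<lambda>h. grad \<phi> x \<bullet> h)) (at x)" and cc: "continuous_on UNIV (grad \<phi>)" for x
      by (rule test_functionE[OF \<phi>], assumption)+
    have "(\<Sum>U\<in>\<T>. LINT x:U|lborel. R U x \<bullet> grad \<phi> x + D U x * \<phi> x) =
       (LINT x:S|lborel. R S x \<bullet> grad \<phi> x + D S x * \<phi> x) + (LINT x:T|lborel. R T x \<bullet> grad \<phi> x + D T x * \<phi> x)"
      by (rule split) (simp add: R_def D_def)
    also have "(LINT x:S|lborel. R S x \<bullet> grad \<phi> x + D S x * \<phi> x) = (LINT x:S|lborel. CARD('d) * \<phi> x + grad \<phi> x \<bullet> (x - a))"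
      by (simp add: R_def D_def inner_commute add.commute)
    also have "(\<lambda>x. R T x \<bullet> grad \<phi> x + D T x * \<phi> x) = (\<lambda>x. (- k) * (CARD('d) * \<phi> x + grad \<phi> x \<bullet> (x - b)))"
      using ST by (auto simp: R_def D_def inner_commute algebra_simps)
    also have "(LINT x:T|lborel. (- k) * (CARD('d) * \<phi> x + grad \<phi> x \<bullet> (x - b))) = (- k) * (LINT x:T|lborel. CARD('d) * \<phi> x + grad \<phi> x \<bullet> (x - b))"
      by (rule set_integral_mult_right)
    finally show "(\<Sum>U\<in>\<T>. LINT x:U|lborel. R U x \<bullet> grad \<phi> x + D U x * \<phi> x) = 0"
      using k(2)[of \<phi> "grad \<phi>"] dd cc by simp
  qed
  also have "(\<Sum>U\<in>\<T>. LINT x:U|lborel. D U x * Y U x) = (LINT x:S|lborel. D S x * Y S x) + (LINT x:T|lborel. D T x * Y T x)"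
    by (rule split) (simp add: D_def)
  also have "(LINT x:S|lborel. D S x * Y S x) = CARD('d) * c * (LINT x:S|lborel. 1)"
    using ST set_integral_mult_right[of lborel S "CARD('d) * c" "\<lambda>x. 1"] by (simp add: D_def Y_def)
  also have "(LINT x:T|lborel. D T x * Y T x) = - k * CARD('d) * d * (LINT x:T|lborel. 1)"
    using ST set_integral_mult_right[of lborel T "- k * CARD('d) * d" "\<lambda>x. 1"] by (simp add: D_def Y_def)
  finally have 1: "CARD('d) * c * (LINT x:S|lborel. 1) - k * CARD('d) * d * (LINT x:T|lborel. 1) = 0" by simp
  \<comment> \<open>\<open>cone_compare\<close> for the constant function 1 computes the ratio of
    the volumes.\<close>
  have "(LINT x:S|lborel. real CARD('d) * 1 + 0 \<bullet> (x - a)) = k * (LINT x:T|lborel. real CARD('d) * 1 + 0 \<bullet> (x - b))"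
    by (rule k(2)) (auto intro!: has_derivative_eq_rhs[OF has_derivative_const] simp: fun_eq_iff)
  then have "(LINT x:S|lborel. 1 * real CARD('d)) = k * (LINT x:T|lborel. 1 * real CARD('d))" by simp
  then have 2: "(LINT x:S|lborel. 1::real) = k * (LINT x:T|lborel. 1)"
    unfolding set_integral_mult_left by simp
  have "(LINT x:S|lborel. 1::real) > 0"
  proof -
    have "\<not> negligible S" using mesh_element(3)[OF mesh S] open_not_negligible[of "interior S"] negligible_subset interior_subset by blast
    then have "measure lebesgue S \<noteq> 0" using mesh_element(1)[OF mesh S]
      by (metis lmeasurable_compact negligible_iff_measure)
    moreover have "(LINT x:S|lborel. 1::real) = measure lborel S"
      using mesh_element(1)[OF mesh S] by (simp add: set_lebesgue_integral_def compact_imp_closed)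
    ultimately show ?thesis using mesh_element(1)[OF mesh S] measure_nonneg[of lborel S]
      by (simp add: compact_imp_closed less_le)
  qed
  moreover have "CARD('d) * (c - d) * (LINT x:S|lborel. 1) = 0" using 1 unfolding 2 by (simp add: algebra_simps)
  ultimately show ?thesis by simp
qed

text \<open>Facet connectivity makes the local constants agree throughout the mesh. The global field
  x has constant divergence d, so orthogonality gives d c |\<Omega>| = 0 for the common value
  c.\<close>

lemma multiplier_zero: "AE x\<in>\<Omega> in lebesgue. z x = 0"
proof (cases "\<T> = {}")
  case True
  then show ?thesis using mesh_cover by auto
next
  case False
  then obtain T0 where T0: "T0 \<in> \<T>" by blast
  obtain c where c: "\<And>T. T \<in> \<T> \<Longrightarrow> AE x\<in>T in lebesgue. z x = c T"
    using multiplier_piecewise_constant by metis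
  define \<U> where "\<U> = {T\<in>\<T>. c T = c T0}"
  have "\<T> - \<U> = {}"
  proof (rule ccontr)
    assume "\<T> - \<U> \<noteq> {}"
    moreover have "\<T> = \<U> \<union> (\<T> - \<U>)" "\<U> \<noteq> {}" using T0 by (auto simp: \<U>_def)
    ultimately obtain S T where ST: "S \<in> \<U>" "T \<in> \<T> - \<U>" "aff_dim (S \<inter> T) = int CARD('d) - 1"
      using mesh_facet_connected[OF open_dom connected_dom mesh, of \<U> "\<T> - \<U>"] by blast
    then have "c S = c T" using multiplier_facet_eq[OF _ _ ST(3) c c] by (auto simp: \<U>_def)
    then show False using ST by (auto simp: \<U>_def)
  qed
  then have zc: "AE x\<in>\<Omega> in lebesgue. z x = c T0"
  proof (intro mesh_AE)
    fix T assume T: "T \<in> \<T>"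
    then have "c T = c T0" using \<open>\<T> - \<U> = {}\<close> by (auto simp: \<U>_def)
    then show "AE x\<in>interior T in lebesgue. z x = c T0"
      using c[OF T] by eventually_elim (use interior_subset[of T] \<open>c T = c T0\<close> in auto)
  qed
  have zL: "z \<in> L2_space \<Omega>" using z by (simp add: X_space_def)
  have m: "\<Omega> \<in> sets lebesgue" using open_dom by simp
  have L2: "(\<lambda>x. x) \<in> L2_space \<Omega>" "(\<lambda>x::real^'d. e::real) \<in> L2_space \<Omega>" for e
    by (auto intro!: L2_continuous_bounded bounded_dom m)
  have wd: "has_weak_div \<Omega> (\<lambda>x. x) (\<lambda>x. CARD('d))"
    unfolding has_weak_div_alt
  proof (intro conjI ballI)
    show "locally_integrable \<Omega> (\<lambda>x. x)" "locally_integrable \<Omega> (\<lambda>x. real CARD('d))"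
      using L2 L2_locally_integrable by blast+
    fix \<phi> assume \<phi>: "\<phi> \<in> test_functions \<Omega>"
    have "((\<lambda>x. x $ i) has_derivative (\<lambda>h. axis i 1 \<bullet> h)) (at x)" for i and x :: "real^'d"
      using bounded_linear.has_derivative[OF bounded_linear_vec_nth has_derivative_ident] by (simp add: inner_axis')
    from test_divergence_by_parts[OF this continuous_on_const \<phi>]
    show "(LINT x|lebesgue. x \<bullet> grad \<phi> x) = - (LINT x|lebesgue. CARD('d) * \<phi> x)" by simp
  qed
  then have RT: "(\<lambda>x. x) \<in> RT_space \<Omega> \<T> p"
    using L2 cone_field_RT_local[OF poly_space_const[of 1 p], of 0]
    by (auto simp: RT_space_def Hdiv_space_def intro!: bexI[of _ "\<lambda>x. x"])
  then have hd: "(\<lambda>x. x) \<in> Hdiv_space \<Omega>" by (simp add: RT_space_def)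
  have "AE x\<in>\<Omega> in lebesgue. weak_div \<Omega> (\<lambda>x. x) x = CARD('d)"
    by (rule weak_div_unique[OF open_dom Hdiv_weak_div(1)[OF open_dom hd] wd])
  then have "L2_inner \<Omega> (weak_div \<Omega> (\<lambda>x. x)) z = L2_inner \<Omega> (\<lambda>x. CARD('d)) (\<lambda>x. c T0)"
    by (intro L2_inner_AE_cong Hdiv_weak_div(2)[OF open_dom hd] zL zc) auto
  then have "L2_inner \<Omega> (\<lambda>x. real CARD('d)) (\<lambda>x. c T0) = 0" using orth[OF RT] by simp
  then have "(LINT x:\<Omega>|lebesgue. CARD('d) * c T0) = 0" by (simp add: L2_inner_def)
  \<comment> \<open>Rescaling by c / d turns the equation into a vanishing squared norm of the
    constant.\<close>
  then have "(LINT x:\<Omega>|lebesgue. (c T0 / CARD('d)) * (CARD('d) * c T0)) = 0"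
    unfolding set_integral_mult_right by simp
  then have "L2_inner \<Omega> (\<lambda>x. c T0) (\<lambda>x. c T0) = 0" by (simp add: L2_inner_def)
  then have "AE x\<in>\<Omega> in lebesgue. c T0 = 0" using L2_inner_self_zero[OF L2(2)] by blast
  then show ?thesis using zc by eventually_elim auto
qed

end

end

section \<open>Unique continuation across a facet\<close>

lemma rpf_C1:
  fixes P :: "real^'d \<Rightarrow> real"
  assumes "real_polynomial_function P"
  shows "\<exists>G. (\<forall>x. (P has_derivative (\<lambda>h. G x \<bullet> h)) (at x)) \<and> continuous_on UNIV G"
  using assms
proof (induction)
  case (linear f)
  have "f h = adjoint f 1 \<bullet> h" for h
    using adjoint_works[of f h 1] linear by (simp add: inner_commute bounded_linear.linear)
  then have "f = (\<lambda>h. adjoint f 1 \<bullet> h)" by blast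
  then show ?case using bounded_linear.has_derivative[OF linear has_derivative_ident]
    by (intro exI[of _ "\<lambda>x. adjoint f 1"]) (metis continuous_on_const)
next
  case (const c)
  show ?case
    by (intro exI[of _ "\<lambda>x. 0"]) (auto intro!: has_derivative_eq_rhs[OF has_derivative_const] simp: fun_eq_iff)
next
  case (add f g)
  then obtain F G where F: "\<forall>x. (f has_derivative (\<lambda>h. F x \<bullet> h)) (at x)" "continuous_on UNIV F"
    and G: "\<forall>x. (g has_derivative (\<lambda>h. G x \<bullet> h)) (at x)" "continuous_on UNIV G" by auto
  show ?case
  proof (intro exI[of _ "\<lambda>x. F x + G x"] conjI allI)
    show "((\<lambda>x. f x + g x) has_derivative (\<lambda>h. (F x + G x) \<bullet> h)) (at x)" for x
      using has_derivative_add[OF F(1)[rule_format, of x] G(1)[rule_format, of x]] by (simp add: inner_add_left)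
    show "continuous_on UNIV (\<lambda>x. F x + G x)" using F G by (intro continuous_intros)
  qed
next
  case (mult f g)
  then obtain F G where F: "\<forall>x. (f has_derivative (\<lambda>h. F x \<bullet> h)) (at x)" "continuous_on UNIV F"
    and G: "\<forall>x. (g has_derivative (\<lambda>h. G x \<bullet> h)) (at x)" "continuous_on UNIV G" by auto
  have c: "continuous_on UNIV f" "continuous_on UNIV g"
    using has_derivative_continuous_on[OF F(1)[rule_format]] has_derivative_continuous_on[OF G(1)[rule_format]] by auto
  show ?case
  proof (intro exI[of _ "\<lambda>x. f x *\<^sub>R G x + g x *\<^sub>R F x"] conjI allI)
    show "((\<lambda>x. f x * g x) has_derivative (\<lambda>h. (f x *\<^sub>R G x + g x *\<^sub>R F x) \<bullet> h)) (at x)" for x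
      using has_derivative_mult[OF F(1)[rule_format, of x] G(1)[rule_format, of x]] by (simp add: inner_add_left mult.commute)
    show "continuous_on UNIV (\<lambda>x. f x *\<^sub>R G x + g x *\<^sub>R F x)" using F G c by (intro continuous_intros)
  qed
qed

text \<open>A Hopf type barrier: a radial bump centred slightly beyond the hyperplane, whose support meets the
  half space only in a flat cap, on which its gradient is nearly normal.\<close>

lemma hopf_barrier:
  fixes w :: "real^'d \<Rightarrow> real"
  assumes \<nu>: "norm \<nu> = 1" and p: "c + \<nu> \<bullet> p = 0" and e: "e > 0"
    and w: "continuous_on UNIV w" "w p > 0" and W: "continuous_on UNIV W"
  obtains \<phi> V where "\<phi> \<in> test_functions (ball p e)" "open V" "p \<in> V" "V \<subseteq> ball p e"
    "\<And>x. x \<notin> V \<Longrightarrow> \<phi> x = 0" "\<And>x. x \<notin> V \<Longrightarrow> grad \<phi> x = 0"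
    "\<And>x k. x \<in> V \<Longrightarrow> c + \<nu> \<bullet> x \<ge> 0 \<Longrightarrow> k \<ge> 1 \<Longrightarrow> grad \<phi> x \<bullet> ((k * w x) *\<^sub>R \<nu> + (c + \<nu> \<bullet> x) *\<^sub>R W x) < 0"
    "\<And>x. x \<in> V \<Longrightarrow> c + \<nu> \<bullet> x \<ge> 0 \<Longrightarrow> w x * (\<nu> \<bullet> grad \<phi> x) + (\<nu> \<bullet> W x) * \<phi> x < 0"
proof -
  have nn: "\<nu> \<bullet> \<nu> = 1" using \<nu> by (simp add: norm_eq_1)
  \<comment> \<open>Half the value at p serves as a lower bound for w on a whole ball.\<close>
  define w0 where "w0 = w p / 2"
  have w0: "w0 > 0" using w by (simp add: w0_def)
  have "open (w -` {w0<..})" using w by (intro open_vimage) auto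
  moreover have "p \<in> w -` {w0<..}" using w by (simp add: w0_def)
  ultimately obtain e1 where e1: "e1 > 0" "ball p e1 \<subseteq> w -` {w0<..}" using open_contains_ball by blast
  define d where "d = min (min e e1) 1"
  have d: "d > 0" "d \<le> e" "d \<le> e1" "d \<le> 1" using e e1 by (auto simp: d_def)
  have ww: "w x > w0" if "x \<in> ball p d" for x
    using subsetD[OF e1(2), of x] subset_ball[OF d(3), of p] that by auto
  have "compact (W ` cball p d)" using W by (intro compact_continuous_image) (auto intro: continuous_on_subset)
  then obtain M0 where M0: "\<And>x. x \<in> cball p d \<Longrightarrow> norm (W x) \<le> M0" using compact_imp_bounded bounded_iff by (metis imageI)
  define M where "M = max M0 1"
  have M: "norm (W x) \<le> M" if "x \<in> ball p d" for x using M0[of x] that by (auto simp: M_def)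
  have M1: "M \<ge> 1" by (simp add: M_def)
  define \<rho> where "\<rho> = d / 4"
  \<comment> \<open>Height of the cap. M \<delta> < w0 \<rho> lets the normal contribution, at least
    w0 \<rho>, dominate the one from W, at most M \<delta>.\<close>
  define \<delta> where "\<delta> = min (d / 4) (w0 * \<rho> / (2 * M))"
  have \<rho>: "\<rho> > 0" using d by (simp add: \<rho>_def)
  have \<delta>: "\<delta> > 0" "\<delta> \<le> d / 4" using d w0 \<rho> M1 by (auto simp: \<delta>_def)
  have "M * \<delta> \<le> M * (w0 * \<rho> / (2 * M))" using M1 by (intro mult_left_mono) (auto simp: \<delta>_def)
  also have "\<dots> < w0 * \<rho>" using M1 w0 \<rho> by simp
  finally have M\<delta>: "M * \<delta> < w0 * \<rho>" .
  \<comment> \<open>The centre q lies \<rho> behind the hyperplane, so a ball of radius \<rho> +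
    \<delta> sticks out by exactly \<delta>.\<close>
  define r where "r = \<rho> + \<delta>"
  have r: "0 < r" "r \<le> 1" "r + \<rho> < d" using \<rho> \<delta> d by (auto simp: r_def \<rho>_def)
  define q where "q = p - \<rho> *\<^sub>R \<nu>"
  define h where "h x = r\<^sup>2 - (norm (x - q))\<^sup>2" for x
  define \<phi> where "\<phi> x = bump1 1 0 (h x)" for x
  define V where "V = ball q r"
  have hV: "h x > 0 \<longleftrightarrow> x \<in> V" for x
  proof -
    have "norm (x - q) < r \<longleftrightarrow> (norm (x - q))\<^sup>2 < r\<^sup>2" using r by (metis norm_ge_zero power2_less_imp_less power_strict_mono less_imp_le zero_less_numeral)
    then show ?thesis by (simp add: h_def V_def dist_norm norm_minus_commute)
  qed
  have hpoly: "h \<in> poly_space 2"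
  proof -
    have "(\<lambda>x. r\<^sup>2 + (-1) * (\<Sum>i\<in>UNIV. (- (q $ i) + axis i 1 \<bullet> x) * ((- (q $ i) + axis i 1 \<bullet> x) * 1))) \<in> poly_space (Suc (Suc 0))"
      by (intro poly_space_add poly_space_const poly_space_cmult poly_space_sum poly_space_mult_affine)
    moreover have "r\<^sup>2 + (-1) * (\<Sum>i\<in>UNIV. (- (q $ i) + axis i 1 \<bullet> x) * ((- (q $ i) + axis i 1 \<bullet> x) * 1)) = h x" for x
      unfolding inner_axis' h_def power2_norm_eq_inner inner_vec_def[of "x - q"] by simp
    ultimately show ?thesis by (simp add: numeral_2_eq_2)
  qed
  have sub: "cball q r \<subseteq> ball p d"
  proof
    fix x assume "x \<in> cball q r"
    moreover have "dist p q = \<rho>" using \<rho> \<nu> by (simp add: q_def dist_norm)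
    ultimately show "x \<in> ball p d" using dist_triangle[of p x q] r by auto
  qed
  have t: "\<phi> \<in> test_functions (ball p e)"
  proof (rule test_functionI)
    show "Ck_fun n \<phi>" for n unfolding \<phi>_def by (intro Ck_fun_bump1 poly_space_Ck_fun[OF hpoly]) simp
    show "cball q r \<subseteq> ball p e" using sub subset_ball[OF d(2), of p] by blast
    show "\<phi> x = 0" if "x \<notin> cball q r" for x using hV[of x] that by (auto simp: \<phi>_def bump1_def V_def)
  qed simp
  \<comment> \<open>The derivative of \<open>bump1 1 0\<close> is \<open>bump1 1 2\<close>, so E is
    the slope of the bump as a function of h.\<close>
  define E where "E x = bump1 1 2 (h x)" for x
  have gr: "grad \<phi> x = (- 2 * E x) *\<^sub>R (x - q)" for x
  proof (rule grad_eq)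
    have "((\<lambda>x. (x - q) \<bullet> (x - q)) has_derivative (\<lambda>v. (x - q) \<bullet> v + v \<bullet> (x - q))) (at x)"
      by (auto intro!: derivative_eq_intros)
    then have "(h has_derivative (\<lambda>v. - (2 * ((x - q) \<bullet> v)))) (at x)"
      unfolding h_def power2_norm_eq_inner
      by (auto intro!: derivative_eq_intros simp: inner_commute)
    from has_derivative_compose[OF this bump1_deriv[of 1 0, unfolded has_field_derivative_def]]
    show "(\<phi> has_derivative (\<lambda>v. ((- 2 * E x) *\<^sub>R (x - q)) \<bullet> v)) (at x)"
      by (simp add: \<phi>_def[abs_def] E_def algebra_simps numeral_2_eq_2)
  qed
  have z: "\<phi> x = 0" "grad \<phi> x = 0" if "x \<notin> V" for x
    using hV[of x] that by (auto simp: \<phi>_def gr E_def bump1_def)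
  have key: "E x > 0" "\<nu> \<bullet> (x - q) \<ge> \<rho>" "c + \<nu> \<bullet> x \<le> \<delta>" "norm (x - q) \<le> 1" "w x > w0" "norm (W x) \<le> M"
      "\<phi> x \<le> \<delta> * E x" "\<phi> x \<ge> 0"
    if x: "x \<in> V" and l: "c + \<nu> \<bullet> x \<ge> 0" for x
  proof -
    show E: "E x > 0" using hV[of x] x by (simp add: E_def bump1_def)
    have eq: "\<nu> \<bullet> (x - q) = c + \<nu> \<bullet> x + \<rho>" using p nn by (simp add: q_def inner_diff_right)
    then show ge: "\<nu> \<bullet> (x - q) \<ge> \<rho>" using l by simp
    have nr: "norm (x - q) < r" using x by (simp add: V_def dist_norm norm_minus_commute)
    have "\<nu> \<bullet> (x - q) \<le> norm (x - q)" using norm_cauchy_schwarz[of \<nu> "x - q"] \<nu> by simp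
    then show "c + \<nu> \<bullet> x \<le> \<delta>" using eq nr by (simp add: r_def)
    show "norm (x - q) \<le> 1" using nr r by simp
    have "x \<in> ball p d" using subsetD[OF sub, of x] x by (auto simp: V_def)
    then show "w x > w0" "norm (W x) \<le> M" using ww M by auto
    have "\<rho>\<^sup>2 \<le> (norm (x - q))\<^sup>2" using \<open>\<nu> \<bullet> (x - q) \<le> norm (x - q)\<close> ge \<rho> by (intro power_mono) auto
    then have "h x \<le> r\<^sup>2 - \<rho>\<^sup>2" by (simp add: h_def)
    also have "\<dots> = \<delta> * (r + \<rho>)" by (simp add: r_def power2_eq_square algebra_simps)
    also have "\<dots> \<le> \<delta> * 1" using \<delta> r d by (intro mult_left_mono) auto
    finally have h\<delta>: "h x \<le> \<delta>" by simp
    have h0: "h x > 0" using hV x by simp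
    have "h x * h x \<le> \<delta> * 1" using h\<delta> h0 \<delta> d by (intro mult_mono) auto
    \<comment> \<open>The bump is h^2 times its slope and h is at most \<delta> on the cap; this
      makes the zero-order term in the second inequality small against the gradient.\<close>
    moreover have "\<phi> x = (h x * h x) * E x" using h0 by (simp add: \<phi>_def E_def bump1_def power2_eq_square field_simps)
    ultimately show "\<phi> x \<le> \<delta> * E x" using E by (simp add: mult_right_mono)
    show "\<phi> x \<ge> 0" by (simp add: \<phi>_def bump1_nonneg)
  qed
  have A: "grad \<phi> x \<bullet> ((k * w x) *\<^sub>R \<nu> + (c + \<nu> \<bullet> x) *\<^sub>R W x) < 0"
    if x: "x \<in> V" and l: "c + \<nu> \<bullet> x \<ge> 0" and k: "k \<ge> 1" for x k
  proof -
    note K = key[OF x l]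
    have "\<bar>(x - q) \<bullet> W x\<bar> \<le> norm (x - q) * norm (W x)" by (rule Cauchy_Schwarz_ineq2)
    also have "\<dots> \<le> 1 * M" using K(4,6) by (intro mult_mono) auto
    finally have 1: "\<bar>(x - q) \<bullet> W x\<bar> \<le> M" by simp
    have "(c + \<nu> \<bullet> x) * \<bar>(x - q) \<bullet> W x\<bar> \<le> \<delta> * M" using 1 K(3) l M1 \<delta> by (intro mult_mono) auto
    then have 2: "- (M * \<delta>) \<le> (c + \<nu> \<bullet> x) * ((x - q) \<bullet> W x)" using l
      by (metis abs_le_D2 abs_mult abs_of_nonneg mult.commute neg_le_iff_le minus_le_iff)
    have "1 * (w0 * \<rho>) \<le> k * (w x * (\<nu> \<bullet> (x - q)))"
      using k K(2,5) w0 \<rho> by (intro mult_mono) auto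
    then have "k * w x * ((x - q) \<bullet> \<nu>) + (c + \<nu> \<bullet> x) * ((x - q) \<bullet> W x) > 0"
      using 2 M\<delta> by (simp add: inner_commute mult.assoc)
    then have "(x - q) \<bullet> ((k * w x) *\<^sub>R \<nu> + (c + \<nu> \<bullet> x) *\<^sub>R W x) > 0" by (simp add: inner_add_right)
    then show ?thesis unfolding gr using K(1) by (simp add: mult_less_0_iff)
  qed
  have B: "w x * (\<nu> \<bullet> grad \<phi> x) + (\<nu> \<bullet> W x) * \<phi> x < 0" if x: "x \<in> V" and l: "c + \<nu> \<bullet> x \<ge> 0" for x
  proof -
    note K = key[OF x l]
    have "\<bar>\<nu> \<bullet> W x\<bar> \<le> M" using Cauchy_Schwarz_ineq2[of \<nu> "W x"] \<nu> K(6) by simp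
    then have "(\<nu> \<bullet> W x) * \<phi> x \<le> M * (\<delta> * E x)" using K(7,8) M1 by (intro mult_mono) auto
    also have "\<dots> < (w0 * \<rho>) * E x" using M\<delta> K(1) by (simp flip: mult.assoc)
    also have "\<dots> \<le> (w x * (\<nu> \<bullet> (x - q))) * E x" using K(1,2,5) w0 \<rho> by (intro mult_right_mono mult_mono) auto
    also have "\<dots> \<le> 2 * ((w x * (\<nu> \<bullet> (x - q))) * E x)"
      using K(1,2,5) w0 \<rho> by simp
    finally show ?thesis unfolding gr by (simp add: algebra_simps)
  qed
  show ?thesis
  proof (rule that[OF t _ _ _ z A B])
    show "open V" by (simp add: V_def)
    show "p \<in> V" using \<nu> \<rho> \<delta> by (simp add: V_def q_def dist_norm r_def)
    show "V \<subseteq> ball p e" unfolding V_def using sub subset_ball[OF d(2), of p] ball_subset_cball[of q r] by blast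
  qed auto
qed

lemma negative_integral_contradiction:
  fixes f :: "real^'d \<Rightarrow> real"
  assumes f: "integrable lebesgue f" "(LINT x|lebesgue. f x) = 0" and le: "AE x in lebesgue. f x \<le> 0"
    and U: "open U" "U \<noteq> {}" "AE x\<in>U in lebesgue. f x < 0"
  shows False
proof -
  have "AE x in lebesgue. - f x = 0"
    using integral_nonneg_eq_0_iff_AE[of lebesgue "\<lambda>x. - f x"] f le by auto
  then have "AE x in lebesgue. x \<notin> U" using U(3) by eventually_elim auto
  then have "negligible U" using AE_iff_null_sets[of U lebesgue] U(1) by (simp add: negligible_iff_null_sets)
  then show False using open_not_negligible U by blast
qed

text \<open>If w vanished on the hyperplane near p, then w composed with the orthogonal projection
  would vanish on an open set, hence everywhere, also at y.\<close>

lemma hyperplane_nonzero_nearby: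
  fixes w :: "real^'d \<Rightarrow> real"
  assumes w: "real_polynomial_function w" and \<nu>: "norm \<nu> = 1" and y: "c + \<nu> \<bullet> y = 0" "w y \<noteq> 0"
    and p: "c + \<nu> \<bullet> p = 0" and e: "e > 0"
  shows "\<exists>x\<in>ball p e. c + \<nu> \<bullet> x = 0 \<and> w x \<noteq> 0"
proof (rule ccontr)
  assume no: "\<not> ?thesis"
  have nn: "\<nu> \<bullet> \<nu> = 1" using \<nu> by (simp add: norm_eq_1)
  define pr where "pr = (\<lambda>x. x - (c + \<nu> \<bullet> x) *\<^sub>R \<nu>)"
  have pp: "polynomial_function pr" unfolding pr_def
    by (rule polynomial_function_diff[OF polynomial_function_id polynomial_function_mult[OF
          polynomial_function_add[OF polynomial_function_const
             polynomial_function_bounded_linear[OF bounded_linear_inner_right]] polynomial_function_const]])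
  have rp: "real_polynomial_function (\<lambda>x. w (pr x))"
    using real_polynomial_function_compose[OF pp w] by (simp add: o_def)
  have cont: "continuous_on UNIV pr" unfolding pr_def by (intro continuous_intros)
  have l0: "c + \<nu> \<bullet> pr x = 0" for x by (simp add: pr_def inner_diff_right nn)
  have "w (pr y) = 0"
  proof (rule rpf_zero_on_open[OF rp])
    show "open (pr -` ball p e)" using cont by (intro open_vimage) auto
    show "p \<in> pr -` ball p e" using p e by (simp add: pr_def)
    show "w (pr x) = 0" if "x \<in> pr -` ball p e" for x using no that l0[of x] by auto
  qed
  then show False using y by (simp add: pr_def)
qed

section \<open>Propagation of zeros through the mesh\<close>

context meshed_domain
begin

text \<open>Write u = \<lambda>^j w on S, with \<lambda> the distance to the facet. Both cases test
  with the same bump and reach an integrand that is negative on an open part of S and zero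
  elsewhere: for j > 0 from the divergence equation, for j = 0 from the weak gradient identity in
  the normal direction, where a jump shows up.\<close>

lemma facet_unique_continuation:
  assumes u: "u \<in> V_space \<Omega> \<T> k"
    and \<gamma>: "AE x\<in>\<Omega> in lebesgue. \<gamma> x > 0" and L2: "(\<lambda>x. \<gamma> x *\<^sub>R weak_grad \<Omega> u x) \<in> L2_space \<Omega>"
    and div: "\<And>\<phi>. \<phi> \<in> test_functions \<Omega> \<Longrightarrow> (LINT x|lebesgue. (\<gamma> x *\<^sub>R weak_grad \<Omega> u x) \<bullet> grad \<phi> x) = 0"
    and S: "S \<in> \<T>" and T: "T \<in> \<T>" and facet: "aff_dim (S \<inter> T) = int CARD('d) - 1" "S \<inter> T \<inter> \<Omega> \<noteq> {}"
    and uT: "AE x\<in>T in lebesgue. u x = 0"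
  shows "AE x\<in>S in lebesgue. u x = 0"
proof -
  obtain P G where P: "P \<in> poly_space k" "\<And>x. (P has_derivative (\<lambda>h. G x \<bullet> h)) (at x)" "continuous_on UNIV G"
    "AE x\<in>S in lebesgue. u x = P x" "AE x\<in>S in lebesgue. weak_grad \<Omega> u x = G x"
    by (rule V_space_elementE[OF u S]) (rule that)
  have uH: "u \<in> H1_space \<Omega>" using u by (simp add: V_space_def)
  note wg = H1_weak_grad[OF open_dom uH]
  have uTi: "AE x\<in>interior T in lebesgue. u x = 0" using uT by eventually_elim (use interior_subset[of T] in auto)
  have "AE x\<in>interior T in lebesgue. weak_grad \<Omega> u x = 0"
    by (rule weak_grad_classical[OF wg(1) open_interior mesh_element(4)[OF mesh T] uTi]) auto
  then have gT: "AE x\<in>T in lebesgue. weak_grad \<Omega> u x = 0"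
    by (rule AE_interior_imp[OF mesh_element(6)[OF mesh T]])
  have "P x = 0" for x
  proof (rule ccontr)
    assume "P x \<noteq> 0"
    obtain K a b l m where K: "barycentric (insert a K) l" "barycentric (insert b K) m" "a \<notin> K" "b \<notin> K"
      "S = convex hull (insert a K)" "T = convex hull (insert b K)" "S \<inter> T = convex hull K"
      by (rule mesh_shared_facet[OF mesh S T facet(1)])
    have finK: "finite K" using bary_finite[OF K(1)] by simp
    have cardK: "card K = CARD('d)" using bary_card[OF K(1)] K(3) finK by simp
    then have cK: "card K > 0" by simp
    obtain c1 n where n: "\<And>x. l a x = c1 + n \<bullet> x" using bary_affine[OF K(1), of a] by blast
    have n0: "n \<noteq> 0" by (rule bary_nonconst[OF K(1) _ n]) simp
    define \<nu> where "\<nu> = (1 / norm n) *\<^sub>R n"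
    define c where "c = c1 / norm n"
    have \<nu>: "norm \<nu> = 1" using n0 by (simp add: \<nu>_def)
    have la: "l a x = norm n * (c + \<nu> \<bullet> x)" for x using n0 by (simp add: n c_def \<nu>_def field_simps)
    define h where "h = (\<Sum>v\<in>K. (1 / real (card K)) *\<^sub>R v)"
    have "l v h = (if v = a then 0 else 1 / real (card K))" if "v \<in> insert a K" for v
    proof (rule bary_unique[OF K(1) _ _ that])
      have "(\<Sum>w\<in>K. if w = a then 0 else 1 / real (card K)) = (\<Sum>w\<in>K. 1 / real (card K))"
        "(\<Sum>w\<in>K. (if w = a then 0 else 1 / real (card K)) *\<^sub>R w) = (\<Sum>w\<in>K. (1 / real (card K)) *\<^sub>R w)"
        by (intro sum.cong refl; use K(3) in auto)+
      moreover have "(\<Sum>w\<in>K. 1 / real (card K)) = 1" using cK by simp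
      ultimately show "(\<Sum>w\<in>insert a K. if w = a then 0 else 1 / real (card K)) = 1"
        "(\<Sum>w\<in>insert a K. (if w = a then 0 else 1 / real (card K)) *\<^sub>R w) = h"
        unfolding sum.insert[OF finK K(3)] h_def by simp_all
    qed
    then have lh: "l a h = 0" "\<And>v. v \<in> K \<Longrightarrow> l v h > 0" using K(3) cK by auto
    obtain p0 where p0: "p0 \<in> convex hull K" "p0 \<in> \<Omega>" using facet(2) K(7) by blast
    have "p0 \<in> S" using p0(1) K(7) by blast
    then have lp0: "l a p0 = 0" "\<And>v. v \<in> K \<Longrightarrow> l v p0 \<ge> 0"
      using bary_opposite_facet[OF K(1), of a p0] p0(1) K(3) unfolding K(5) bary_hull[OF K(1)] by auto
    \<comment> \<open>p0 lies in \<Omega> but possibly on the relative boundary of the facet. A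
      small step towards the facet's barycentre h reaches its relative interior without leaving
      \<Omega>.\<close>
    have "\<exists>t\<in>{0<..<1}. p0 + t *\<^sub>R (h - p0) \<in> \<Omega>"
    proof -
      have "open ((\<lambda>t::real. p0 + t *\<^sub>R (h - p0)) -` \<Omega>)" by (intro open_vimage open_dom continuous_intros)
      then obtain e where e: "e > 0" "ball 0 e \<subseteq> ((\<lambda>t::real. p0 + t *\<^sub>R (h - p0)) -` \<Omega>)"
        using p0(2) by (auto simp: open_contains_ball dest: bspec[of _ _ 0])
      have "min (e / 2) (1 / 2) \<in> ball 0 e" using e(1) by (auto simp: dist_real_def)
      from subsetD[OF e(2) this] show ?thesis using e(1) by (intro bexI[of _ "min (e / 2) (1 / 2)"]) auto
    qed
    then obtain t where t: "0 < t" "t < 1" "p0 + t *\<^sub>R (h - p0) \<in> \<Omega>" by auto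
    define p1 where "p1 = p0 + t *\<^sub>R (h - p0)"
    have lp1: "l a p1 = 0" "\<And>v. v \<in> K \<Longrightarrow> l v p1 > 0"
      unfolding p1_def bary_line[OF K(1)] using lh lp0 t by (auto simp: add_nonneg_pos)
    obtain e1 where e1: "e1 > 0" "\<And>x. x \<in> ball p1 e1 \<Longrightarrow> (l a x \<ge> 0 \<longrightarrow> x \<in> S) \<and> (l a x \<le> 0 \<longrightarrow> x \<in> T)"
      using facet_neighbours[OF K(1-4) K(7)[unfolded K(5,6)] lp1(2,1)] unfolding K(5,6) by blast
    have "p1 \<in> \<Omega>" using t(3) by (simp add: p1_def)
    then obtain e2 where e2: "e2 > 0" "ball p1 e2 \<subseteq> \<Omega>" using open_dom open_contains_ball by blast
    obtain j w y where w: "real_polynomial_function w" "\<And>x. P x = (c + \<nu> \<bullet> x) ^ j * w x" "c + \<nu> \<bullet> y = 0" "w y \<noteq> 0"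
      using rpf_factor_affine[OF poly_space_imp_rpf[OF P(1)] \<open>P x \<noteq> 0\<close> \<nu>, of c] by blast
    have "c + \<nu> \<bullet> p1 = 0" using lp1(1) n0 by (simp add: la)
    \<comment> \<open>w is nonzero somewhere on the hyperplane, hence also at a point as close to p1
      as desired.\<close>
    then obtain p where p: "p \<in> ball p1 (min e1 e2)" "c + \<nu> \<bullet> p = 0" "w p \<noteq> 0"
      using hyperplane_nonzero_nearby[OF w(1) \<nu> w(3,4)] e1(1) e2(1) by (metis min_less_iff_conj)
    obtain e where e: "e > 0" "ball p e \<subseteq> ball p1 (min e1 e2)" using p(1) open_ball open_contains_ball by blast
    have eST: "x \<in> \<Omega>" "c + \<nu> \<bullet> x \<ge> 0 \<Longrightarrow> x \<in> S" "c + \<nu> \<bullet> x \<le> 0 \<Longrightarrow> x \<in> T" if "x \<in> ball p e" for x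
    proof -
      have "x \<in> ball p1 e1" "x \<in> ball p1 e2" using that e(2) by auto
      moreover have "l a x \<ge> 0 \<longleftrightarrow> c + \<nu> \<bullet> x \<ge> 0" "l a x \<le> 0 \<longleftrightarrow> c + \<nu> \<bullet> x \<le> 0"
        using n0 unfolding la by (auto simp: zero_le_mult_iff mult_le_0_iff)
      ultimately show "x \<in> \<Omega>" "c + \<nu> \<bullet> x \<ge> 0 \<Longrightarrow> x \<in> S" "c + \<nu> \<bullet> x \<le> 0 \<Longrightarrow> x \<in> T"
        using e1(2)[of x] e2(2) by auto
    qed
    \<comment> \<open>Normalises the sign of w at p, as the barrier expects a positive
      function.\<close>
    define s where "s = sgn (w p)"
    have s: "s * w p > 0" "s \<noteq> 0" using p(3) by (auto simp: s_def sgn_if)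
    obtain W where W: "\<And>x. (w has_derivative (\<lambda>h. W x \<bullet> h)) (at x)" "continuous_on UNIV W" using rpf_C1[OF w(1)] by blast
    have cw: "continuous_on UNIV w" by (rule has_derivative_continuous_on[OF W(1)])
    obtain \<phi> V where \<phi>: "\<phi> \<in> test_functions (ball p e)" "open V" "p \<in> V" "V \<subseteq> ball p e"
      "\<And>x. x \<notin> V \<Longrightarrow> \<phi> x = 0" "\<And>x. x \<notin> V \<Longrightarrow> grad \<phi> x = 0"
      "\<And>x k. x \<in> V \<Longrightarrow> c + \<nu> \<bullet> x \<ge> 0 \<Longrightarrow> k \<ge> 1 \<Longrightarrow> grad \<phi> x \<bullet> ((k * (s * w x)) *\<^sub>R \<nu> + (c + \<nu> \<bullet> x) *\<^sub>R (s *\<^sub>R W x)) < 0"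
      "\<And>x. x \<in> V \<Longrightarrow> c + \<nu> \<bullet> x \<ge> 0 \<Longrightarrow> (s * w x) * (\<nu> \<bullet> grad \<phi> x) + (\<nu> \<bullet> (s *\<^sub>R W x)) * \<phi> x < 0"
    proof (rule hopf_barrier[OF \<nu> p(2) e(1), of "\<lambda>x. s * w x" "\<lambda>x. s *\<^sub>R W x"])
      show "continuous_on UNIV (\<lambda>x. s * w x)" "continuous_on UNIV (\<lambda>x. s *\<^sub>R W x)"
        using cw W(2) by (auto intro: continuous_intros)
    qed (rule s(1), rule that)
    have \<phi>\<Omega>: "\<phi> \<in> test_functions \<Omega>" using \<phi>(1) test_functions_mono[of "ball p e" \<Omega>] eST(1) by blast
    \<comment> \<open>The part of the support strictly on the side of S, where the integrands below
      are negative.\<close>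
    define U where "U = V \<inter> {x. c + \<nu> \<bullet> x > 0}"
    have oU: "open U" unfolding U_def using \<phi>(2) by (intro open_Int open_Collect_less continuous_intros)
    have neU: "U \<noteq> {}"
    proof -
      obtain r where r: "r > 0" "ball p r \<subseteq> V" using \<phi>(2,3) open_contains_ball by blast
      have "p + (r / 2) *\<^sub>R \<nu> \<in> ball p r" using r \<nu> by (simp add: dist_norm)
      moreover have "c + \<nu> \<bullet> (p + (r / 2) *\<^sub>R \<nu>) > 0"
        using p(2) r \<nu> by (simp add: inner_add_right norm_eq_1)
      ultimately show ?thesis using r by (auto simp: U_def)
    qed
    have gradP: "G x = (real j * (c + \<nu> \<bullet> x) ^ (j - 1) * w x) *\<^sub>R \<nu> + (c + \<nu> \<bullet> x) ^ j *\<^sub>R W x" for x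
    proof -
      have "((\<lambda>x. (c + \<nu> \<bullet> x) ^ j * w x) has_derivative
          (\<lambda>h. (c + \<nu> \<bullet> x) ^ j * (W x \<bullet> h) + (real j * (\<nu> \<bullet> h) * (c + \<nu> \<bullet> x) ^ (j - 1)) * w x)) (at x)"
        by (rule has_derivative_mult[OF has_derivative_power W(1)]) (auto intro!: derivative_eq_intros)
      moreover have "P = (\<lambda>x. (c + \<nu> \<bullet> x) ^ j * w x)" using w(2) by blast
      ultimately have "(P has_derivative (\<lambda>h. ((real j * (c + \<nu> \<bullet> x) ^ (j - 1) * w x) *\<^sub>R \<nu> + (c + \<nu> \<bullet> x) ^ j *\<^sub>R W x) \<bullet> h)) (at x)"
        by (simp add: inner_add_left algebra_simps)
      then show ?thesis using grad_eq P(2) by metis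
    qed
    have AES: "AE x in lebesgue. x \<in> V \<longrightarrow> c + \<nu> \<bullet> x > 0 \<longrightarrow> u x = P x \<and> weak_grad \<Omega> u x = G x"
      using P(4,5) by eventually_elim (use eST(2) \<phi>(4) in force)
    have AET: "AE x in lebesgue. x \<in> V \<longrightarrow> c + \<nu> \<bullet> x \<le> 0 \<longrightarrow> u x = 0 \<and> weak_grad \<Omega> u x = 0"
      using uT gT by eventually_elim (use eST(3) \<phi>(4) in force)
    show False
    proof (cases "j = 0")
      case True
      have GW: "G x = W x" "P x = w x" for x using gradP[of x] w(2)[of x] True by simp_all
      \<comment> \<open>The \<nu>-component of grad (u \<phi>), which integrates to zero for a
        weakly differentiable u.\<close>
      define f where "f x = s * (u x * (\<nu> \<bullet> grad \<phi> x) + (\<nu> \<bullet> weak_grad \<Omega> u x) * \<phi> x)" for x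
      have li: "locally_integrable \<Omega> u" "locally_integrable \<Omega> (weak_grad \<Omega> u)" using wg(1) by (auto simp: has_weak_grad_alt)
      have i: "integrable lebesgue (\<lambda>x. u x * grad \<phi> x $ i)" "integrable lebesgue (\<lambda>x. weak_grad \<Omega> u x $ i * \<phi> x)" for i
        using test_integrable(2)[OF li(1) \<phi>\<Omega>] test_integrable(1)[OF locally_integrable_nth[OF li(2)] \<phi>\<Omega>] by auto
      have eq: "f = (\<lambda>x. s * (\<Sum>i\<in>UNIV. \<nu> $ i * (u x * grad \<phi> x $ i + weak_grad \<Omega> u x $ i * \<phi> x)))"
        by (simp add: f_def[abs_def] inner_vec_def sum_distrib_left sum_distrib_right sum.distrib[symmetric] algebra_simps)
      have "(LINT x|lebesgue. u x * grad \<phi> x $ i + weak_grad \<Omega> u x $ i * \<phi> x) = 0" for i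
        using wg(1) \<phi>\<Omega> i by (simp add: has_weak_grad_alt)
      then have f: "integrable lebesgue f" "(LINT x|lebesgue. f x) = 0"
        unfolding eq using i by simp_all
      show False
      proof (rule negative_integral_contradiction[OF f _ oU neU])
        have *: "AE x in lebesgue. (x \<in> U \<longrightarrow> f x < 0) \<and> (x \<notin> U \<longrightarrow> f x = 0)"
          using AES AET
        proof eventually_elim
          case (elim x)
          have "f x < 0" if "x \<in> U"
          proof -
            have x: "x \<in> V" "c + \<nu> \<bullet> x \<ge> 0" "c + \<nu> \<bullet> x > 0" using that by (auto simp: U_def)
            then have "u x = w x" "weak_grad \<Omega> u x = W x" using elim GW by auto
            then show ?thesis using \<phi>(8)[OF x(1,2)] by (simp add: f_def algebra_simps)
          qed
          moreover have "f x = 0" if "x \<notin> U"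
          proof (cases "x \<in> V")
            case True
            then have "c + \<nu> \<bullet> x \<le> 0" using that by (auto simp: U_def)
            then show ?thesis using elim True by (simp add: f_def)
          next
            case False
            then show ?thesis using \<phi>(5,6) by (simp add: f_def)
          qed
          ultimately show ?case by blast
        qed
        then show "AE x in lebesgue. f x \<le> 0" by eventually_elim force
        show "AE x\<in>U in lebesgue. f x < 0" using * by eventually_elim blast
      qed
    next
      case False
      then have j1: "real j \<ge> 1" by simp
      \<comment> \<open>Integrates to zero because \<gamma> grad u is divergence free.\<close>
      define f where "f x = s * ((\<gamma> x *\<^sub>R weak_grad \<Omega> u x) \<bullet> grad \<phi> x)" for x
      have f: "integrable lebesgue f" "(LINT x|lebesgue. f x) = 0"
        using test_inner_integrable(1)[OF L2_locally_integrable[OF L2] \<phi>\<Omega>] div[OF \<phi>\<Omega>] by (simp_all add: f_def[abs_def])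
      show False
      proof (rule negative_integral_contradiction[OF f _ oU neU])
        have *: "AE x in lebesgue. (x \<in> U \<longrightarrow> f x < 0) \<and> (x \<notin> U \<longrightarrow> f x = 0)"
          using AES AET \<gamma>
        proof eventually_elim
          case (elim x)
          have "f x < 0" if "x \<in> U"
          proof -
            have x: "x \<in> V" "c + \<nu> \<bullet> x \<ge> 0" "c + \<nu> \<bullet> x > 0" using that by (auto simp: U_def)
            have "\<gamma> x > 0" using elim(3) eST(1) \<phi>(4) x(1) by blast
            have wG: "weak_grad \<Omega> u x = G x" using elim x by blast
            \<comment> \<open>One factor \<lambda>^(j-1) comes out of the gradient; what is left is
              the vector of the barrier estimate with k = j.\<close>
            have "(c + \<nu> \<bullet> x) ^ j = (c + \<nu> \<bullet> x) ^ (j - 1) * (c + \<nu> \<bullet> x)" using False by (simp add: power_eq_if)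
            then have "G x = (c + \<nu> \<bullet> x) ^ (j - 1) *\<^sub>R ((real j * w x) *\<^sub>R \<nu> + (c + \<nu> \<bullet> x) *\<^sub>R W x)"
              unfolding gradP by (simp add: scaleR_add_right algebra_simps)
            then have "f x = (\<gamma> x * (c + \<nu> \<bullet> x) ^ (j - 1)) *
                (grad \<phi> x \<bullet> ((real j * (s * w x)) *\<^sub>R \<nu> + (c + \<nu> \<bullet> x) *\<^sub>R (s *\<^sub>R W x)))"
              by (simp add: f_def wG inner_add_left inner_add_right inner_commute algebra_simps)
            moreover have "\<gamma> x * (c + \<nu> \<bullet> x) ^ (j - 1) > 0" using x(3) \<open>\<gamma> x > 0\<close> by simp
            ultimately show ?thesis using \<phi>(7)[OF x(1,2) j1] by (simp add: mult_pos_neg)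
          qed
          moreover have "f x = 0" if "x \<notin> U"
          proof (cases "x \<in> V")
            case True
            then have "c + \<nu> \<bullet> x \<le> 0" using that by (auto simp: U_def)
            then show ?thesis using elim True by (simp add: f_def)
          next
            case False
            then show ?thesis using \<phi>(6) by (simp add: f_def)
          qed
          ultimately show ?case by blast
        qed
        then show "AE x in lebesgue. f x \<le> 0" by eventually_elim force
        show "AE x\<in>U in lebesgue. f x < 0" using * by eventually_elim blast
      qed
    qed
  qed
  then show ?thesis using P(4) by auto
qed

text \<open>The open set \<omega> meets the interior of some simplex, where a polynomial vanishing
  on an open set is zero. From there the zero set grows across facets until it is the whole
  mesh.\<close>

lemma unique_continuation:
  assumes u: "u \<in> V_space \<Omega> \<T> k"
    and \<gamma>: "AE x\<in>\<Omega> in lebesgue. \<gamma> x > 0" and L2: "(\<lambda>x. \<gamma> x *\<^sub>R weak_grad \<Omega> u x) \<in> L2_space \<Omega>"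
    and div: "\<And>\<phi>. \<phi> \<in> test_functions \<Omega> \<Longrightarrow> (LINT x|lebesgue. (\<gamma> x *\<^sub>R weak_grad \<Omega> u x) \<bullet> grad \<phi> x) = 0"
    and \<omega>: "open \<omega>" "\<omega> \<noteq> {}" "\<omega> \<subseteq> \<Omega>" "AE x\<in>\<omega> in lebesgue. u x = 0"
  shows "AE x\<in>\<Omega> in lebesgue. u x = 0"
proof -
  define \<N> where "\<N> = {T\<in>\<T>. AE x\<in>T in lebesgue. u x = 0}"
  obtain x where x: "x \<in> \<omega>" using \<omega>(2) by blast
  then obtain T0 where T0: "T0 \<in> \<T>" "x \<in> T0" using mesh_cover \<omega>(3) by blast
  have "x \<in> closure (interior T0)" using mesh_element(5)[OF mesh T0(1)] T0(2) by simp
  then have ne: "\<omega> \<inter> interior T0 \<noteq> {}" using x \<omega>(1) open_Int_closure_eq_empty by blast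
  obtain P where P: "P \<in> poly_space k" "AE x\<in>T0 in lebesgue. u x = P x"
    by (rule V_space_elementE[OF u T0(1)]) (rule that)
  have ae: "AE x\<in>\<omega> \<inter> interior T0 in lebesgue. P x = 0"
    using P(2) \<omega>(4) by eventually_elim (use interior_subset[of T0] in auto)
  have oI: "open (\<omega> \<inter> interior T0)" using \<omega>(1) by auto
  obtain x0 where x0: "x0 \<in> \<omega> \<inter> interior T0" using ne by blast
  have "P x = 0" for x
    by (rule rpf_zero_on_open[OF poly_space_imp_rpf[OF P(1)] oI x0])
      (rule continuous_AE_zero_open[OF oI poly_space_continuous[OF P(1)] ae])
  then have T0N: "T0 \<in> \<N>" using P(2) T0(1) by (simp add: \<N>_def)
  have "\<T> - \<N> = {}"
  proof (rule ccontr)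
    assume "\<T> - \<N> \<noteq> {}"
    moreover have "\<T> = (\<T> - \<N>) \<union> \<N>" "\<N> \<noteq> {}" "(\<T> - \<N>) \<inter> \<N> = {}" using T0N by (auto simp: \<N>_def)
    ultimately obtain S T where ST: "S \<in> \<T> - \<N>" "T \<in> \<N>" "S \<inter> T \<inter> \<Omega> \<noteq> {}" "aff_dim (S \<inter> T) = int CARD('d) - 1"
      using mesh_facet_connected[OF open_dom connected_dom mesh, of "\<T> - \<N>" \<N>] by blast
    have "AE x\<in>S in lebesgue. u x = 0"
      by (rule facet_unique_continuation[OF u \<gamma> L2 div _ _ ST(4,3)]) (use ST in \<open>auto simp: \<N>_def\<close>)
    then show False using ST by (simp add: \<N>_def)
  qed
  then have all: "AE x\<in>T in lebesgue. u x = 0" if "T \<in> \<T>" for T using that by (auto simp: \<N>_def)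
  show ?thesis
  proof (rule mesh_AE)
    show "AE x\<in>interior T in lebesgue. u x = 0" if "T \<in> \<T>" for T
      using all[OF that] by eventually_elim (use interior_subset[of T] in auto)
  qed
qed

end

section \<open>The discrete saddle point problem\<close>

lemma L2_inner_zero_left:
  fixes v w :: "real^'d \<Rightarrow> 'b::euclidean_space"
  assumes "v \<in> L2_space X" "w \<in> L2_space X" "AE x\<in>X in lebesgue. v x = 0"
  shows "L2_inner X v w = 0"
proof -
  have "L2_inner X v w = L2_inner X (\<lambda>x. 0) w"
    using assms by (intro L2_inner_AE_cong) auto
  then show ?thesis by (simp add: L2_inner_def)
qed

lemma L2_inner_zero_right:
  fixes v w :: "real^'d \<Rightarrow> 'b::euclidean_space"
  assumes "v \<in> L2_space X" "w \<in> L2_space X" "AE x\<in>X in lebesgue. w x = 0"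
  shows "L2_inner X v w = 0"
  using L2_inner_zero_left[OF assms(2,1,3)] by (simp add: L2_inner_commute)

lemma L2_inner_comb_right:
  assumes "u \<in> L2_space X" "v \<in> L2_space X" "w \<in> L2_space X"
  shows "L2_inner X u (\<lambda>x. v x + a *\<^sub>R w x) = L2_inner X u v + a * L2_inner X u w"
  using L2_inner_comb[OF assms] by (simp add: L2_inner_commute)

text \<open>The moments of v against all monomials control its product with P, and P equals v almost
  everywhere, so v is orthogonal to itself.\<close>

lemma polynomial_moments_separate:
  fixes v :: "real^'d \<Rightarrow> real"
  assumes Y: "open Y" "bounded Y" and v: "v \<in> L2_space Y" "AE x\<in>Y in lebesgue. v x = P x" and P: "P \<in> poly_space r"
    and mom: "\<And>m. (\<Sum>i\<in>UNIV. m i) \<le> r \<Longrightarrow> L2_inner Y v (monom_fun m) = 0"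
  shows "AE x\<in>Y in lebesgue. v x = 0"
proof -
  have L2: "Q \<in> L2_space Y" if "Q \<in> poly_space r" for Q
    using poly_space_continuous[OF that] Y by (intro L2_continuous_bounded) auto
  have "L2_inner Y v P = 0" using P
  proof (induction rule: poly_space_induct)
    case (comb Q R a)
    then show ?case using L2_inner_comb_right[OF v(1) L2 L2, of Q R a] by simp
  qed (rule mom)
  moreover have "L2_inner Y v v = L2_inner Y v P" by (rule L2_inner_AE_cong[OF v(1,1) _ v(2)]) simp
  ultimately show ?thesis using L2_inner_self_zero[OF v(1)] by simp
qed

lemma RT_local_nth:
  assumes "R \<in> RT_local p" shows "(\<lambda>x. R x $ i) \<in> poly_space (Suc p)"
proof -
  obtain a b where ab: "\<And>i. (\<lambda>x. a x $ i) \<in> poly_space p" "b \<in> poly_space p" "R = (\<lambda>x. a x + b x *\<^sub>R x)"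
    using assms unfolding RT_local_def by blast
  have "(\<lambda>x. a x $ i + x $ i * b x) \<in> poly_space (Suc p)"
    using ab(1)[of i] poly_space_mono[of p "Suc p"] by (intro poly_space_add poly_space_mult_coord ab(2)) auto
  then show ?thesis by (simp add: ab(3) mult.commute)
qed

lemma L2_nth:
  fixes v :: "real^'d \<Rightarrow> real^'d"
  assumes v: "v \<in> L2_space X" shows "(\<lambda>x. v x $ i) \<in> L2_space X"
proof (rule L2_dominated[OF _ L2_spaceD(2)[OF v]])
  have "(\<lambda>x. indicator X x *\<^sub>R v x $ i) = (\<lambda>x. (indicator X x *\<^sub>R v x) \<bullet> axis i 1)" by (simp add: inner_axis)
  then show "(\<lambda>x. indicator X x *\<^sub>R v x $ i) \<in> borel_measurable lebesgue"
    using borel_measurable_inner[OF L2_spaceD(1)[OF v] borel_measurable_const[of "axis i 1"]] by simp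
  have "(v x $ i)\<^sup>2 \<le> (norm (v x))\<^sup>2" for x using component_le_norm_cart[of "v x" i] by (intro abs_le_square_iff[THEN iffD1]) simp
  then show "AE x\<in>X in lebesgue. (norm (v x $ i))\<^sup>2 \<le> (norm (indicator X x *\<^sub>R v x))\<^sup>2"
    by (intro AE_I2) simp
qed simp

section \<open>The three equations as one symmetric form\<close>

locale mixed_problem = meshed_domain \<Omega> \<T> for \<Omega> :: "(real^'d) set" and \<T> +
  fixes \<omega> :: "(real^'d) set" and \<gamma> :: "real^'d \<Rightarrow> real" and \<alpha> :: real and k p :: nat and c C :: real
  assumes \<omega>: "open \<omega>" "\<omega> \<noteq> {}" "\<omega> \<subseteq> \<Omega>"
    and \<gamma>_meas: "(\<lambda>x. indicator \<Omega> x *\<^sub>R \<gamma> x) \<in> borel_measurable lebesgue"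
    and \<gamma>_bounds: "c > 0" "AE x\<in>\<Omega> in lebesgue. c \<le> \<gamma> x" "AE x\<in>\<Omega> in lebesgue. \<bar>\<gamma> x\<bar> \<le> C"
    and \<alpha>: "\<alpha> > 0"
begin

abbreviation "V \<equiv> V_space \<Omega> \<T> k"
abbreviation "RT \<equiv> RT_space \<Omega> \<T> p"
abbreviation "X \<equiv> X_space \<Omega> \<T> p"
abbreviation "g \<equiv> weak_grad \<Omega>"
abbreviation "dv \<equiv> weak_div \<Omega>"

definition "M v = (\<lambda>x. \<gamma> x *\<^sub>R (v x :: real^'d))"
definition "N v = (\<lambda>x. inverse (\<gamma> x) *\<^sub>R (v x :: real^'d))"

lemma M_L2: "v \<in> L2_space \<Omega> \<Longrightarrow> M v \<in> L2_space \<Omega>"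
  unfolding M_def by (rule L2_bounded_mult[OF \<gamma>_meas \<gamma>_bounds(3)])

lemma N_L2:
  assumes "v \<in> L2_space \<Omega>" shows "N v \<in> L2_space \<Omega>"
  unfolding N_def
proof (rule L2_bounded_mult[OF _ _ assms])
  have "(\<lambda>x. indicator \<Omega> x *\<^sub>R inverse (\<gamma> x)) = (\<lambda>x. inverse (indicator \<Omega> x *\<^sub>R \<gamma> x))" by (auto simp: indicator_def)
  then show "(\<lambda>x. indicator \<Omega> x *\<^sub>R inverse (\<gamma> x)) \<in> borel_measurable lebesgue"
    using borel_measurable_inverse[OF \<gamma>_meas] by simp
  show "AE x\<in>\<Omega> in lebesgue. \<bar>inverse (\<gamma> x)\<bar> \<le> inverse c"
    using \<gamma>_bounds(2) by eventually_elim (use \<gamma>_bounds(1) in \<open>auto intro!: le_imp_inverse_le\<close>)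
qed

lemma V_L2: "u \<in> V \<Longrightarrow> u \<in> L2_space \<Omega>" "u \<in> V \<Longrightarrow> g u \<in> L2_space \<Omega>"
  and RT_L2: "\<sigma> \<in> RT \<Longrightarrow> \<sigma> \<in> L2_space \<Omega>" "\<sigma> \<in> RT \<Longrightarrow> dv \<sigma> \<in> L2_space \<Omega>"
  and X_L2: "z \<in> X \<Longrightarrow> z \<in> L2_space \<Omega>"
  using H1_weak_grad(2)[OF open_dom] Hdiv_weak_div(2)[OF open_dom]
  by (auto simp: V_space_def RT_space_def X_space_def H1_space_def Hdiv_space_def)

lemma \<omega>_L2:
  fixes v :: "real^'d \<Rightarrow> 'b::euclidean_space"
  shows "v \<in> L2_space \<Omega> \<Longrightarrow> v \<in> L2_space \<omega>"
  using L2_subset[OF _ \<omega>(3)] \<omega>(1) by simp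

definition W :: "((real^'d \<Rightarrow> real) \<times> (real^'d \<Rightarrow> real^'d) \<times> (real^'d \<Rightarrow> real)) set" where
  "W = V \<times> RT \<times> X"

definition comb3 :: "real \<Rightarrow> (real^'d \<Rightarrow> real) \<times> (real^'d \<Rightarrow> real^'d) \<times> (real^'d \<Rightarrow> real) \<Rightarrow>
    (real^'d \<Rightarrow> real) \<times> (real^'d \<Rightarrow> real^'d) \<times> (real^'d \<Rightarrow> real) \<Rightarrow>
    (real^'d \<Rightarrow> real) \<times> (real^'d \<Rightarrow> real^'d) \<times> (real^'d \<Rightarrow> real)" where
  "comb3 a = (\<lambda>(u, \<sigma>, z) (v, \<tau>, y). (\<lambda>x. u x + a * v x, \<lambda>x. \<sigma> x + a *\<^sub>R \<tau> x, \<lambda>x. z x + a * y x))"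

text \<open>The sum of the three left-hand sides; the test field - \<tau> and the signs of the
  divergence terms are what makes it symmetric.\<close>

definition form :: "(real^'d \<Rightarrow> real) \<times> (real^'d \<Rightarrow> real^'d) \<times> (real^'d \<Rightarrow> real) \<Rightarrow>
    (real^'d \<Rightarrow> real) \<times> (real^'d \<Rightarrow> real^'d) \<times> (real^'d \<Rightarrow> real) \<Rightarrow> real" where
  "form = (\<lambda>(u, \<sigma>, z) (v, \<tau>, y). L2_inner \<Omega> (M (g u)) (g v) - L2_inner \<Omega> \<sigma> (g v) - L2_inner \<Omega> (g u) \<tau>
      + L2_inner \<Omega> (N \<sigma>) \<tau> + \<alpha> * L2_inner \<omega> u v - L2_inner \<Omega> (dv \<tau>) z - L2_inner \<Omega> (dv \<sigma>) y)"

lemma comb3_closed: "comb_closed comb3 W"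
  unfolding comb_closed_def W_def comb3_def
  by (auto intro: V_space_comb RT_space_comb X_space_comb open_dom)

lemma zero_V: "(\<lambda>x. 0) \<in> V" and zero_RT: "(\<lambda>x. 0) \<in> RT" and zero_X: "(\<lambda>x. 0) \<in> X"
proof -
  have wg: "has_weak_grad \<Omega> (\<lambda>x. 0) (\<lambda>x. 0)" and wd: "has_weak_div \<Omega> (\<lambda>x. 0) (\<lambda>x. 0)"
    by (auto simp: has_weak_grad_alt has_weak_div_alt L2_locally_integrable[OF L2_zero])
  show "(\<lambda>x. 0) \<in> X"
    by (auto simp: X_space_def L2_zero poly_space_zero intro!: bexI[of _ "\<lambda>x. 0"])
  show "(\<lambda>x. 0) \<in> V" using wg
    by (auto simp: V_space_def H1_space_def X_space_def L2_zero poly_space_zero intro!: bexI[of _ "\<lambda>x. 0"])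
  show "(\<lambda>x. 0) \<in> RT" using wd
    by (auto simp: RT_space_def Hdiv_space_def L2_zero zero_RT_local intro!: bexI[of _ "\<lambda>x. 0"])
qed

lemma g_zero:
  assumes "u \<in> V" "AE x\<in>\<Omega> in lebesgue. u x = 0" shows "AE x\<in>\<Omega> in lebesgue. g u x = 0"
proof -
  have "u \<in> H1_space \<Omega>" using assms(1) by (simp add: V_space_def)
  from weak_grad_classical[OF H1_weak_grad(1)[OF open_dom this] open_dom order_refl assms(2), of "\<lambda>x. 0"]
  show ?thesis by (auto intro!: has_derivative_eq_rhs[OF has_derivative_const] simp: fun_eq_iff)
qed

lemma dv_zero:
  assumes "\<sigma> \<in> RT" "AE x\<in>\<Omega> in lebesgue. \<sigma> x = 0" shows "AE x\<in>\<Omega> in lebesgue. dv \<sigma> x = 0"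
proof -
  have "\<sigma> \<in> Hdiv_space \<Omega>" using assms(1) by (simp add: RT_space_def)
  from weak_div_classical[OF Hdiv_weak_div(1)[OF open_dom this] open_dom order_refl assms(2), of "\<lambda>i x. 0"]
  show ?thesis by (auto intro!: has_derivative_eq_rhs[OF has_derivative_const] simp: fun_eq_iff)
qed

lemma g_comb:
  assumes "u \<in> V" "v \<in> V" "w \<in> L2_space \<Omega>"
  shows "L2_inner \<Omega> (g (\<lambda>x. u x + a * v x)) w = L2_inner \<Omega> (g u) w + a * L2_inner \<Omega> (g v) w"
    "L2_inner \<Omega> (M (g (\<lambda>x. u x + a * v x))) w = L2_inner \<Omega> (M (g u)) w + a * L2_inner \<Omega> (M (g v)) w"
proof -
  have ae: "AE x\<in>\<Omega> in lebesgue. g (\<lambda>x. u x + a * v x) x = g u x + a *\<^sub>R g v x"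
    using H1_comb(2)[OF open_dom] assms by (simp add: V_space_def)
  have L2: "g (\<lambda>x. u x + a * v x) \<in> L2_space \<Omega>" using V_L2 V_space_comb[OF open_dom assms(1,2)] by blast
  have "L2_inner \<Omega> (g (\<lambda>x. u x + a * v x)) w = L2_inner \<Omega> (\<lambda>x. g u x + a *\<^sub>R g v x) w"
    using ae by (intro L2_inner_AE_cong L2 assms) auto
  then show "L2_inner \<Omega> (g (\<lambda>x. u x + a * v x)) w = L2_inner \<Omega> (g u) w + a * L2_inner \<Omega> (g v) w"
    using L2_inner_comb[OF assms(3) V_L2(2)[OF assms(1)] V_L2(2)[OF assms(2)]] by simp
  have "L2_inner \<Omega> (M (g (\<lambda>x. u x + a * v x))) w = L2_inner \<Omega> (\<lambda>x. M (g u) x + a *\<^sub>R M (g v) x) w"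
  proof (intro L2_inner_AE_cong M_L2 L2 assms)
    show "AE x\<in>\<Omega> in lebesgue. M (g (\<lambda>x. u x + a * v x)) x = M (g u) x + a *\<^sub>R M (g v) x"
      using ae by eventually_elim (simp add: M_def algebra_simps)
  qed simp
  then show "L2_inner \<Omega> (M (g (\<lambda>x. u x + a * v x))) w = L2_inner \<Omega> (M (g u)) w + a * L2_inner \<Omega> (M (g v)) w"
    using L2_inner_comb[OF assms(3) M_L2[OF V_L2(2)[OF assms(1)]] M_L2[OF V_L2(2)[OF assms(2)]]] by simp
qed

lemma dv_comb:
  assumes "\<sigma> \<in> RT" "\<tau> \<in> RT" "w \<in> L2_space \<Omega>"
  shows "L2_inner \<Omega> (dv (\<lambda>x. \<sigma> x + a *\<^sub>R \<tau> x)) w = L2_inner \<Omega> (dv \<sigma>) w + a * L2_inner \<Omega> (dv \<tau>) w"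
proof -
  have ae: "AE x\<in>\<Omega> in lebesgue. dv (\<lambda>x. \<sigma> x + a *\<^sub>R \<tau> x) x = dv \<sigma> x + a * dv \<tau> x"
    using Hdiv_comb(2)[OF open_dom] assms by (simp add: RT_space_def)
  have L2: "dv (\<lambda>x. \<sigma> x + a *\<^sub>R \<tau> x) \<in> L2_space \<Omega>" using RT_L2 RT_space_comb[OF open_dom assms(1,2)] by blast
  have "L2_inner \<Omega> (dv (\<lambda>x. \<sigma> x + a *\<^sub>R \<tau> x)) w = L2_inner \<Omega> (\<lambda>x. dv \<sigma> x + a *\<^sub>R dv \<tau> x) w"
    using ae by (intro L2_inner_AE_cong L2 assms) auto
  then show ?thesis
    using L2_inner_comb[OF assms(3) RT_L2(2)[OF assms(1)] RT_L2(2)[OF assms(2)]] by simp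
qed

lemma form_linear:
  assumes "w' \<in> W" shows "comb_linear comb3 W (\<lambda>w. form w w')"
  unfolding comb_linear_def
proof (intro allI ballI)
  fix a w1 w2 assume W12: "w1 \<in> W" "w2 \<in> W"
  obtain v \<tau> y where w': "w' = (v, \<tau>, y)" "v \<in> V" "\<tau> \<in> RT" "y \<in> X" using assms by (auto simp: W_def)
  obtain u \<sigma> z where w1: "w1 = (u, \<sigma>, z)" "u \<in> V" "\<sigma> \<in> RT" "z \<in> X" using W12 by (auto simp: W_def)
  obtain u' \<sigma>' z' where w2: "w2 = (u', \<sigma>', z')" "u' \<in> V" "\<sigma>' \<in> RT" "z' \<in> X" using W12 by (auto simp: W_def)
  note L2 = V_L2[OF w'(2)] RT_L2[OF w'(3)] X_L2[OF w'(4)] V_L2[OF w1(2)] RT_L2[OF w1(3)] X_L2[OF w1(4)]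
    V_L2[OF w2(2)] RT_L2[OF w2(3)] X_L2[OF w2(4)]
  have 1: "L2_inner \<Omega> (\<lambda>x. \<sigma> x + a *\<^sub>R \<sigma>' x) (g v) = L2_inner \<Omega> \<sigma> (g v) + a * L2_inner \<Omega> \<sigma>' (g v)"
    by (rule L2_inner_comb) (use L2 in auto)
  have "N (\<lambda>x. \<sigma> x + a *\<^sub>R \<sigma>' x) = (\<lambda>x. N \<sigma> x + a *\<^sub>R N \<sigma>' x)" by (simp add: N_def fun_eq_iff algebra_simps)
  then have 2: "L2_inner \<Omega> (N (\<lambda>x. \<sigma> x + a *\<^sub>R \<sigma>' x)) \<tau> = L2_inner \<Omega> (N \<sigma>) \<tau> + a * L2_inner \<Omega> (N \<sigma>') \<tau>"
    using L2 N_L2 by (simp add: L2_inner_comb)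
  have 3: "L2_inner \<omega> (\<lambda>x. u x + a * u' x) v = L2_inner \<omega> u v + a * L2_inner \<omega> u' v"
    using L2_inner_comb[OF \<omega>_L2[OF L2(1)] \<omega>_L2[OF L2(6)] \<omega>_L2[OF L2(11)], of a] by simp
  have 4: "L2_inner \<Omega> (dv \<tau>) (\<lambda>x. z x + a * z' x) = L2_inner \<Omega> (dv \<tau>) z + a * L2_inner \<Omega> (dv \<tau>) z'"
    using L2_inner_comb_right[of "dv \<tau>" \<Omega> z z' a] L2 by simp
  show "form (comb3 a w1 w2) w' = form w1 w' + a * form w2 w'"
    unfolding w'(1) w1(1) w2(1) form_def comb3_def prod.case
    unfolding 1 2 3 4 g_comb(1)[OF w1(2) w2(2) L2(3)] g_comb(2)[OF w1(2) w2(2) L2(2)] dv_comb[OF w1(3) w2(3) L2(5)]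
    by (simp add: algebra_simps)
qed

lemma form_symmetric: "form w w' = form w' w"
proof -
  have "L2_inner \<Omega> (M a) b = L2_inner \<Omega> (M b) a" "L2_inner \<Omega> (N a) b = L2_inner \<Omega> (N b) a" for a b
    by (simp_all add: L2_inner_def M_def N_def inner_commute)
  then show ?thesis
    by (cases w; cases w') (simp add: form_def L2_inner_commute)
qed

text \<open>Representatives of zero are invisible to the form, although their weak gradients and
  divergences are separately chosen functions. With the separating moments this bounds the rank of
  the form.\<close>

lemma form_zero:
  assumes "(u, \<sigma>, z) \<in> W" "w' \<in> W"
    and "AE x\<in>\<Omega> in lebesgue. u x = 0" "AE x\<in>\<Omega> in lebesgue. \<sigma> x = 0" "AE x\<in>\<Omega> in lebesgue. z x = 0"
  shows "form (u, \<sigma>, z) w' = 0"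
proof -
  have w: "u \<in> V" "\<sigma> \<in> RT" "z \<in> X" using assms(1) by (auto simp: W_def)
  obtain v \<tau> y where w': "w' = (v, \<tau>, y)" "v \<in> V" "\<tau> \<in> RT" "y \<in> X" using assms(2) by (auto simp: W_def)
  note gz = g_zero[OF w(1) assms(3)] and dz = dv_zero[OF w(2) assms(4)]
  have Mz: "AE x\<in>\<Omega> in lebesgue. M (g u) x = 0" using gz by eventually_elim (simp add: M_def)
  have Nz: "AE x\<in>\<Omega> in lebesgue. N \<sigma> x = 0" using assms(4) by eventually_elim (simp add: N_def)
  have uz: "AE x\<in>\<omega> in lebesgue. u x = 0" using assms(3) by eventually_elim (use \<omega>(3) in auto)
  note L2 = V_L2[OF w'(2)] RT_L2[OF w'(3)] X_L2[OF w'(4)] V_L2[OF w(1)] RT_L2[OF w(2)] X_L2[OF w(3)]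
  show ?thesis unfolding w'(1) form_def prod.case
    using L2_inner_zero_left[OF M_L2[OF L2(7)] L2(2) Mz] L2_inner_zero_left[OF L2(8) L2(2) assms(4)]
      L2_inner_zero_left[OF L2(7) L2(3) gz] L2_inner_zero_left[OF N_L2[OF L2(8)] L2(3) Nz]
      L2_inner_zero_left[OF \<omega>_L2[OF L2(6)] \<omega>_L2[OF L2(1)] uz] L2_inner_zero_right[OF L2(4) L2(10) assms(5)]
      L2_inner_zero_left[OF L2(9) L2(5) dz] by simp
qed

text \<open>Zero components in the test triple isolate the equations one at a time: the third gives
  div \<sigma> = 0, the first two together give the energy identity, and once u and \<sigma> vanish
  the second says that z is orthogonal to all divergences.\<close>

lemma form_nondegenerate:
  assumes w: "(u, \<sigma>, z) \<in> W" and zero: "\<And>w'. w' \<in> W \<Longrightarrow> form (u, \<sigma>, z) w' = 0"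
  shows "AE x\<in>\<Omega> in lebesgue. u x = 0" "AE x\<in>\<Omega> in lebesgue. \<sigma> x = 0" "AE x\<in>\<Omega> in lebesgue. z x = 0"
proof -
  have w': "u \<in> V" "\<sigma> \<in> RT" "z \<in> X" using w by (auto simp: W_def)
  note L2 = V_L2[OF w'(1)] RT_L2[OF w'(2)] X_L2[OF w'(3)]
  have g0: "AE x\<in>\<Omega> in lebesgue. g (\<lambda>x. 0) x = 0" "g (\<lambda>x. 0) \<in> L2_space \<Omega>" using g_zero[OF zero_V] V_L2(2)[OF zero_V] by auto
  have d0: "AE x\<in>\<Omega> in lebesgue. dv (\<lambda>x. 0) x = 0" "dv (\<lambda>x. 0) \<in> L2_space \<Omega>" using dv_zero[OF zero_RT] RT_L2(2)[OF zero_RT] by auto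
  have z0: "L2_inner Y a (\<lambda>x. 0) = 0" for Y :: "(real^'d) set" and a :: "real^'d \<Rightarrow> 'b::euclidean_space" by (simp add: L2_inner_def)
  have div0: "L2_inner \<Omega> (dv \<sigma>) y = 0" if "y \<in> X" for y
  proof -
    have "(\<lambda>x. 0, \<lambda>x. 0, y) \<in> W" using that zero_V zero_RT by (simp add: W_def)
    from zero[OF this] show ?thesis
      using L2_inner_zero_right[OF M_L2[OF L2(2)] g0(2,1)] L2_inner_zero_right[OF L2(3) g0(2,1)]
        L2_inner_zero_left[OF d0(2) L2(5) d0(1)] by (simp add: form_def z0)
  qed
  \<comment> \<open>The divergence itself is an admissible test function for the third
    equation.\<close>
  have "L2_inner \<Omega> (dv \<sigma>) (dv \<sigma>) = 0" by (rule div0[OF weak_div_in_X_space[OF w'(2)]])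
  then have dz: "AE x\<in>\<Omega> in lebesgue. dv \<sigma> x = 0" by (rule L2_inner_self_zero[OF L2(4)])
  \<comment> \<open>The completed square: (\<gamma>^-1 e, e) is the sum of the first three energy
    terms.\<close>
  define e where "e x = M (g u) x - \<sigma> x" for x
  have eL2: "e \<in> L2_space \<Omega>" unfolding e_def by (intro L2_diff M_L2 L2)
  have pos: "AE x\<in>\<Omega> in lebesgue. \<gamma> x > 0" using \<gamma>_bounds(2) by eventually_elim (use \<gamma>_bounds(1) in auto)
  have "(u, \<sigma>, \<lambda>x. 0) \<in> W" using w' zero_X by (simp add: W_def)
  \<comment> \<open>The zero last component removes one divergence term; the other is (div \<sigma>,
    z), which \<open>div0\<close> removes.\<close>
  from zero[OF this] have energy: "L2_inner \<Omega> (M (g u)) (g u) - 2 * L2_inner \<Omega> \<sigma> (g u) + L2_inner \<Omega> (N \<sigma>) \<sigma> + \<alpha> * L2_inner \<omega> u u = 0"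
    using div0[OF w'(3)] by (simp add: form_def z0 L2_inner_commute[of \<Omega> "g u" \<sigma>])
  have "L2_inner \<Omega> (N e) e = L2_inner \<Omega> (M (g u)) (g u) - 2 * L2_inner \<Omega> \<sigma> (g u) + L2_inner \<Omega> (N \<sigma>) \<sigma>"
  proof -
    note i = L2_inner_integrable[OF M_L2[OF L2(2)] L2(2)] L2_inner_integrable[OF L2(3) L2(2)] L2_inner_integrable[OF N_L2[OF L2(3)] L2(3)]
    have "L2_inner \<Omega> (N e) e = (LINT x:\<Omega>|lebesgue. (M (g u) x \<bullet> g u x - 2 * (\<sigma> x \<bullet> g u x)) + N \<sigma> x \<bullet> \<sigma> x)"
      unfolding L2_inner_def
    proof (rule set_integral_AE_cong)
      show "(\<lambda>x. indicat_real \<Omega> x *\<^sub>R (N e x \<bullet> e x)) \<in> borel_measurable lebesgue"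
        using L2_inner_integrable[OF N_L2[OF eL2] eL2] by (auto simp: set_integrable_def)
      show "AE x\<in>\<Omega> in lebesgue. N e x \<bullet> e x = (M (g u) x \<bullet> g u x - 2 * (\<sigma> x \<bullet> g u x)) + N \<sigma> x \<bullet> \<sigma> x"
        using pos by eventually_elim (auto simp: N_def M_def e_def inner_diff_left inner_diff_right inner_commute field_simps)
    qed
    then show ?thesis using i by (simp add: L2_inner_def)
  qed
  moreover have Ne: "AE x in lebesgue. 0 \<le> indicator \<Omega> x *\<^sub>R (N e x \<bullet> e x)"
    using pos by eventually_elim (auto simp: N_def indicator_def)
  then have "L2_inner \<Omega> (N e) e \<ge> 0" unfolding L2_inner_def set_lebesgue_integral_def by (rule integral_nonneg_AE)
  moreover have "\<alpha> * L2_inner \<omega> u u \<ge> 0" using \<alpha> L2_inner_self_nonneg[of \<omega> u] by simp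
  ultimately have Ne0: "L2_inner \<Omega> (N e) e = 0" and "\<alpha> * L2_inner \<omega> u u = 0" using energy by linarith+
  then have u\<omega>: "AE x\<in>\<omega> in lebesgue. u x = 0" using \<alpha> L2_inner_self_zero[OF \<omega>_L2[OF L2(1)]] by simp
  have "AE x in lebesgue. indicator \<Omega> x *\<^sub>R (N e x \<bullet> e x) = 0"
    using integral_nonneg_eq_0_iff_AE[OF L2_inner_integrable[OF N_L2[OF eL2] eL2, unfolded set_integrable_def] Ne] Ne0
    by (simp add: L2_inner_def set_lebesgue_integral_def)
  then have e0: "AE x\<in>\<Omega> in lebesgue. \<sigma> x = M (g u) x"
    using pos by eventually_elim (auto simp: N_def e_def)
  show uz: "AE x\<in>\<Omega> in lebesgue. u x = 0"
  proof (rule unique_continuation[OF w'(1) pos M_L2[OF L2(2), unfolded M_def] _ \<omega> u\<omega>])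
    fix \<phi> assume \<phi>: "\<phi> \<in> test_functions \<Omega>"
    have "\<sigma> \<in> Hdiv_space \<Omega>" using w'(2) by (simp add: RT_space_def)
    then have wd: "has_weak_div \<Omega> \<sigma> (dv \<sigma>)" by (rule Hdiv_weak_div(1)[OF open_dom])
    then have li: "locally_integrable \<Omega> \<sigma>" "locally_integrable \<Omega> (dv \<sigma>)" by (auto simp: has_weak_div_alt)
    obtain K where K: "K \<subseteq> \<Omega>" "\<And>x. x \<notin> K \<Longrightarrow> \<phi> x = 0" "\<And>x. x \<notin> K \<Longrightarrow> grad \<phi> x = 0"
      by (rule test_functionE[OF \<phi>]) (rule that; simp)
    have K0: "\<phi> x = 0" "grad \<phi> x = 0" if "x \<notin> \<Omega>" for x using that K by blast+
    have ae: "AE x in lebesgue. (\<gamma> x *\<^sub>R g u x) \<bullet> grad \<phi> x = \<sigma> x \<bullet> grad \<phi> x"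
      using e0 by eventually_elim (use K0 in \<open>auto simp: M_def\<close>)
    have "(LINT x|lebesgue. (\<gamma> x *\<^sub>R g u x) \<bullet> grad \<phi> x) = (LINT x|lebesgue. \<sigma> x \<bullet> grad \<phi> x)"
      using test_inner_integrable(1)[OF li(1) \<phi>]
        test_inner_integrable(1)[OF L2_locally_integrable[OF M_L2[OF L2(2), unfolded M_def]] \<phi>] ae
      by (intro integral_cong_AE) auto
    also have "\<dots> = - (LINT x|lebesgue. dv \<sigma> x * \<phi> x)" using wd \<phi> by (auto simp: has_weak_div_alt)
    also have "(LINT x|lebesgue. dv \<sigma> x * \<phi> x) = (LINT x|lebesgue. 0 * \<phi> x)"
      by (rule integral_test_AE_cong[OF dz K0(1) test_integrable(1)[OF li(2) \<phi>]])
    finally show "(LINT x|lebesgue. (\<gamma> x *\<^sub>R g u x) \<bullet> grad \<phi> x) = 0" by simp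
  qed
  have gz: "AE x\<in>\<Omega> in lebesgue. g u x = 0" by (rule g_zero[OF w'(1) uz])
  show \<sigma>z: "AE x\<in>\<Omega> in lebesgue. \<sigma> x = 0" using gz e0 by eventually_elim (auto simp: M_def)
  have Nz: "AE x\<in>\<Omega> in lebesgue. N \<sigma> x = 0" using \<sigma>z by eventually_elim (simp add: N_def)
  show "AE x\<in>\<Omega> in lebesgue. z x = 0"
  proof (rule multiplier_zero[OF w'(3)])
    fix \<tau> assume \<tau>: "\<tau> \<in> RT"
    have "(\<lambda>x. 0, \<tau>, \<lambda>x. 0) \<in> W" using \<tau> zero_V zero_X by (simp add: W_def)
    from zero[OF this] show "L2_inner \<Omega> (dv \<tau>) z = 0"
      using L2_inner_zero_right[OF M_L2[OF L2(2)] g0(2,1)] L2_inner_zero_right[OF L2(3) g0(2,1)]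
        L2_inner_zero_left[OF L2(2) RT_L2(1)[OF \<tau>] gz] L2_inner_zero_left[OF N_L2[OF L2(3)] RT_L2(1)[OF \<tau>] Nz]
      by (simp add: form_def z0)
  qed
qed

definition load :: "(real^'d \<Rightarrow> real) \<Rightarrow> (real^'d \<Rightarrow> real) \<Rightarrow>
    (real^'d \<Rightarrow> real) \<times> (real^'d \<Rightarrow> real^'d) \<times> (real^'d \<Rightarrow> real) \<Rightarrow> real" where
  "load f q = (\<lambda>(v, \<tau>, y). \<alpha> * L2_inner \<omega> q v + L2_inner \<Omega> f y)"

text \<open>Triples with two zero components recover the separate equations from the summed one. The
  chosen derivatives of the zero function vanish only almost everywhere, hence the auxiliary facts
  about them.\<close>

lemma discrete_solution_iff:
  assumes f: "f \<in> L2_space \<Omega>"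
  shows "discrete_solution \<Omega> \<omega> \<T> k p \<gamma> \<alpha> f q u \<sigma> z \<longleftrightarrow>
    (u, \<sigma>, z) \<in> W \<and> (\<forall>w'\<in>W. form (u, \<sigma>, z) w' = load f q w')"
proof (cases "(u, \<sigma>, z) \<in> W")
  case False
  then show ?thesis by (auto simp: discrete_solution_def W_def)
next
  case True
  then have w: "u \<in> V" "\<sigma> \<in> RT" "z \<in> X" by (auto simp: W_def)
  note L2 = V_L2[OF w(1)] RT_L2[OF w(2)] X_L2[OF w(3)]
  define E1 where "E1 v \<longleftrightarrow> L2_inner \<Omega> (\<lambda>x. \<gamma> x *\<^sub>R g u x - \<sigma> x) (g v) + \<alpha> * L2_inner \<omega> u v = \<alpha> * L2_inner \<omega> q v" for v
  define E2 where "E2 \<tau> \<longleftrightarrow> L2_inner \<Omega> (\<lambda>x. g u x - inverse (\<gamma> x) *\<^sub>R \<sigma> x) (\<lambda>x. - \<tau> x) - L2_inner \<Omega> (dv \<tau>) z = 0" for \<tau>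
  define E3 where "E3 y \<longleftrightarrow> - L2_inner \<Omega> (dv \<sigma>) y = L2_inner \<Omega> f y" for y
  have e1: "L2_inner \<Omega> (\<lambda>x. \<gamma> x *\<^sub>R g u x - \<sigma> x) (g v) = L2_inner \<Omega> (M (g u)) (g v) - L2_inner \<Omega> \<sigma> (g v)" if "v \<in> V" for v
    using L2_inner_comb[OF V_L2(2)[OF that] M_L2[OF L2(2)] L2(3), of "-1"] by (simp add: M_def)
  have e2: "L2_inner \<Omega> (\<lambda>x. g u x - inverse (\<gamma> x) *\<^sub>R \<sigma> x) (\<lambda>x. - \<tau> x) = - L2_inner \<Omega> (g u) \<tau> + L2_inner \<Omega> (N \<sigma>) \<tau>" if "\<tau> \<in> RT" for \<tau>
    using L2_inner_comb[OF L2_uminus[OF RT_L2(1)[OF that]] L2(2) N_L2[OF L2(3)], of "-1"]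
      L2_inner_comb_right[OF L2(2) L2_zero RT_L2(1)[OF that], of "-1"]
      L2_inner_comb_right[OF N_L2[OF L2(3)] L2_zero RT_L2(1)[OF that], of "-1"]
      L2_inner_zero_right[OF L2(2) L2_zero] L2_inner_zero_right[OF N_L2[OF L2(3)] L2_zero]
    by (simp add: N_def)
  have form_split: "form (u, \<sigma>, z) (v, \<tau>, y) - load f q (v, \<tau>, y) =
      (L2_inner \<Omega> (\<lambda>x. \<gamma> x *\<^sub>R g u x - \<sigma> x) (g v) + \<alpha> * L2_inner \<omega> u v - \<alpha> * L2_inner \<omega> q v)
      + (L2_inner \<Omega> (\<lambda>x. g u x - inverse (\<gamma> x) *\<^sub>R \<sigma> x) (\<lambda>x. - \<tau> x) - L2_inner \<Omega> (dv \<tau>) z)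
      + (- L2_inner \<Omega> (dv \<sigma>) y - L2_inner \<Omega> f y)" if "v \<in> V" "\<tau> \<in> RT" for v \<tau> y
    using e1[OF that(1)] e2[OF that(2)] by (simp add: form_def load_def)
  have g0: "AE x\<in>\<Omega> in lebesgue. g (\<lambda>x. 0) x = 0" "g (\<lambda>x. 0) \<in> L2_space \<Omega>" using g_zero[OF zero_V] V_L2(2)[OF zero_V] by auto
  have d0: "AE x\<in>\<Omega> in lebesgue. dv (\<lambda>x. 0) x = 0" "dv (\<lambda>x. 0) \<in> L2_space \<Omega>" using dv_zero[OF zero_RT] RT_L2(2)[OF zero_RT] by auto
  have z0: "L2_inner Y a (\<lambda>x. 0) = 0" for Y :: "(real^'d) set" and a :: "real^'d \<Rightarrow> 'b::euclidean_space" by (simp add: L2_inner_def)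
  have gz: "L2_inner \<Omega> (\<lambda>x. \<gamma> x *\<^sub>R g u x - \<sigma> x) (g (\<lambda>x. 0)) = 0"
    by (rule L2_inner_zero_right[OF _ g0(2,1)]) (use L2_diff[OF M_L2[OF L2(2)] L2(3)] in \<open>simp add: M_def\<close>)
  have dz: "L2_inner \<Omega> (dv (\<lambda>x. 0)) z = 0" by (rule L2_inner_zero_left[OF d0(2) L2(5) d0(1)])
  have "(\<forall>w'\<in>W. form (u, \<sigma>, z) w' = load f q w') \<longleftrightarrow> (\<forall>v\<in>V. E1 v) \<and> (\<forall>\<tau>\<in>RT. E2 \<tau>) \<and> (\<forall>y\<in>X. E3 y)"
  proof (intro iffI conjI ballI)
    assume all: "\<forall>w'\<in>W. form (u, \<sigma>, z) w' = load f q w'"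
    show "E1 v" if "v \<in> V" for v
      using form_split[OF that zero_RT, of "\<lambda>x. 0"] all that zero_RT zero_X dz by (simp add: E1_def W_def z0)
    show "E2 \<tau>" if "\<tau> \<in> RT" for \<tau>
      using form_split[OF zero_V that, of "\<lambda>x. 0"] all that zero_V zero_X gz by (simp add: E2_def W_def z0)
    show "E3 y" if "y \<in> X" for y
      using form_split[OF zero_V zero_RT, of y] all that zero_V zero_RT gz dz by (simp add: E3_def W_def z0)
  next
    fix w' assume E: "(\<forall>v\<in>V. E1 v) \<and> (\<forall>\<tau>\<in>RT. E2 \<tau>) \<and> (\<forall>y\<in>X. E3 y)" and "w' \<in> W"
    then obtain v \<tau> y where w': "w' = (v, \<tau>, y)" "v \<in> V" "\<tau> \<in> RT" "y \<in> X" by (auto simp: W_def)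
    then have "E1 v" "E2 \<tau>" "E3 y" using E by auto
    then show "form (u, \<sigma>, z) w' = load f q w'"
      using form_split[OF w'(2,3), of y] unfolding w'(1) E1_def E2_def E3_def by simp
  qed
  then show ?thesis using True w by (simp add: discrete_solution_def E1_def E2_def E3_def)
qed

text \<open>Finite dimensionality without a basis: finitely many functionals that determine a triple
  up to null sets. Components of Raviart-Thomas fields have degree p + 1, hence \<open>Suc p\<close>
  for \<sigma>.\<close>

definition moments :: "((real^'d \<Rightarrow> real) \<times> (real^'d \<Rightarrow> real^'d) \<times> (real^'d \<Rightarrow> real) \<Rightarrow> real) set" where
  "moments = (\<lambda>(T, m) (u, \<sigma>, z). L2_inner (interior T) u (monom_fun m)) ` (\<T> \<times> {m. (\<Sum>i\<in>UNIV. m i) \<le> k})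
     \<union> (\<lambda>(T, m) (u, \<sigma>, z). L2_inner (interior T) z (monom_fun m)) ` (\<T> \<times> {m. (\<Sum>i\<in>UNIV. m i) \<le> p})
     \<union> (\<lambda>(T, m, i) (u, \<sigma>, z). L2_inner (interior T) (\<lambda>x. \<sigma> x $ i) (monom_fun m)) ` (\<T> \<times> {m. (\<Sum>i\<in>UNIV. m i) \<le> Suc p} \<times> UNIV)"

lemma interior_L2:
  fixes v :: "real^'d \<Rightarrow> 'b::euclidean_space"
  assumes "T \<in> \<T>" shows "v \<in> L2_space \<Omega> \<Longrightarrow> v \<in> L2_space (interior T)"
  using L2_subset mesh_element(4)[OF mesh assms] by (metis open_interior borel_open sets_completionI_sets sets_lborel)

lemma monom_L2:
  assumes "T \<in> \<T>" shows "monom_fun m \<in> L2_space (interior T)"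
  using poly_space_continuous[OF monom_in_poly_space[OF order_refl, of m]] mesh_element(1)[OF mesh assms]
  by (intro L2_continuous_bounded) (auto intro: bounded_subset[OF compact_imp_bounded interior_subset])

lemma finite_moments: "finite moments"
  unfolding moments_def using mesh_finite finite_multi_indices by (intro finite_UnI finite_imageI finite_cartesian_product) auto

lemma moments_linear:
  assumes "h \<in> moments" shows "comb_linear comb3 W h"
proof -
  have *: "L2_inner (interior T) (\<lambda>x. a x + s * b x) (monom_fun m) = L2_inner (interior T) a (monom_fun m) + s * L2_inner (interior T) b (monom_fun m)"
    if "T \<in> \<T>" "a \<in> L2_space \<Omega>" "b \<in> L2_space \<Omega>" for T m s and a b :: "real^'d \<Rightarrow> real"
    using L2_inner_comb[OF monom_L2[OF that(1)] interior_L2[OF that(1,2)] interior_L2[OF that(1,3)], of s] by simp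
  show ?thesis using assms
    unfolding moments_def comb_linear_def comb3_def W_def
    by (auto simp: * V_L2 RT_L2 X_L2 L2_nth)
qed

lemma moments_separate:
  assumes w: "(u, \<sigma>, z) \<in> W" and zero: "\<And>h. h \<in> moments \<Longrightarrow> h (u, \<sigma>, z) = 0"
  shows "AE x\<in>\<Omega> in lebesgue. u x = 0" "AE x\<in>\<Omega> in lebesgue. \<sigma> x = 0" "AE x\<in>\<Omega> in lebesgue. z x = 0"
proof -
  have w': "u \<in> V" "\<sigma> \<in> RT" "z \<in> X" using w by (auto simp: W_def)
  have bd: "bounded (interior T)" if "T \<in> \<T>" for T
    using mesh_element(1)[OF mesh that] by (meson bounded_subset compact_imp_bounded interior_subset)
  have int: "AE x\<in>interior T in lebesgue. Q x" if "AE x\<in>T in lebesgue. Q x" for T Q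
    using that by eventually_elim (use interior_subset[of T] in auto)
  show "AE x\<in>\<Omega> in lebesgue. u x = 0"
  proof (rule mesh_AE)
    fix T assume T: "T \<in> \<T>"
    obtain P where P: "P \<in> poly_space k" "AE x\<in>T in lebesgue. u x = P x"
      using w'(1) T by (auto simp: V_space_def X_space_def)
    show "AE x\<in>interior T in lebesgue. u x = 0"
    proof (rule polynomial_moments_separate[OF open_interior bd[OF T] interior_L2[OF T V_L2(1)[OF w'(1)]] int[OF P(2)] P(1)])
      fix m :: "'d \<Rightarrow> nat" assume "(\<Sum>i\<in>UNIV. m i) \<le> k"
      then have "(\<lambda>(u, \<sigma>, z). L2_inner (interior T) u (monom_fun m)) \<in> moments" using T
        unfolding moments_def by (intro UnI1 image_eqI[where x = "(T, m)"]) auto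
      from zero[OF this] show "L2_inner (interior T) u (monom_fun m) = 0" by simp
    qed
  qed
  show "AE x\<in>\<Omega> in lebesgue. z x = 0"
  proof (rule mesh_AE)
    fix T assume T: "T \<in> \<T>"
    obtain P where P: "P \<in> poly_space p" "AE x\<in>T in lebesgue. z x = P x"
      using w'(3) T by (auto simp: X_space_def)
    show "AE x\<in>interior T in lebesgue. z x = 0"
    proof (rule polynomial_moments_separate[OF open_interior bd[OF T] interior_L2[OF T X_L2[OF w'(3)]] int[OF P(2)] P(1)])
      fix m :: "'d \<Rightarrow> nat" assume "(\<Sum>i\<in>UNIV. m i) \<le> p"
      then have "(\<lambda>(u, \<sigma>, z). L2_inner (interior T) z (monom_fun m)) \<in> moments" using T
        unfolding moments_def by (intro UnI1[OF UnI2] image_eqI[where x = "(T, m)"]) auto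
      from zero[OF this] show "L2_inner (interior T) z (monom_fun m) = 0" by simp
    qed
  qed
  show "AE x\<in>\<Omega> in lebesgue. \<sigma> x = 0"
  proof (rule mesh_AE)
    fix T assume T: "T \<in> \<T>"
    obtain R where R: "R \<in> RT_local p" "AE x\<in>T in lebesgue. \<sigma> x = R x"
      using w'(2) T by (auto simp: RT_space_def)
    have "AE x\<in>interior T in lebesgue. \<sigma> x $ i = 0" for i
    proof (rule polynomial_moments_separate[OF open_interior bd[OF T] interior_L2[OF T L2_nth[OF RT_L2(1)[OF w'(2)]]] _ RT_local_nth[OF R(1)]])
      show "AE x\<in>interior T in lebesgue. \<sigma> x $ i = R x $ i" using int[OF R(2)] by eventually_elim auto
      fix m :: "'d \<Rightarrow> nat" assume "(\<Sum>i\<in>UNIV. m i) \<le> Suc p"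
      then have "(\<lambda>(u, \<sigma>, z). L2_inner (interior T) (\<lambda>x. \<sigma> x $ i) (monom_fun m)) \<in> moments" using T
        unfolding moments_def by (intro UnI2 image_eqI[where x = "(T, m, i)"]) auto
      from zero[OF this] show "L2_inner (interior T) (\<lambda>x. \<sigma> x $ i) (monom_fun m) = 0" by simp
    qed
    then show "AE x\<in>interior T in lebesgue. \<sigma> x = 0" by (intro AE_vec_eq) simp
  qed
qed

text \<open>The kernel of the form consists of triples that vanish almost everywhere, and on these
  the load vanishes as well, so the alternative yields a solution for every f and q.\<close>

lemma discrete_solution_exists:
  assumes f: "f \<in> L2_space \<Omega>" and q: "q \<in> L2_space \<omega>"
  shows "\<exists>u \<sigma> z. discrete_solution \<Omega> \<omega> \<T> k p \<gamma> \<alpha> f q u \<sigma> z"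
proof -
  have "\<exists>w\<in>W. \<forall>v\<in>W. form w v = load f q v"
  proof (rule symmetric_form_solvable[of W comb3 moments form "load f q"])
    show "W \<noteq> {}" using zero_V zero_RT zero_X by (auto simp: W_def)
    show "comb_linear comb3 W (load f q)"
      unfolding comb_linear_def load_def comb3_def W_def
      using L2_inner_comb_right[OF q \<omega>_L2[OF V_L2(1)] \<omega>_L2[OF V_L2(1)]] L2_inner_comb_right[OF f X_L2 X_L2]
      by (auto simp: algebra_simps)
    show "form w v = 0" if "w \<in> W" "v \<in> W" "\<And>h. h \<in> moments \<Longrightarrow> h w = 0" for w v
    proof -
      obtain u \<sigma> z where w: "w = (u, \<sigma>, z)" by (cases w)
      show ?thesis unfolding w using that form_zero moments_separate[of u \<sigma> z] by (simp add: w)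
    qed
    show "load f q v = 0" if "v \<in> W" "\<And>w. w \<in> W \<Longrightarrow> form v w = 0" for v
    proof -
      obtain u \<sigma> z where v: "v = (u, \<sigma>, z)" by (cases v)
      have uz: "u \<in> V" "z \<in> X" using that(1) by (auto simp: v W_def)
      have 0: "AE x\<in>\<Omega> in lebesgue. u x = 0" "AE x\<in>\<Omega> in lebesgue. z x = 0"
        using form_nondegenerate[of u \<sigma> z] that by (auto simp: v)
      have "AE x\<in>\<omega> in lebesgue. u x = 0" using 0(1) by eventually_elim (use \<omega>(3) in auto)
      then show ?thesis
        using L2_inner_zero_right[OF q \<omega>_L2[OF V_L2(1)[OF uz(1)]]] L2_inner_zero_right[OF f X_L2[OF uz(2)] 0(2)]
        by (simp add: v load_def)
    qed
  qed (use comb3_closed finite_moments moments_linear form_linear form_symmetric in auto)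
  then show ?thesis using discrete_solution_iff[OF f] by auto
qed

text \<open>The difference of two solutions lies in the kernel of the form.\<close>

lemma discrete_solution_unique:
  assumes f: "f \<in> L2_space \<Omega>"
    and sol: "discrete_solution \<Omega> \<omega> \<T> k p \<gamma> \<alpha> f q u \<sigma> z" "discrete_solution \<Omega> \<omega> \<T> k p \<gamma> \<alpha> f q u' \<sigma>' z'"
  shows "AE x\<in>\<Omega> in lebesgue. u x = u' x \<and> \<sigma> x = \<sigma>' x \<and> z x = z' x"
proof -
  define d where "d = comb3 (-1) (u, \<sigma>, z) (u', \<sigma>', z')"
  have W: "(u, \<sigma>, z) \<in> W" "(u', \<sigma>', z') \<in> W" using sol discrete_solution_iff[OF f] by auto
  have dW: "d \<in> W" unfolding d_def by (rule comb_closedD[OF comb3_closed W])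
  have "form d w' = 0" if "w' \<in> W" for w'
    using comb_linearD[OF form_linear[OF that] W, of "-1"] sol discrete_solution_iff[OF f] that by (simp add: d_def)
  then have "AE x\<in>\<Omega> in lebesgue. u x + (-1) * u' x = 0" "AE x\<in>\<Omega> in lebesgue. \<sigma> x + (-1) *\<^sub>R \<sigma>' x = 0"
    "AE x\<in>\<Omega> in lebesgue. z x + (-1) * z' x = 0"
    using form_nondegenerate[OF dW[unfolded d_def comb3_def prod.case]] unfolding d_def comb3_def prod.case by simp_all
  then show ?thesis by eventually_elim auto
qed

end

theorem mainTheorem1:
  fixes \<Omega> \<omega> :: "(real^'d) set"
    and \<T> :: "(real^'d) set set"
    and \<gamma> f q :: "real^'d \<Rightarrow> real"
    and \<alpha> \<kappa> :: real
    and k p :: nat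
  assumes "CARD('d) \<in> {2, 3}"
    and "polyhedral_domain \<Omega>"
    and "open \<omega>" and "connected \<omega>" and "\<omega> \<subseteq> \<Omega>" and "emeasure lebesgue \<omega> \<noteq> 0"
    and "simplicial_mesh \<Omega> \<T>" and "shape_regular \<kappa> \<T>"
    and "\<gamma> \<in> W1inf_space \<Omega>"
    and "\<exists>c>0. AE x\<in>\<Omega> in lebesgue. c \<le> \<gamma> x"
    and "\<alpha> > 0" and "k \<ge> 1"
    and "f \<in> L2_space \<Omega>" and "q \<in> H1_space \<omega>"
  shows "(\<exists>u \<sigma> z. discrete_solution \<Omega> \<omega> \<T> k p \<gamma> \<alpha> f q u \<sigma> z) \<and>
    (\<forall>u \<sigma> z u' \<sigma>' z'.
       discrete_solution \<Omega> \<omega> \<T> k p \<gamma> \<alpha> f q u \<sigma> z \<and>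
       discrete_solution \<Omega> \<omega> \<T> k p \<gamma> \<alpha> f q u' \<sigma>' z' \<longrightarrow>
       (AE x\<in>\<Omega> in lebesgue. u x = u' x \<and> \<sigma> x = \<sigma>' x \<and> z x = z' x))"
proof -
  obtain c where c: "c > 0" "AE x\<in>\<Omega> in lebesgue. c \<le> \<gamma> x" using assms(10) by blast
  have "\<gamma> \<in> Linf_space \<Omega>" using assms(9) by (simp add: W1inf_space_def)
  then obtain C where C: "(\<lambda>x. indicator \<Omega> x *\<^sub>R \<gamma> x) \<in> borel_measurable lebesgue" "AE x\<in>\<Omega> in lebesgue. \<bar>\<gamma> x\<bar> \<le> C"
    by (auto simp: Linf_space_def set_borel_measurable_def)
  have "\<omega> \<noteq> {}" using assms(6) by auto
  interpret mixed_problem \<Omega> \<T> \<omega> \<gamma> \<alpha> k p c C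
    by unfold_locales (use assms c C \<open>\<omega> \<noteq> {}\<close> in \<open>auto simp: polyhedral_domain_def\<close>)
  have "q \<in> L2_space \<omega>" using assms(14) by (simp add: H1_space_def)
  then show ?thesis using discrete_solution_exists discrete_solution_unique assms(13) by blast
qed

end
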